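(* Let $F$ be a causal operator given by functions $f_t:\mathbb R^{nt}\times\Omega\to\mathbb R^m$, $t=1,\dots,T$, satisfying Assumption 1 (see context), extended to $F:\widetilde{\mathcal X}\to\widetilde{\mathcal Y}$ by the same formula $F_t(x)(\omega)=f_t(x_{1:t}(\omega),\omega)$; for $t=1,\dots,T$ let $Y_t:\Omega\rightrightarrows\mathbb R^m$ and $X_t:\Omega\rightrightarrows\mathbb R^n$ be $\mathcal F_t$-measurable multifunctions with convex and closed values; let $\varphi:\mathcal X\to\mathbb R$ be Lipschitz continuous and let $\widetilde\varphi:\widetilde{\mathcal X}\to\mathbb R$ be a Lipschitz continuous extension of $\varphi$. Suppose the system $$f_t(\zeta_{1:t-1},\xi,\omega)\in Y_t(\omega),\qquad \xi\in X_t(\omega)$$ admits complete subregular recourse (see context). If a policy $\hat x\in\widetilde{\mathcal X}$ is a local minimum of the problem $$\min_{x\in\widetilde{\mathcal X}}\ \widetilde\varphi(x_1,\dots,x_T)\quad\text{s.t.}\quad x_t-\mathbb E_t[x_t]=0\ \text{a.s.},\quad F_t(x_{1:t})\in\widetilde Y_t\ \text{a.s.},\quad x_t\in\widetilde X_t\ \text{a.s.},\quad t=1,\dots,T,$$ then there exist a subgradient $\tilde g\in\partial\widetilde\varphi(\hat x)$, multipliers $\lambda_t\in\widetilde{\mathcal X}_t^*$ and $\widetilde\psi_t\in N_{\widetilde Y_t}(F_t(\hat x_{1:t}))$, $t=1,\dots,T$, and normal elements $\tilde n_t\in N_{\widetilde X_t}(\hat x_t)$, $t=1,\dots,T$, such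 that for $P$-almost all $\omega\in\Omega$ $$\tilde g_t+\lambda_t+\sum_{\ell=t}^T A_{\ell,t}^\top\widetilde\psi_\ell+\tilde n_t=0,\qquad t=1,\dots,T,$$ $$\mathbb E_t[\lambda_t]=0,\qquad t=1,\dots,T.$$
   Context: $(\Omega,\mathcal F,P)$ is a probability space with filtration $\{\emptyset,\Omega\}=\mathcal F_1\subset\dots\subset\mathcal F_T=\mathcal F$; $p\in[1,\infty)$, $1/p+1/q=1$. $\mathcal X_t=L_p(\Omega,\mathcal F_t,P;\mathbb R^n)$, $\mathcal Y_t=L_p(\Omega,\mathcal F_t,P;\mathbb R^m)$, $\mathcal X=\prod_t\mathcal X_t$, $\mathcal Y=\prod_t\mathcal Y_t$. The extended spaces are $\widetilde{\mathcal X}_t=L_p(\Omega,\mathcal F,P;\mathbb R^n)$, $\widetilde{\mathcal Y}_t=L_p(\Omega,\mathcal F,P;\mathbb R^m)$, $\widetilde{\mathcal X}=\prod_t\widetilde{\mathcal X}_t$, $\widetilde{\mathcal Y}=\prod_t\widetilde{\mathcal Y}_t$, all with $L_p$ norms; duals $\widetilde{\mathcal X}_t^*=L_q(\Omega,\mathcal F,P;\mathbb R^n)$, $\widetilde{\mathcal Y}_t^*=L_q(\Omega,\mathcal F,P;\mathbb R^m)$, $\widetilde{\mathcal X}^*=\prod_t\widetilde{\mathcal X}_t^*$, with pairing $\langle y,x\rangle=\int y(\omega)^\top x(\omega)\,P(d\omega)$ (summed over $t$ for the products). $x_{1:t}=(x_1,\dots,x_t)$ and $\mathbb E_t[\cdot]=\mathbb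 E[\cdot\,|\,\mathcal F_t]$. The subspace $\mathcal N=\{x\in\widetilde{\mathcal X}:x_t=\mathbb E_t[x_t],\ t=1,\dots,T\}$ is identified with $\mathcal X$; $\widetilde\varphi$ is an extension of $\varphi$ if $\widetilde\varphi(x)=\varphi(x)$ for all $x\in\mathcal N$. $F:\mathcal X\to\mathcal Y$ is causal if $F=(F_1,\dots,F_T)$ with $F_t(x)(\omega)=f_t(x_{1:t}(\omega),\omega)$ for superpositionally measurable functions $f_t$; one also writes $F_t(x_{1:t})$. Assumption 1: for all $t$: (i) $f_t(\xi,\cdot)\in\mathcal Y_t$ for all $\xi\in\mathbb R^{nt}$; (ii) for almost all $\omega$, $f_t(\cdot,\omega)$ is continuously differentiable with Jacobian $f_t'(\cdot,\omega)$; (iii) there is a constant $C_f$ with $\|f_t'(\cdot,\omega)\|\le C_f$ almost surely. $A_{t,\ell}$ ($1\le\ell\le t\le T$) is the random matrix $A_{t,\ell}(\omega)=\dfrac{\partial f_t(\hat x_{1:t}(\omega),\omega)}{\partial x_\ell(\omega)}$, the partial Jacobian of $f_t(\cdot,\omega)$ with respect to its $\ell$-th $\mathbb R^n$-block, evaluated at $\hat x_{1:t}(\omega)$. $\widetilde X_t=\{x_t\in\widetilde{\mathcal X}_t:x_t(\omega)\in X_t(\omega)\text{ a.s.}\}$, $\widetilde Y_t=\{y_t\in\widetilde{\mathcal Y}_t:y_t(\omega)\in Y_t(\omega)\text{ a.s.}\}$. Normal cones: $N_{\widetilde Y_t}(y)=\{\psi\in\widetilde{\mathcal Y}_t^*:\langle\psi,z-y\rangle\le0\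 \forall z\in\widetilde Y_t\}$, $N_{\widetilde X_t}(x)=\{\nu\in\widetilde{\mathcal X}_t^*:\langle\nu,z-x\rangle\le0\ \forall z\in\widetilde X_t\}$. $\partial\widetilde\varphi(\hat x)\subset\widetilde{\mathcal X}^*$ is the Clarke subdifferential. $\mathsf d$ is the distance to a set in a finite-dimensional space. Complete subregular recourse: there is a constant $C$ such that for every $t=1,\dots,T$, for almost all $\omega\in\Omega$, every $\zeta_{1:t-1}\in X_1(\omega)\times\dots\times X_{t-1}(\omega)$ and every $\eta\in\mathbb R^n$, there exists $\xi$ with $f_t(\zeta_{1:t-1},\xi,\omega)\in Y_t(\omega)$, $\xi\in X_t(\omega)$ and $$\|\xi-\eta\|\le C\big(\mathsf d(f_t(\zeta_{1:t-1},\eta,\omega),Y_t(\omega))+\mathsf d(\eta,X_t(\omega))\big).$$ (For $t=1$ the parameter $\zeta_{1:t-1}$ is absent.) *)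

theory Defs
  imports "HOL-Probability.Probability"
begin

text \<open>
  Stages are indexed by a finite linearly ordered type \<open>'t\<close>, which plays the role of
  \<open>{1, ..., T}\<close>: the first stage is \<open>Min UNIV\<close>, the last one \<open>Max UNIV\<close>.
  A policy is a family \<open>x :: 't \<Rightarrow> 'a \<Rightarrow> real^'n\<close>.  A function of the history
  \<open>x\<^sub>1, ..., x\<^sub>t\<close> is a function on \<open>real^'n^'t\<close> that depends only on the blocks
  \<open>s \<le> t\<close> (predicate \<open>depends_on_history\<close>).  With the Euclidean norm on \<open>real^'n^'t\<close> this
  changes neither differentiability nor the operator norm of the Jacobian.

  Elements of the Lebesgue spaces are represented by functions rather than by equivalence classes
  modulo almost everywhere equality.
\<close>

subsection \<open>Lebesgue spaces\<close>

definition Lspace :: "ennreal \<Rightarrow> 'a measure \<Rightarrow> ('a \<Rightarrow> 'b::euclidean_space) set" where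
  "Lspace r M = {f \<in> borel_measurable M.
     if r = \<infinity> then \<exists>C. AE \<omega> in M. norm (f \<omega>) \<le> C
     else integrable M (\<lambda>\<omega>. norm (f \<omega>) powr enn2real r)}"

definition pairing :: "'a measure \<Rightarrow> ('a \<Rightarrow> 'b::euclidean_space) \<Rightarrow> ('a \<Rightarrow> 'b) \<Rightarrow> real" where
  "pairing M y x = (LINT \<omega>|M. y \<omega> \<bullet> x \<omega>)"

definition policies :: "ennreal \<Rightarrow> 'a measure \<Rightarrow> ('t \<Rightarrow> 'a \<Rightarrow> 'b::euclidean_space) set" where
  "policies r M = {x. \<forall>t. x t \<in> Lspace r M}"

text \<open>
  The \<open>\<sigma>\<close>-algebra \<open>F t\<close> is given as a measure of which only the measurable sets
  matter; \<open>restr_to_subalg M (F t)\<close> carries the restriction of the probability \<open>M\<close>.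
\<close>

definition adapted_policies ::
  "ennreal \<Rightarrow> 'a measure \<Rightarrow> ('t \<Rightarrow> 'a measure) \<Rightarrow> ('t \<Rightarrow> 'a \<Rightarrow> 'b::euclidean_space) set" where
  "adapted_policies r M F = {x. \<forall>t. x t \<in> Lspace r (restr_to_subalg M (F t))}"

definition policy_norm :: "real \<Rightarrow> 'a measure \<Rightarrow> ('t::finite \<Rightarrow> 'a \<Rightarrow> 'b::euclidean_space) \<Rightarrow> real" where
  "policy_norm p M x = (\<Sum>t\<in>UNIV. LINT \<omega>|M. norm (x t \<omega>) powr p) powr (1 / p)"

definition policy_dist ::
  "real \<Rightarrow> 'a measure \<Rightarrow> ('t::finite \<Rightarrow> 'a \<Rightarrow> 'b::euclidean_space) \<Rightarrow> ('t \<Rightarrow> 'a \<Rightarrow> 'b) \<Rightarrow> real" where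
  "policy_dist p M x y = policy_norm p M (\<lambda>t \<omega>. x t \<omega> - y t \<omega>)"

definition Lipschitz_functional ::
  "real \<Rightarrow> 'a measure \<Rightarrow> ('t::finite \<Rightarrow> 'a \<Rightarrow> 'b::euclidean_space) set
     \<Rightarrow> (('t \<Rightarrow> 'a \<Rightarrow> 'b) \<Rightarrow> real) \<Rightarrow> bool" where
  "Lipschitz_functional p M D \<phi> \<longleftrightarrow>
     (\<exists>L. \<forall>x\<in>D. \<forall>y\<in>D. \<bar>\<phi> x - \<phi> y\<bar> \<le> L * policy_dist p M x y)"


subsection \<open>Filtrations and nonanticipativity\<close>

definition stage_filtration ::
  "'a measure \<Rightarrow> ('t::{finite,linorder} \<Rightarrow> 'a measure) \<Rightarrow> bool" where
  "stage_filtration M F \<longleftrightarrow>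
     (\<forall>t. subalgebra M (F t)) \<and> (\<forall>s t. s \<le> t \<longrightarrow> subalgebra (F t) (F s)) \<and>
     sets (F (Min UNIV)) = {{}, space M} \<and> sets (F (Max UNIV)) = sets M"

text \<open>The library's \<open>real_cond_exp\<close> is taken componentwise.\<close>

definition vec_cond_exp :: "'a measure \<Rightarrow> 'a measure \<Rightarrow> ('a \<Rightarrow> real^'n) \<Rightarrow> 'a \<Rightarrow> real^'n" where
  "vec_cond_exp M G x \<omega> = (\<chi> i. real_cond_exp M G (\<lambda>\<omega>. x \<omega> $ i) \<omega>)"

definition nonanticipative_policies ::
  "ennreal \<Rightarrow> 'a measure \<Rightarrow> ('t \<Rightarrow> 'a measure) \<Rightarrow> ('t \<Rightarrow> 'a \<Rightarrow> real^'n) set" where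
  "nonanticipative_policies r M F =
     {x \<in> policies r M. \<forall>t. AE \<omega> in M. x t \<omega> = vec_cond_exp M (F t) (x t) \<omega>}"

text \<open>
  A nonanticipative policy is identified with each adapted policy that it equals almost everywhere.
\<close>

definition is_extension ::
  "ennreal \<Rightarrow> 'a measure \<Rightarrow> ('t \<Rightarrow> 'a measure) \<Rightarrow> (('t \<Rightarrow> 'a \<Rightarrow> real^'n) \<Rightarrow> real)
     \<Rightarrow> (('t \<Rightarrow> 'a \<Rightarrow> real^'n) \<Rightarrow> real) \<Rightarrow> bool" where
  "is_extension r M F \<phi>' \<phi> \<longleftrightarrow>
     (\<forall>x \<in> nonanticipative_policies r M F. \<forall>z \<in> adapted_policies r M F.
        (\<forall>t. AE \<omega> in M. x t \<omega> = z t \<omega>) \<longrightarrow> \<phi>' x = \<phi> z)"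


subsection \<open>Causal operators\<close>

definition depends_on_history :: "'t::{finite,linorder} \<Rightarrow> (('b, 't) vec \<Rightarrow> 'c) \<Rightarrow> bool" where
  "depends_on_history t g \<longleftrightarrow> (\<forall>\<xi> \<zeta>. (\<forall>s\<le>t. \<xi> $ s = \<zeta> $ s) \<longrightarrow> g \<xi> = g \<zeta>)"

definition superpositionally_measurable ::
  "'a measure \<Rightarrow> ('b::euclidean_space \<Rightarrow> 'a \<Rightarrow> 'c::euclidean_space) \<Rightarrow> bool" where
  "superpositionally_measurable G f \<longleftrightarrow>
     (\<forall>x \<in> borel_measurable G. (\<lambda>\<omega>. f (x \<omega>) \<omega>) \<in> borel_measurable G)"

text \<open>
  Measurability with respect to \<open>F t\<close> makes the operator causal on adapted policies;
  measurability with respect to \<open>M\<close> is needed for its extension to all policies.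
\<close>

definition causal ::
  "'a measure \<Rightarrow> ('t::{finite,linorder} \<Rightarrow> 'a measure)
     \<Rightarrow> ('t \<Rightarrow> (real^'n, 't) vec \<Rightarrow> 'a \<Rightarrow> real^'m) \<Rightarrow> bool" where
  "causal M F f \<longleftrightarrow>
     (\<forall>t. (\<forall>\<omega>\<in>space M. depends_on_history t (\<lambda>\<xi>. f t \<xi> \<omega>)) \<and>
          superpositionally_measurable (F t) (f t) \<and> superpositionally_measurable M (f t))"

definition causal_op ::
  "('t::finite \<Rightarrow> (real^'n, 't) vec \<Rightarrow> 'a \<Rightarrow> real^'m) \<Rightarrow> 't \<Rightarrow> ('t \<Rightarrow> 'a \<Rightarrow> real^'n) \<Rightarrow> 'a \<Rightarrow> real^'m" where
  "causal_op f t x \<omega> = f t (\<chi> s. x s \<omega>) \<omega>"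

definition continuously_differentiable ::
  "('b::real_normed_vector \<Rightarrow> 'c::real_normed_vector) \<Rightarrow> bool" where
  "continuously_differentiable g \<longleftrightarrow>
     (\<exists>g' :: 'b \<Rightarrow> 'b \<Rightarrow>\<^sub>L 'c.
        (\<forall>\<xi>. (g has_derivative blinfun_apply (g' \<xi>)) (at \<xi>)) \<and> continuous_on UNIV g')"

definition smoothness_assumption ::
  "ennreal \<Rightarrow> 'a measure \<Rightarrow> ('t::{finite,linorder} \<Rightarrow> 'a measure)
     \<Rightarrow> ('t \<Rightarrow> (real^'n, 't) vec \<Rightarrow> 'a \<Rightarrow> real^'m) \<Rightarrow> bool" where
  "smoothness_assumption r M F f \<longleftrightarrow>
     (\<forall>t \<xi>. f t \<xi> \<in> Lspace r (restr_to_subalg M (F t))) \<and>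
     (\<forall>t. AE \<omega> in M. continuously_differentiable (\<lambda>\<xi>. f t \<xi> \<omega>)) \<and>
     (\<exists>C. \<forall>t. AE \<omega> in M. \<forall>\<xi>. onorm (frechet_derivative (\<lambda>\<zeta>. f t \<zeta> \<omega>) (at \<xi>)) \<le> C)"

definition replace_block :: "'b^'t \<Rightarrow> 't \<Rightarrow> 'b \<Rightarrow> 'b^'t" where
  "replace_block \<zeta> t u = (\<chi> s. if s = t then u else \<zeta> $ s)"

definition partial_jacobian :: "((real^'n, 't) vec \<Rightarrow> real^'m) \<Rightarrow> 't::finite \<Rightarrow> (real^'n, 't) vec \<Rightarrow> real^'n^'m" where
  "partial_jacobian g l \<zeta> = matrix (frechet_derivative (\<lambda>u. g (replace_block \<zeta> l u)) (at (\<zeta> $ l)))"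

definition jacobian_block ::
  "('t::finite \<Rightarrow> (real^'n, 't) vec \<Rightarrow> 'a \<Rightarrow> real^'m) \<Rightarrow> ('t \<Rightarrow> 'a \<Rightarrow> real^'n)
     \<Rightarrow> 't \<Rightarrow> 't \<Rightarrow> 'a \<Rightarrow> real^'n^'m" where
  "jacobian_block f x t l \<omega> = partial_jacobian (\<lambda>\<xi>. f t \<xi> \<omega>) l (\<chi> s. x s \<omega>)"


subsection \<open>Multifunctions, recourse, and the optimization problem\<close>

definition measurable_multifunction :: "'a measure \<Rightarrow> ('a \<Rightarrow> 'b::topological_space set) \<Rightarrow> bool" where
  "measurable_multifunction G S \<longleftrightarrow>
     (\<forall>U. open U \<longrightarrow> {\<omega> \<in> space G. S \<omega> \<inter> U \<noteq> {}} \<in> sets G)"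

definition convex_closed_multifunction ::
  "'a measure \<Rightarrow> ('a \<Rightarrow> 'b::euclidean_space set) \<Rightarrow> bool" where
  "convex_closed_multifunction G S \<longleftrightarrow>
     measurable_multifunction G S \<and> (\<forall>\<omega>\<in>space G. convex (S \<omega>) \<and> closed (S \<omega>))"

definition Lselections ::
  "ennreal \<Rightarrow> 'a measure \<Rightarrow> ('a \<Rightarrow> 'b::euclidean_space set) \<Rightarrow> ('a \<Rightarrow> 'b) set" where
  "Lselections r M S = {y \<in> Lspace r M. AE \<omega> in M. y \<omega> \<in> S \<omega>}"

text \<open>
  Only the blocks of \<open>\<zeta>\<close> before stage \<open>t\<close> are relevant, since block \<open>t\<close> is
  overwritten and \<open>f t\<close> ignores the later ones.
\<close>

definition complete_subregular_recourse ::
  "'a measure \<Rightarrow> ('t::{finite,linorder} \<Rightarrow> (real^'n, 't) vec \<Rightarrow> 'a \<Rightarrow> real^'m)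
     \<Rightarrow> ('t \<Rightarrow> 'a \<Rightarrow> (real^'n) set) \<Rightarrow> ('t \<Rightarrow> 'a \<Rightarrow> (real^'m) set) \<Rightarrow> bool" where
  "complete_subregular_recourse M f X Y \<longleftrightarrow>
     (\<exists>C. \<forall>t. AE \<omega> in M. \<forall>\<zeta>. (\<forall>s<t. \<zeta> $ s \<in> X s \<omega>) \<longrightarrow>
        (\<forall>\<eta>. \<exists>\<xi>. f t (replace_block \<zeta> t \<xi>) \<omega> \<in> Y t \<omega> \<and> \<xi> \<in> X t \<omega> \<and>
           norm (\<xi> - \<eta>) \<le>
             C * (infdist (f t (replace_block \<zeta> t \<eta>) \<omega>) (Y t \<omega>) + infdist \<eta> (X t \<omega>))))"

definition feasible ::
  "ennreal \<Rightarrow> 'a measure \<Rightarrow> ('t::{finite,linorder} \<Rightarrow> 'a measure)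
     \<Rightarrow> ('t \<Rightarrow> (real^'n, 't) vec \<Rightarrow> 'a \<Rightarrow> real^'m)
     \<Rightarrow> ('t \<Rightarrow> 'a \<Rightarrow> (real^'n) set) \<Rightarrow> ('t \<Rightarrow> 'a \<Rightarrow> (real^'m) set)
     \<Rightarrow> ('t \<Rightarrow> 'a \<Rightarrow> real^'n) set" where
  "feasible r M F f X Y = {x \<in> policies r M. \<forall>t.
     (AE \<omega> in M. x t \<omega> - vec_cond_exp M (F t) (x t) \<omega> = 0) \<and>
     causal_op f t x \<in> Lselections r M (Y t) \<and> x t \<in> Lselections r M (X t)}"

definition local_minimum ::
  "real \<Rightarrow> 'a measure \<Rightarrow> (('t::finite \<Rightarrow> 'a \<Rightarrow> 'b::euclidean_space) \<Rightarrow> real)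
     \<Rightarrow> ('t \<Rightarrow> 'a \<Rightarrow> 'b) set \<Rightarrow> ('t \<Rightarrow> 'a \<Rightarrow> 'b) \<Rightarrow> bool" where
  "local_minimum p M \<phi> D x \<longleftrightarrow>
     x \<in> D \<and> (\<exists>\<epsilon>>0. \<forall>y\<in>D. policy_dist p M y x < \<epsilon> \<longrightarrow> \<phi> x \<le> \<phi> y)"


subsection \<open>Normal cones and the Clarke subdifferential\<close>

text \<open>
  Here \<open>q\<close> is the conjugate exponent, so that \<open>Lspace q M\<close> represents the dual space.
\<close>

definition normal_cone ::
  "ennreal \<Rightarrow> 'a measure \<Rightarrow> ('a \<Rightarrow> 'b::euclidean_space) set \<Rightarrow> ('a \<Rightarrow> 'b) \<Rightarrow> ('a \<Rightarrow> 'b) set" where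
  "normal_cone q M S y =
     {\<psi> \<in> Lspace q M. \<forall>z\<in>S. pairing M \<psi> (\<lambda>\<omega>. z \<omega> - y \<omega>) \<le> 0}"

definition policy_nhds ::
  "real \<Rightarrow> 'a measure \<Rightarrow> ('t::finite \<Rightarrow> 'a \<Rightarrow> 'b::euclidean_space) \<Rightarrow> ('t \<Rightarrow> 'a \<Rightarrow> 'b) filter" where
  "policy_nhds p M x =
     (INF \<epsilon>\<in>{0<..}. principal {y \<in> policies (ennreal p) M. policy_dist p M y x < \<epsilon>})"

definition clarke_derivative ::
  "real \<Rightarrow> 'a measure \<Rightarrow> (('t::finite \<Rightarrow> 'a \<Rightarrow> 'b::euclidean_space) \<Rightarrow> real)
     \<Rightarrow> ('t \<Rightarrow> 'a \<Rightarrow> 'b) \<Rightarrow> ('t \<Rightarrow> 'a \<Rightarrow> 'b) \<Rightarrow> ereal" where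
  "clarke_derivative p M \<phi> x v =
     Limsup (policy_nhds p M x \<times>\<^sub>F at_right 0)
       (\<lambda>(y, s). ereal ((\<phi> (\<lambda>t \<omega>. y t \<omega> + s *\<^sub>R v t \<omega>) - \<phi> y) / s))"

definition clarke_subdifferential ::
  "real \<Rightarrow> ennreal \<Rightarrow> 'a measure \<Rightarrow> (('t::finite \<Rightarrow> 'a \<Rightarrow> 'b::euclidean_space) \<Rightarrow> real)
     \<Rightarrow> ('t \<Rightarrow> 'a \<Rightarrow> 'b) \<Rightarrow> ('t \<Rightarrow> 'a \<Rightarrow> 'b) set" where
  "clarke_subdifferential p q M \<phi> x =
     {g \<in> policies q M. \<forall>v \<in> policies (ennreal p) M.
        ereal (\<Sum>t\<in>UNIV. pairing M (g t) (v t)) \<le> clarke_derivative p M \<phi> x v}"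

end

theory Submission
  imports Defs "HOL-Library.Function_Algebras"
begin

text \<open>
  The proof turns the constraints into a penalty and then separates.

  A nonanticipative policy that violates the constraints can be repaired stage by stage: recourse
  corrects the decision of a stage for the history repaired so far, and a measurable selection keeps the
  correction nonanticipative.  Each correction is bounded by the violation at its stage and by the
  earlier corrections, so that pointwise, and therefore in the norm, the distance to a feasible
  policy is at most a constant times the violation (\<open>nonanticipative_error_bound\<close>).
  As the objective is Lipschitz continuous, near a local minimum it cannot decrease along the
  nonanticipative policies faster than a multiple of the violation increases.

  Along a line \<open>x + s v\<close> the violation has a directional rate.  The operator may be replaced by its
  linearization with an error that is small compared to \<open>s\<close>, by dominated convergence, and for
  the linearized path the difference quotients of the distance to a convex-valued multifunction
  decrease, as \<open>s\<close> tends to zero, to a sublinear function of the direction.  The Clarke derivative of the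
  objective is sublinear too.  Hence for all nonanticipative \<open>v\<close> a sum of three sublinear terms, in \<open>v\<close>, in
  the linearization of the operator applied to \<open>v\<close>, and again in \<open>v\<close>, is nonnegative
  (\<open>directional_stationarity\<close>).

  The Hahn-Banach theorem on triples of directions splits this inequality into three linear
  functionals, one below each term (\<open>separated_multipliers\<close>), and the duality of Lebesgue spaces
  represents them by integrable functions \<open>g\<close>, \<open>\<psi>\<close> and \<open>\<nu>\<close>.  A functional below the Clarke derivative is a
  Clarke subgradient; one below a multiple of a distance rate is a normal, because the rate is not
  positive in the direction of a selection.  The multiplier \<open>lam\<close> is what balances the equation; it
  annihilates all nonanticipative policies, which means that its conditional expectations vanish.
\<close>

section \<open>The spaces of \<open>p\<close>-integrable functions\<close>

lemma Lspace_measurable: "f \<in> Lspace r M \<Longrightarrow> f \<in> borel_measurable M"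
  by (simp add: Lspace_def)

lemma Lspace_infinity:
  "f \<in> Lspace \<infinity> M \<longleftrightarrow> f \<in> borel_measurable M \<and> (\<exists>C. AE \<omega> in M. norm (f \<omega>) \<le> C)"
  by (simp add: Lspace_def)

lemma Lspace_ennreal:
  "0 \<le> p \<Longrightarrow> f \<in> Lspace (ennreal p) M \<longleftrightarrow>
     f \<in> borel_measurable M \<and> integrable M (\<lambda>\<omega>. norm (f \<omega>) powr p)"
  by (simp add: Lspace_def)

text \<open>
  Membership in the Lebesgue spaces is mostly obtained by domination.  The exponent \<open>r\<close> is arbitrary,
  so that the primal exponent and its conjugate, which is infinite if \<open>p = 1\<close>, are treated alike.
\<close>

lemma Lspace_dominated:
  fixes f :: "'a \<Rightarrow> 'b::euclidean_space" and h :: "'a \<Rightarrow> 'c::euclidean_space"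
  assumes h: "h \<in> Lspace r M" and f: "f \<in> borel_measurable M"
    and le: "AE \<omega> in M. norm (f \<omega>) \<le> C * norm (h \<omega>)"
  shows "f \<in> Lspace r M"
proof (cases "r = \<infinity>")
  case True
  with h obtain D where "AE \<omega> in M. norm (h \<omega>) \<le> D"
    by (auto simp: Lspace_def)
  with le have "AE \<omega> in M. norm (f \<omega>) \<le> \<bar>C\<bar> * D"
  proof eventually_elim
    case (elim \<omega>)
    have "C * norm (h \<omega>) \<le> \<bar>C\<bar> * norm (h \<omega>)" by (intro mult_right_mono) auto
    also have "\<dots> \<le> \<bar>C\<bar> * D" using elim by (intro mult_left_mono) auto
    finally show ?case using elim by linarith
  qed
  then show ?thesis using f True by (auto simp: Lspace_def)
next
  case False
  let ?r = "enn2real r"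
  have hm [measurable]: "h \<in> borel_measurable M" by (rule Lspace_measurable[OF h])
  have "integrable M (\<lambda>\<omega>. \<bar>C\<bar> powr ?r * norm (h \<omega>) powr ?r)"
    using h False by (auto simp: Lspace_def)
  then have "integrable M (\<lambda>\<omega>. norm (f \<omega>) powr ?r)"
  proof (rule Bochner_Integration.integrable_bound)
    show "(\<lambda>\<omega>. norm (f \<omega>) powr ?r) \<in> borel_measurable M" using f by measurable
    show "AE \<omega> in M. norm (norm (f \<omega>) powr ?r) \<le> norm (\<bar>C\<bar> powr ?r * norm (h \<omega>) powr ?r)"
      using le
    proof eventually_elim
      case (elim \<omega>)
      have "C * norm (h \<omega>) \<le> \<bar>C\<bar> * norm (h \<omega>)" by (intro mult_right_mono) auto
      then have "norm (f \<omega>) powr ?r \<le> (\<bar>C\<bar> * norm (h \<omega>)) powr ?r"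
        using elim by (intro powr_mono2) auto
      then show ?case by (simp add: powr_mult abs_mult)
    qed
  qed
  then show ?thesis using f False by (auto simp: Lspace_def)
qed

lemma Lspace_zero: "(\<lambda>_. 0) \<in> Lspace r M"
  by (auto simp: Lspace_def)

lemma Lspace_add:
  fixes f g :: "'a \<Rightarrow> 'b::euclidean_space"
  assumes f: "f \<in> Lspace r M" and g: "g \<in> Lspace r M"
  shows "(\<lambda>\<omega>. f \<omega> + g \<omega>) \<in> Lspace r M"
proof (cases "r = \<infinity>")
  case True
  with f g obtain C D where "AE \<omega> in M. norm (f \<omega>) \<le> C" "AE \<omega> in M. norm (g \<omega>) \<le> D"
    by (auto simp: Lspace_def)
  then have "AE \<omega> in M. norm (f \<omega> + g \<omega>) \<le> C + D"
    by eventually_elim (use norm_triangle_mono in blast)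
  then show ?thesis using f g True by (auto simp: Lspace_def)
next
  case False
  let ?r = "enn2real r"
  have [measurable]: "f \<in> borel_measurable M" "g \<in> borel_measurable M"
    using f g by (auto simp: Lspace_def)
  have "integrable M (\<lambda>\<omega>. 2 powr ?r * (norm (f \<omega>) powr ?r + norm (g \<omega>) powr ?r))"
    using f g False by (auto simp: Lspace_def)
  then have "integrable M (\<lambda>\<omega>. norm (f \<omega> + g \<omega>) powr ?r)"
  proof (rule Bochner_Integration.integrable_bound)
    show "(\<lambda>\<omega>. norm (f \<omega> + g \<omega>) powr ?r) \<in> borel_measurable M" by measurable
    have "norm (f \<omega> + g \<omega>) powr ?r \<le> 2 powr ?r * (norm (f \<omega>) powr ?r + norm (g \<omega>) powr ?r)" for \<omega>
    proof -
      let ?m = "max (norm (f \<omega>)) (norm (g \<omega>))"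
      have "norm (f \<omega> + g \<omega>) \<le> 2 * ?m" using norm_triangle_ineq[of "f \<omega>" "g \<omega>"] by linarith
      then have "norm (f \<omega> + g \<omega>) powr ?r \<le> (2 * ?m) powr ?r" by (intro powr_mono2) auto
      also have "\<dots> = 2 powr ?r * ?m powr ?r" by (subst powr_mult) auto
      also have "?m powr ?r \<le> norm (f \<omega>) powr ?r + norm (g \<omega>) powr ?r"
        by (cases "norm (f \<omega>) \<le> norm (g \<omega>)") (auto simp: max_def)
      finally show ?thesis by simp
    qed
    then show "AE \<omega> in M. norm (norm (f \<omega> + g \<omega>) powr ?r)
        \<le> norm (2 powr ?r * (norm (f \<omega>) powr ?r + norm (g \<omega>) powr ?r))" by auto
  qed
  then show ?thesis using False by (auto simp: Lspace_def)
qed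

lemma Lspace_scale:
  fixes f :: "'a \<Rightarrow> 'b::euclidean_space"
  assumes "f \<in> Lspace r M" shows "(\<lambda>\<omega>. c *\<^sub>R f \<omega>) \<in> Lspace r M"
  by (rule Lspace_dominated[OF assms, where C = "\<bar>c\<bar>"])
     (use Lspace_measurable[OF assms] in auto)

lemma Lspace_uminus:
  fixes f :: "'a \<Rightarrow> 'b::euclidean_space"
  assumes "f \<in> Lspace r M" shows "(\<lambda>\<omega>. - f \<omega>) \<in> Lspace r M"
  using Lspace_scale[OF assms, of "-1"] by simp

lemma Lspace_diff:
  fixes f g :: "'a \<Rightarrow> 'b::euclidean_space"
  assumes "f \<in> Lspace r M" "g \<in> Lspace r M" shows "(\<lambda>\<omega>. f \<omega> - g \<omega>) \<in> Lspace r M"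
  using Lspace_add[OF assms(1) Lspace_uminus[OF assms(2)]] by simp

lemma Lspace_sum:
  fixes f :: "'i \<Rightarrow> 'a \<Rightarrow> 'b::euclidean_space"
  assumes "\<And>i. i \<in> I \<Longrightarrow> f i \<in> Lspace r M" shows "(\<lambda>\<omega>. \<Sum>i\<in>I. f i \<omega>) \<in> Lspace r M"
  using assms
proof (induction I rule: infinite_finite_induct)
  case (insert i I)
  then show ?case using Lspace_add[of "f i" r M "\<lambda>\<omega>. \<Sum>i\<in>I. f i \<omega>"] by simp
qed (auto simp: Lspace_zero)

lemma Lspace_norm:
  fixes f :: "'a \<Rightarrow> 'b::euclidean_space"
  assumes "f \<in> Lspace r M" shows "(\<lambda>\<omega>. norm (f \<omega>)) \<in> Lspace r M"
  by (rule Lspace_dominated[OF assms, where C = 1])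
     (use Lspace_measurable[OF assms] in auto)

lemma Lspace_bounded:
  fixes f :: "'a \<Rightarrow> 'b::euclidean_space"
  assumes "finite_measure M" "f \<in> borel_measurable M" "AE \<omega> in M. norm (f \<omega>) \<le> C"
  shows "f \<in> Lspace r M"
proof -
  interpret finite_measure M by fact
  have "(\<lambda>_. 1::real) \<in> Lspace r M" by (auto simp: Lspace_def intro!: exI[of _ 1])
  then show ?thesis by (rule Lspace_dominated[where C = C]) (use assms in auto)
qed

definition Lnorm :: "real \<Rightarrow> 'a measure \<Rightarrow> ('a \<Rightarrow> 'b::euclidean_space) \<Rightarrow> real" where
  "Lnorm p M f = (LINT \<omega>|M. norm (f \<omega>) powr p) powr (1 / p)"

lemma Lnorm_nonneg: "0 \<le> Lnorm p M f"
  by (simp add: Lnorm_def)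

lemma Lnorm_zero: "Lnorm p M (\<lambda>_. 0) = 0"
  by (simp add: Lnorm_def)

lemma Lnorm_powr: "0 < p \<Longrightarrow> Lnorm p M f powr p = (LINT \<omega>|M. norm (f \<omega>) powr p)"
  by (simp add: Lnorm_def powr_powr)

lemma Lnorm_le_iff:
  assumes "0 < p" "0 \<le> a"
  shows "Lnorm p M f \<le> a \<longleftrightarrow> (LINT \<omega>|M. norm (f \<omega>) powr p) \<le> a powr p"
proof -
  have "Lnorm p M f \<le> a \<longleftrightarrow> Lnorm p M f powr p \<le> a powr p"
    using assms Lnorm_nonneg[of p M f]
    by (metis linorder_not_le order_less_imp_le powr_less_mono2 powr_mono2)
  then show ?thesis using Lnorm_powr[OF assms(1), of M f] by simp
qed

lemma Lnorm_mono:
  fixes f :: "'a \<Rightarrow> 'b::euclidean_space" and g :: "'a \<Rightarrow> 'c::euclidean_space"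
  assumes "0 < p" "f \<in> borel_measurable M" "g \<in> Lspace (ennreal p) M"
    and le: "AE \<omega> in M. norm (f \<omega>) \<le> norm (g \<omega>)"
  shows "Lnorm p M f \<le> Lnorm p M g"
proof -
  have f: "f \<in> Lspace (ennreal p) M"
    by (rule Lspace_dominated[OF assms(3,2), where C = 1]) (simp add: le)
  then have "(LINT \<omega>|M. norm (f \<omega>) powr p) \<le> (LINT \<omega>|M. norm (g \<omega>) powr p)"
  proof (intro integral_mono_AE)
    show "AE \<omega> in M. norm (f \<omega>) powr p \<le> norm (g \<omega>) powr p"
      using le by eventually_elim (use assms(1) in \<open>auto intro: powr_mono2\<close>)
  qed (use assms(1,3) f in \<open>auto simp: Lspace_ennreal\<close>)
  then show ?thesis using assms(1) unfolding Lnorm_def by (intro powr_mono2) auto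
qed

lemma Lnorm_scale:
  assumes "0 < p" shows "Lnorm p M (\<lambda>\<omega>. c *\<^sub>R f \<omega>) = \<bar>c\<bar> * Lnorm p M f"
  using assms by (simp add: Lnorm_def powr_mult powr_powr)

lemma powr_convex_nonneg:
  fixes a b u v p :: real
  assumes "1 \<le> p" "0 \<le> a" "0 \<le> b" "0 \<le> u" "0 \<le> v" "u + v = 1"
  shows "(u * a + v * b) powr p \<le> u * a powr p + v * b powr p"
proof -
  have shrink: "(w * c) powr p \<le> w * c powr p" if "0 \<le> w" "w \<le> 1" "0 \<le> c" for w c :: real
  proof -
    have "w powr p \<le> w powr 1" using that assms(1) by (intro powr_mono') auto
    then have "w powr p \<le> w" using that by (simp split: if_splits)
    then show ?thesis using that by (simp add: powr_mult mult_right_mono)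
  qed
  show ?thesis
  proof (cases "a = 0 \<or> b = 0")
    case True
    then show ?thesis using shrink[of v b] shrink[of u a] assms by auto
  next
    case False
    moreover have u: "u = 1 - v" using assms by simp
    ultimately show ?thesis unfolding u
      using convex_onD[OF powr_convex[OF assms(1)], of v a b] assms by simp
  qed
qed

text \<open>
  Minkowski's inequality, from convexity of \<open>s \<mapsto> s powr p\<close>: for \<open>\<alpha>\<close> and \<open>\<beta>\<close> above the norms of
  \<open>f\<close> and \<open>g\<close>, the quotient \<open>(f + g) / (\<alpha> + \<beta>)\<close> is a convex combination of \<open>f / \<alpha>\<close> and \<open>g / \<beta>\<close>.
\<close>

lemma Lnorm_triangle:
  fixes f g :: "'a \<Rightarrow> 'b::euclidean_space"
  assumes p: "1 \<le> p" and f: "f \<in> Lspace (ennreal p) M" and g: "g \<in> Lspace (ennreal p) M"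
  shows "Lnorm p M (\<lambda>\<omega>. f \<omega> + g \<omega>) \<le> Lnorm p M f + Lnorm p M g"
proof (rule field_le_epsilon)
  fix e :: real assume e: "0 < e"
  define \<alpha> \<beta> where "\<alpha> = Lnorm p M f + e / 2" and "\<beta> = Lnorm p M g + e / 2"
  have pos: "0 < \<alpha>" "0 < \<beta>" using e Lnorm_nonneg[of p M f] Lnorm_nonneg[of p M g]
    by (auto simp: \<alpha>_def \<beta>_def)
  have If: "integrable M (\<lambda>\<omega>. norm (f \<omega>) powr p)" and Ig: "integrable M (\<lambda>\<omega>. norm (g \<omega>) powr p)"
    and Ifg: "integrable M (\<lambda>\<omega>. norm (f \<omega> + g \<omega>) powr p)"
    using f g Lspace_add[OF f g] p by (auto simp: Lspace_ennreal)
  have intf: "(LINT \<omega>|M. norm (f \<omega>) powr p) \<le> \<alpha> powr p"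
    using p pos e by (subst Lnorm_le_iff[symmetric]) (auto simp: \<alpha>_def)
  have intg: "(LINT \<omega>|M. norm (g \<omega>) powr p) \<le> \<beta> powr p"
    using p pos e by (subst Lnorm_le_iff[symmetric]) (auto simp: \<beta>_def)
  let ?u = "\<alpha> / (\<alpha> + \<beta>)" and ?v = "\<beta> / (\<alpha> + \<beta>)"
  have uv: "?u + ?v = 1" "0 \<le> ?u" "0 \<le> ?v" using pos by (auto simp: add_divide_distrib[symmetric])
  have pw: "norm (f \<omega> + g \<omega>) powr p
      \<le> (\<alpha> + \<beta>) powr p * (?u * (norm (f \<omega>) powr p / \<alpha> powr p) + ?v * (norm (g \<omega>) powr p / \<beta> powr p))" for \<omega>
  proof -
    have "norm (f \<omega> + g \<omega>) \<le> (\<alpha> + \<beta>) * (?u * (norm (f \<omega>) / \<alpha>) + ?v * (norm (g \<omega>) / \<beta>))"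
    proof -
      have "(\<alpha> + \<beta>) * (?u * (norm (f \<omega>) / \<alpha>) + ?v * (norm (g \<omega>) / \<beta>)) = norm (f \<omega>) + norm (g \<omega>)"
        using pos by (simp add: distrib_left)
      then show ?thesis using norm_triangle_ineq[of "f \<omega>" "g \<omega>"] by simp
    qed
    then have "norm (f \<omega> + g \<omega>) powr p
        \<le> ((\<alpha> + \<beta>) * (?u * (norm (f \<omega>) / \<alpha>) + ?v * (norm (g \<omega>) / \<beta>))) powr p"
      using p by (intro powr_mono2) auto
    also have "\<dots> = (\<alpha> + \<beta>) powr p * (?u * (norm (f \<omega>) / \<alpha>) + ?v * (norm (g \<omega>) / \<beta>)) powr p"
      using pos by (intro powr_mult)
    also have "\<dots> \<le> (\<alpha> + \<beta>) powr p *
        (?u * (norm (f \<omega>) / \<alpha>) powr p + ?v * (norm (g \<omega>) / \<beta>) powr p)"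
      using uv p pos by (intro mult_left_mono powr_convex_nonneg) auto
    finally show ?thesis using pos by (simp add: powr_divide)
  qed
  have "(LINT \<omega>|M. norm (f \<omega> + g \<omega>) powr p)
      \<le> (LINT \<omega>|M. (\<alpha> + \<beta>) powr p *
            (?u * (norm (f \<omega>) powr p / \<alpha> powr p) + ?v * (norm (g \<omega>) powr p / \<beta> powr p)))"
    using If Ig Ifg pw by (intro integral_mono) auto
  also have "\<dots> = (\<alpha> + \<beta>) powr p * (?u * ((LINT \<omega>|M. norm (f \<omega>) powr p) / \<alpha> powr p)
      + ?v * ((LINT \<omega>|M. norm (g \<omega>) powr p) / \<beta> powr p))"
    using If Ig by simp
  also have "\<dots> \<le> (\<alpha> + \<beta>) powr p * (?u * 1 + ?v * 1)"
    using intf intg uv pos by (intro mult_left_mono add_mono) auto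
  also have "\<dots> = (\<alpha> + \<beta>) powr p" using uv by simp
  finally have "Lnorm p M (\<lambda>\<omega>. f \<omega> + g \<omega>) \<le> \<alpha> + \<beta>"
    using p pos by (subst Lnorm_le_iff) auto
  then show "Lnorm p M (\<lambda>\<omega>. f \<omega> + g \<omega>) \<le> Lnorm p M f + Lnorm p M g + e"
    by (simp add: \<alpha>_def \<beta>_def)
qed

lemma Lnorm_sum_le:
  fixes f :: "'i \<Rightarrow> 'a \<Rightarrow> 'b::euclidean_space"
  assumes "1 \<le> p" "\<And>i. i \<in> I \<Longrightarrow> f i \<in> Lspace (ennreal p) M"
  shows "Lnorm p M (\<lambda>\<omega>. \<Sum>i\<in>I. f i \<omega>) \<le> (\<Sum>i\<in>I. Lnorm p M (f i))"
  using assms(2)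
proof (induction I rule: infinite_finite_induct)
  case (insert i I)
  then show ?case
    using Lnorm_triangle[OF assms(1), of "f i" M "\<lambda>\<omega>. \<Sum>i\<in>I. f i \<omega>"] Lspace_sum[of I f "ennreal p" M]
    by force
qed (auto simp: Lnorm_zero)

lemma Lnorm_dominated_convergence:
  fixes f :: "nat \<Rightarrow> 'a \<Rightarrow> 'b::euclidean_space" and w :: "'a \<Rightarrow> 'c::euclidean_space"
  assumes p: "0 < p" and f: "\<And>k. f k \<in> borel_measurable M" and w: "w \<in> Lspace (ennreal p) M"
    and dom: "\<And>k. AE \<omega> in M. norm (f k \<omega>) \<le> C * norm (w \<omega>)"
    and lim: "AE \<omega> in M. (\<lambda>k. f k \<omega>) \<longlonglongrightarrow> 0"
  shows "(\<lambda>k. Lnorm p M (f k)) \<longlonglongrightarrow> 0"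
proof -
  have "(\<lambda>k. LINT \<omega>|M. norm (f k \<omega>) powr p) \<longlonglongrightarrow> (LINT \<omega>|M. (0::real))"
  proof (rule integral_dominated_convergence)
    show "integrable M (\<lambda>\<omega>. \<bar>C\<bar> powr p * norm (w \<omega>) powr p)"
      using w p by (auto simp: Lspace_ennreal)
    show "(\<lambda>\<omega>. norm (f k \<omega>) powr p) \<in> borel_measurable M" for k using f by measurable
    show "AE \<omega> in M. (\<lambda>k. norm (f k \<omega>) powr p) \<longlonglongrightarrow> 0"
      using lim
    proof eventually_elim
      case (elim \<omega>)
      then have "(\<lambda>k. norm (f k \<omega>)) \<longlonglongrightarrow> 0" by (simp add: tendsto_norm_zero)
      from tendsto_powr'[OF this, of "\<lambda>_. p" p] show ?case using p by simp
    qed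
    show "AE \<omega> in M. norm (norm (f k \<omega>) powr p) \<le> \<bar>C\<bar> powr p * norm (w \<omega>) powr p" for k
      using dom[of k]
    proof eventually_elim
      case (elim \<omega>)
      have "C * norm (w \<omega>) \<le> \<bar>C\<bar> * norm (w \<omega>)" by (intro mult_right_mono) auto
      then have "norm (f k \<omega>) powr p \<le> (\<bar>C\<bar> * norm (w \<omega>)) powr p"
        using elim p by (intro powr_mono2) auto
      then show ?case by (simp add: powr_mult)
    qed
  qed simp
  from tendsto_powr'[OF this, of "\<lambda>_. 1/p" "1/p"] show ?thesis
    using p by (simp add: Lnorm_def)
qed

lemma Lnorm_le_policy_norm:
  assumes "0 < p"
  shows "Lnorm p M (x t) \<le> policy_norm p M x"
proof -
  have "(LINT \<omega>|M. norm (x t \<omega>) powr p) \<le> (\<Sum>t\<in>UNIV. LINT \<omega>|M. norm (x t \<omega>) powr p)"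
    by (rule member_le_sum[where f = "\<lambda>t. LINT \<omega>|M. norm (x t \<omega>) powr p"]) auto
  then show ?thesis using assms unfolding Lnorm_def policy_norm_def by (intro powr_mono2) auto
qed

text \<open>
  By subadditivity of \<open>s \<mapsto> s powr (1 / p)\<close>.  Together with \<open>Lnorm_le_policy_norm\<close> this allows
  estimates stage by stage.
\<close>

lemma policy_norm_le_sum_Lnorm:
  assumes "1 \<le> p"
  shows "policy_norm p M x \<le> (\<Sum>t\<in>UNIV. Lnorm p M (x t))"
proof -
  have step: "(a + b) powr (1/p) \<le> a powr (1/p) + b powr (1/p)" if "0 \<le> a" "0 \<le> b" for a b :: real
  proof (cases "a + b = 0")
    case False
    let ?s = "a + b"
    have s: "0 < ?s" using that False by linarith
    have sub: "c / ?s \<le> (c / ?s) powr (1/p)" if "0 \<le> c" "c \<le> ?s" for c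
    proof (cases "c = 0")
      case False
      then have "(c / ?s) powr 1 \<le> (c / ?s) powr (1/p)"
        using that s assms by (intro powr_mono') auto
      then show ?thesis using that s by (simp split: if_splits)
    qed auto
    have "1 = a / ?s + b / ?s" using s by (simp add: add_divide_distrib[symmetric])
    also have "\<dots> \<le> (a / ?s) powr (1/p) + (b / ?s) powr (1/p)"
      using that by (intro add_mono sub) auto
    also have "\<dots> = (a powr (1/p) + b powr (1/p)) / ?s powr (1/p)"
      using s that by (simp add: powr_divide add_divide_distrib)
    finally show ?thesis using s by (simp add: field_simps)
  qed (use that in auto)
  have "(\<Sum>t\<in>I. a t) powr (1/p) \<le> (\<Sum>t\<in>I. a t powr (1/p))"
    if "finite I" "\<And>t. 0 \<le> a t" for I :: "'b set" and a :: "'b \<Rightarrow> real"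
    using that(1)
  proof induction
    case (insert t I)
    have "(\<Sum>t\<in>insert t I. a t) powr (1/p) \<le> a t powr (1/p) + (\<Sum>t\<in>I. a t) powr (1/p)"
      using insert step[of "a t" "\<Sum>t\<in>I. a t"] that(2) by (simp add: sum_nonneg)
    then show ?case using insert by simp
  qed auto
  then show ?thesis unfolding policy_norm_def Lnorm_def by simp
qed

lemma policiesD: "x \<in> policies r M \<Longrightarrow> x t \<in> Lspace r M"
  by (simp add: policies_def)

section \<open>The Hahn-Banach theorem for sublinear functionals\<close>

text \<open>
  Policies are functions of a stage and a point.  Their pointwise vector space structure, and the
  product structure on triples of policies, let the Hahn-Banach theorem be stated for an arbitrary
  real vector space.
\<close>

instantiation "fun" :: (type, real_vector) real_vector
begin

definition scaleR_fun_def: "c *\<^sub>R f = (\<lambda>x. c *\<^sub>R f x)"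

instance
  by standard (auto simp: scaleR_fun_def fun_eq_iff algebra_simps)

end

lemma scaleR_fun_apply [simp]: "(c *\<^sub>R f) x = c *\<^sub>R f x"
  by (simp add: scaleR_fun_def)

lemma sum_fun_apply: "(\<Sum>i\<in>I. F i) x = (\<Sum>i\<in>I. F i x)"
  for F :: "'i \<Rightarrow> 'a \<Rightarrow> 'b::comm_monoid_add"
  by (induction I rule: infinite_finite_induct) auto

text \<open>
  Positive homogeneity is required as an inequality only; the reverse inequality follows by scaling
  back with \<open>1 / c\<close>.
\<close>

definition sublinear_on :: "'v::real_vector set \<Rightarrow> ('v \<Rightarrow> real) \<Rightarrow> bool" where
  "sublinear_on E S \<longleftrightarrow>
     (\<forall>x\<in>E. \<forall>y\<in>E. S (x + y) \<le> S x + S y) \<and> (\<forall>c>0. \<forall>x\<in>E. S (c *\<^sub>R x) \<le> c * S x)"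

lemma sublinear_onI:
  assumes "\<And>x y. x \<in> E \<Longrightarrow> y \<in> E \<Longrightarrow> S (x + y) \<le> S x + S y"
    and "\<And>c x. 0 < c \<Longrightarrow> x \<in> E \<Longrightarrow> S (c *\<^sub>R x) \<le> c * S x"
  shows "sublinear_on E S"
  using assms by (auto simp: sublinear_on_def)

lemma sublinear_on_add: "sublinear_on E S \<Longrightarrow> x \<in> E \<Longrightarrow> y \<in> E \<Longrightarrow> S (x + y) \<le> S x + S y"
  by (auto simp: sublinear_on_def)

lemma sublinear_on_scale:
  assumes "sublinear_on E S" "subspace E" "0 < c" "x \<in> E"
  shows "S (c *\<^sub>R x) = c * S x"
proof (rule antisym)
  show "S (c *\<^sub>R x) \<le> c * S x" using assms by (auto simp: sublinear_on_def)
  have le: "S (d *\<^sub>R y) \<le> d * S y" if "0 < d" "y \<in> E" for d y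
    using assms(1) that by (auto simp: sublinear_on_def)
  have "S ((1 / c) *\<^sub>R (c *\<^sub>R x)) \<le> (1 / c) * S (c *\<^sub>R x)"
    using assms by (intro le subspace_scale) auto
  then show "c * S x \<le> S (c *\<^sub>R x)" using assms(3) by (simp add: field_simps)
qed

lemma sublinear_on_zero:
  assumes "sublinear_on E S" "subspace E" shows "S 0 = 0"
  using sublinear_on_scale[OF assms, of 2 0] subspace_0[OF assms(2)] by simp

lemma sublinear_on_ge_minus:
  assumes "sublinear_on E S" "subspace E" "x \<in> E" shows "- S (- x) \<le> S x"
  using sublinear_on_add[OF assms(1), of x "- x"] sublinear_on_zero[OF assms(1,2)] assms(2,3)
  by (simp add: subspace_neg)

text \<open>
  Subtracting multiples of \<open>y\<close> optimally from the argument produces a smaller sublinear functional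
  unless \<open>m\<close> is already additive along \<open>y\<close>.  Hence a minimal sublinear functional is linear.
\<close>

lemma minimal_sublinear_is_linear:
  fixes m :: "'v::real_vector \<Rightarrow> real"
  assumes m: "sublinear_on UNIV m"
    and minimal: "\<And>r. sublinear_on UNIV r \<Longrightarrow> (\<And>x. r x \<le> m x) \<Longrightarrow> r = m"
  shows "linear m"
proof -
  note add = sublinear_on_add[OF m, simplified]
  note scale = sublinear_on_scale[OF m subspace_UNIV, simplified]
  have zero: "m 0 = 0" using sublinear_on_zero[OF m] by simp
  have neg: "m (- y) = - m y" for y
  proof -
    let ?g = "\<lambda>x t. m (x + t *\<^sub>R y) - t * m y"
    define r where "r x = (INF t\<in>{0..}. ?g x t)" for x
    have lower: "- m (- x) \<le> ?g x t" if "0 \<le> t" for x t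
    proof -
      have "t * m y = m (t *\<^sub>R y)" using that scale[of t y] zero by (cases "t = 0") auto
      also have "\<dots> \<le> m (- x) + m (x + t *\<^sub>R y)" using add[of "- x" "x + t *\<^sub>R y"] by simp
      finally show ?thesis by simp
    qed
    have bdd: "bdd_below (?g x ` {0..})" for x
      using lower[of _ x] by (intro bdd_belowI2[where m = "- m (- x)"]) auto
    have r_le: "r x \<le> ?g x t" if "0 \<le> t" for x t
      unfolding r_def using that by (intro cINF_lower[OF bdd]) auto
    have "sublinear_on UNIV r"
    proof (rule sublinear_onI)
      fix x x' :: 'v
      have "r (x + x') - ?g x t \<le> r x'" if t: "0 \<le> t" for t
        unfolding r_def[of x']
      proof (rule cINF_greatest)
        fix t' :: real assume "t' \<in> {0..}"
        then have t': "0 \<le> t'" by simp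
        have "m (x + x' + (t + t') *\<^sub>R y) \<le> m (x + t *\<^sub>R y) + m (x' + t' *\<^sub>R y)"
          using add[of "x + t *\<^sub>R y" "x' + t' *\<^sub>R y"] by (simp add: algebra_simps)
        moreover have "r (x + x') \<le> ?g (x + x') (t + t')" using t t' by (intro r_le) auto
        ultimately show "r (x + x') - ?g x t \<le> ?g x' t'" by (simp add: algebra_simps)
      qed simp
      then have "r (x + x') - r x' \<le> ?g x t" if "0 \<le> t" for t using that by force
      then have "r (x + x') - r x' \<le> r x" unfolding r_def[of x] by (intro cINF_greatest) auto
      then show "r (x + x') \<le> r x + r x'" by simp
    next
      fix c :: real and x :: 'v assume c: "0 < c"
      have "r (c *\<^sub>R x) / c \<le> r x"
        unfolding r_def[of x]
      proof (rule cINF_greatest)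
        fix t :: real assume t: "t \<in> {0..}"
        have "r (c *\<^sub>R x) \<le> ?g (c *\<^sub>R x) (c * t)" using t c by (intro r_le) auto
        also have "\<dots> = c * ?g x t" using scale[OF c, of "x + t *\<^sub>R y"] by (simp add: algebra_simps)
        finally show "r (c *\<^sub>R x) / c \<le> ?g x t" using c by (simp add: field_simps)
      qed simp
      then show "r (c *\<^sub>R x) \<le> c * r x" using c by (simp add: field_simps)
    qed
    moreover have "r x \<le> m x" for x using r_le[of 0 x] by simp
    ultimately have "r = m" by (rule minimal)
    then have "m (- y) \<le> - m y" using r_le[of 1 "- y"] zero by simp
    then show ?thesis using sublinear_on_ge_minus[OF m subspace_UNIV, of y] by simp
  qed
  show ?thesis
  proof (rule linearI)
    fix x y
    have "m x \<le> m (x + y) + m (- y)" using add[of "x + y" "- y"] by simp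
    then show "m (x + y) = m x + m y" using add[of x y] neg[of y] by simp
  next
    fix c :: real and x :: 'v
    consider "0 < c" | "c = 0" | "0 < - c" by linarith
    then show "m (c *\<^sub>R x) = c *\<^sub>R m x"
    proof cases
      case 3
      then have "m ((- c) *\<^sub>R x) = - c * m x" by (rule scale)
      then show ?thesis using neg[of "c *\<^sub>R x"] by simp
    qed (use scale zero in auto)
  qed
qed

text \<open>
  Zorn's lemma applies to the sublinear functionals below \<open>S\<close>, ordered downwards: the pointwise
  infimum of a chain is again sublinear, and it is finite as every member at \<open>x\<close> is at least \<open>- S (- x)\<close>.
\<close>

theorem linear_minorant_of_sublinear:
  fixes S :: "'v::real_vector \<Rightarrow> real"
  assumes S: "sublinear_on UNIV S"
  shows "\<exists>L. linear L \<and> (\<forall>x. L x \<le> S x)"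
proof -
  define A where "A = {q. sublinear_on UNIV q \<and> (\<forall>x. q x \<le> S x)}"
  let ?P = "\<lambda>a b :: 'v \<Rightarrow> real. b \<le> a"
  have "\<exists>m\<in>A. \<forall>a\<in>A. ?P m a \<longrightarrow> a = m"
  proof (rule predicate_Zorn)
    show "partial_order_on A (relation_of ?P A)"
      by (auto simp: partial_order_on_def preorder_on_def refl_on_def trans_def antisym_def relation_of_def
          intro: antisym order_trans)
  next
    fix C assume "C \<in> Chains (relation_of ?P A)"
    then have CA: "C \<subseteq> A" and chain: "\<And>a b. a \<in> C \<Longrightarrow> b \<in> C \<Longrightarrow> a \<le> b \<or> b \<le> a"
      by (auto simp: Chains_def relation_of_def)
    show "\<exists>u\<in>A. \<forall>a\<in>C. ?P a u"
    proof (cases "C = {}")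
      case True
      then show ?thesis using S by (auto simp: A_def)
    next
      case False
      define u where "u x = (INF q\<in>C. q x)" for x
      have lower: "- S (- x) \<le> q x" if "q \<in> C" for q x
      proof -
        have "sublinear_on UNIV q" "q (- x) \<le> S (- x)" using that CA by (auto simp: A_def)
        then show ?thesis using sublinear_on_ge_minus[of UNIV q x] by auto
      qed
      have u_le: "u x \<le> q x" if "q \<in> C" for q x
        unfolding u_def using that lower[of _ x]
        by (intro cINF_lower bdd_belowI2[where m = "- S (- x)"]) auto
      have u_sub: "sublinear_on UNIV u"
      proof (rule sublinear_onI)
        fix x y :: 'v
        have bound: "u (x + y) \<le> a x + b y" if ab: "a \<in> C" "b \<in> C" for a b
        proof -
          obtain q where q: "q \<in> C" "q \<le> a" "q \<le> b" using chain[OF ab] ab by blast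
          have "u (x + y) \<le> q (x + y)" using q by (intro u_le)
          also have "\<dots> \<le> q x + q y" using q CA by (auto simp: A_def intro: sublinear_on_add)
          also have "\<dots> \<le> a x + b y" using q by (auto simp: le_fun_def intro: add_mono)
          finally show ?thesis .
        qed
        have "u (x + y) - a x \<le> u y" if "a \<in> C" for a
          unfolding u_def[of y] using False bound[OF that] by (intro cINF_greatest) (auto simp: algebra_simps)
        then have "u (x + y) - u y \<le> u x"
          unfolding u_def[of x] using False by (intro cINF_greatest) (auto simp: algebra_simps)
        then show "u (x + y) \<le> u x + u y" by simp
      next
        fix c :: real and x :: 'v assume c: "0 < c"
        have "u (c *\<^sub>R x) / c \<le> u x"
          unfolding u_def[of x]
        proof (rule cINF_greatest[OF False])
          fix q assume q: "q \<in> C"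
          then have "sublinear_on UNIV q" using CA by (auto simp: A_def)
          then have "q (c *\<^sub>R x) = c * q x" using c by (intro sublinear_on_scale) auto
          then show "u (c *\<^sub>R x) / c \<le> q x" using u_le[OF q, of "c *\<^sub>R x"] c by (simp add: field_simps)
        qed
        then show "u (c *\<^sub>R x) \<le> c * u x" using c by (simp add: field_simps)
      qed
      have "u x \<le> S x" for x
      proof -
        obtain q where q: "q \<in> C" using False by blast
        then have "q x \<le> S x" using CA by (auto simp: A_def)
        then show ?thesis using u_le[OF q, of x] by simp
      qed
      with u_sub have "u \<in> A" by (auto simp: A_def)
      then show ?thesis using u_le by (auto simp: le_fun_def)
    qed
  qed
  then obtain m where mA: "m \<in> A" and least: "\<And>a. a \<in> A \<Longrightarrow> a \<le> m \<Longrightarrow> a = m" by blast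
  have "linear m"
  proof (rule minimal_sublinear_is_linear)
    show "sublinear_on UNIV m" using mA by (auto simp: A_def)
    show "r = m" if r: "sublinear_on UNIV r" "\<And>x. r x \<le> m x" for r
    proof (rule least)
      have "r x \<le> S x" for x using r(2)[of x] mA by (auto simp: A_def intro: order_trans)
      then show "r \<in> A" using r by (auto simp: A_def)
    qed (use r in \<open>auto simp: le_fun_def\<close>)
  qed
  then show ?thesis using mA by (auto simp: A_def)
qed

text \<open>
  The form of the Hahn-Banach theorem that yields multipliers: minimizing \<open>S\<close> over the cosets of
  \<open>N\<close> gives a sublinear functional that vanishes on \<open>N\<close>, and so does each of its linear minorants.
  A linear projection onto \<open>E\<close> makes everything globally defined.
\<close>

theorem Hahn_Banach_annihilating:
  fixes S :: "'v::real_vector \<Rightarrow> real"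
  assumes E: "subspace E" and S: "sublinear_on E S"
    and N: "subspace N" "N \<subseteq> E" and nonneg: "\<And>x. x \<in> N \<Longrightarrow> 0 \<le> S x"
  shows "\<exists>L. linear L \<and> (\<forall>x\<in>E. L x \<le> S x) \<and> (\<forall>x\<in>N. L x = 0)"
proof -
  obtain \<pi> :: "'v \<Rightarrow> 'v" where \<pi>: "range \<pi> \<subseteq> E" "linear \<pi>" "\<And>x. x \<in> E \<Longrightarrow> \<pi> x = x"
    using linear_exists_left_inverse_on[OF linear_id E] by auto
  have \<pi>E: "\<pi> x \<in> E" for x using \<pi>(1) by auto
  \<comment> \<open>The infimum is finite because \<open>S\<close> is nonnegative on \<open>N\<close>.\<close>
  define R where "R x = (INF n\<in>N. S (\<pi> x + n))" for x
  have N0: "0 \<in> N" "N \<noteq> {}" using subspace_0[OF N(1)] by auto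
  have NE: "n \<in> E" if "n \<in> N" for n using that N by auto
  have lower: "- S (- \<pi> x) \<le> S (\<pi> x + n)" if "n \<in> N" for x n
  proof -
    have "0 \<le> S n" using that by (rule nonneg)
    also have "\<dots> \<le> S (- \<pi> x) + S (\<pi> x + n)"
      using sublinear_on_add[OF S, of "- \<pi> x" "\<pi> x + n"] NE[OF that] \<pi>E[of x] E
      by (simp add: subspace_add subspace_neg)
    finally show ?thesis by simp
  qed
  have R_le: "R x \<le> S (\<pi> x + n)" if "n \<in> N" for x n
    unfolding R_def using that lower[of _ x]
    by (intro cINF_lower bdd_belowI2[where m = "- S (- \<pi> x)"]) auto
  have "sublinear_on UNIV R"
  proof (rule sublinear_onI)
    fix x y :: 'v
    have bound: "R (x + y) \<le> S (\<pi> x + n) + S (\<pi> y + k)" if nk: "n \<in> N" "k \<in> N" for n k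
    proof -
      have "R (x + y) \<le> S (\<pi> (x + y) + (n + k))" using nk N by (intro R_le subspace_add)
      also have "\<pi> (x + y) + (n + k) = (\<pi> x + n) + (\<pi> y + k)"
        using linear_add[OF \<pi>(2)] by (simp add: algebra_simps)
      also have "S \<dots> \<le> S (\<pi> x + n) + S (\<pi> y + k)"
        using nk \<pi>E NE E by (intro sublinear_on_add[OF S] subspace_add) auto
      finally show ?thesis .
    qed
    have "R (x + y) - S (\<pi> x + n) \<le> R y" if "n \<in> N" for n
      unfolding R_def[of y] using N0 bound[OF that] by (intro cINF_greatest) (auto simp: algebra_simps)
    then have "R (x + y) - R y \<le> R x"
      unfolding R_def[of x] using N0 by (intro cINF_greatest) (auto simp: algebra_simps)
    then show "R (x + y) \<le> R x + R y" by simp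
  next
    fix c :: real and x :: 'v assume c: "0 < c"
    have "R (c *\<^sub>R x) / c \<le> R x"
      unfolding R_def[of x]
    proof (rule cINF_greatest[OF N0(2)])
      fix n assume n: "n \<in> N"
      have "R (c *\<^sub>R x) \<le> S (\<pi> (c *\<^sub>R x) + c *\<^sub>R n)" using n N by (intro R_le subspace_scale)
      also have "\<pi> (c *\<^sub>R x) + c *\<^sub>R n = c *\<^sub>R (\<pi> x + n)"
        using linear_scale[OF \<pi>(2)] by (simp add: algebra_simps)
      also have "S \<dots> = c * S (\<pi> x + n)"
        using n NE \<pi>E E c by (intro sublinear_on_scale[OF S E] subspace_add) auto
      finally show "R (c *\<^sub>R x) / c \<le> S (\<pi> x + n)" using c by (simp add: field_simps)
    qed
    then show "R (c *\<^sub>R x) \<le> c * R x" using c by (simp add: field_simps)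
  qed
  then obtain L where L: "linear L" "\<And>x. L x \<le> R x"
    using linear_minorant_of_sublinear by blast
  have "L x \<le> S x" if "x \<in> E" for x
    using L(2)[of x] R_le[OF N0(1), of x] \<pi>(3)[OF that] by simp
  moreover have L_le: "L n \<le> 0" if "n \<in> N" for n
  proof -
    have "R n \<le> S (\<pi> n + - n)" using that N by (intro R_le subspace_neg)
    then show ?thesis
      using L(2)[of n] \<pi>(3)[OF NE[OF that]] sublinear_on_zero[OF S E] by simp
  qed
  moreover have "L n = 0" if "n \<in> N" for n
    using L_le[OF that] L_le[of "- n"] that N linear_neg[OF L(1), of n] by (simp add: subspace_neg)
  ultimately show ?thesis using L(1) by blast
qed

section \<open>Duality of Lebesgue spaces\<close>

lemma conjugate_exponent_cases:
  assumes "1 \<le> p" "1 / ennreal p + 1 / q = 1"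
  obtains (one) "p = 1" "q = \<infinity>"
  | (greater) r where "1 < p" "1 < r" "1 / p + 1 / r = 1" "q = ennreal r"
proof (cases q)
  case top
  then have "ennreal (1 / p) = ennreal 1" using assms
    by (simp add: divide_ennreal[symmetric] ennreal_1)
  then have "p = 1" using assms by (simp del: ennreal_1)
  then show ?thesis using top that(1) by simp
next
  case (real r)
  have "r \<noteq> 0"
  proof
    assume "r = 0"
    then have "1 / q = \<infinity>" using real by (simp add: ennreal_divide_zero)
    then show False using assms(2) by simp
  qed
  then have r: "0 < r" using real by simp
  have "ennreal (1 / p + 1 / r) = 1 / ennreal p + 1 / q"
    using real r assms(1) by (simp add: ennreal_plus divide_ennreal[symmetric])
  then have "ennreal (1 / p + 1 / r) = ennreal 1" using assms(2) by simp
  then have sum1: "1 / p + 1 / r = 1"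
    using r assms(1) by (subst (asm) ennreal_inj) auto
  have "0 < 1 / r" "0 < 1 / p" using r assms(1) by auto
  then have "1 / p < 1" "1 / r < 1" using sum1 by linarith+
  then have "1 < p" "1 < r" using r assms(1) by (auto simp: field_simps)
  then show ?thesis using that(2) sum1 real by blast
qed

text \<open>
  Integrability of the product follows from Young's inequality applied pointwise.
\<close>

lemma integrable_inner_conjugate:
  fixes g f :: "'a \<Rightarrow> 'b::euclidean_space"
  assumes p: "1 \<le> p" "1 / ennreal p + 1 / q = 1"
    and g: "g \<in> Lspace q M" and f: "f \<in> Lspace (ennreal p) M"
  shows "integrable M (\<lambda>\<omega>. g \<omega> \<bullet> f \<omega>)"
proof -
  have [measurable]: "g \<in> borel_measurable M" "f \<in> borel_measurable M"
    using g f by (auto simp: Lspace_def)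
  have meas: "(\<lambda>\<omega>. g \<omega> \<bullet> f \<omega>) \<in> borel_measurable M" by measurable
  show ?thesis
    using p
  proof (cases rule: conjugate_exponent_cases)
    case one
    then obtain C where C: "AE \<omega> in M. norm (g \<omega>) \<le> C" using g unfolding one(2) Lspace_infinity by blast
    have "integrable M (\<lambda>\<omega>. norm (f \<omega>) powr 1)" using f one by (auto simp: Lspace_def)
    then have "integrable M (\<lambda>\<omega>. C * norm (f \<omega>))" by simp
    then show ?thesis
    proof (rule Bochner_Integration.integrable_bound[OF _ meas])
      show "AE \<omega> in M. norm (g \<omega> \<bullet> f \<omega>) \<le> norm (C * norm (f \<omega>))"
        using C
      proof eventually_elim
        case (elim \<omega>)
        have "norm (g \<omega> \<bullet> f \<omega>) \<le> norm (g \<omega>) * norm (f \<omega>)" by (simp add: Cauchy_Schwarz_ineq2)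
        also have "\<dots> \<le> C * norm (f \<omega>)" using elim by (intro mult_right_mono) auto
        finally show ?case by simp
      qed
    qed
  next
    case (greater r)
    have "integrable M (\<lambda>\<omega>. norm (f \<omega>) powr p / p + norm (g \<omega>) powr r / r)"
      using f g greater by (auto simp: Lspace_ennreal)
    then show ?thesis
    proof (rule Bochner_Integration.integrable_bound[OF _ meas])
      have "norm (g \<omega> \<bullet> f \<omega>) \<le> norm (norm (f \<omega>) powr p / p + norm (g \<omega>) powr r / r)" for \<omega>
      proof -
        have "norm (g \<omega> \<bullet> f \<omega>) \<le> norm (f \<omega>) * norm (g \<omega>)"
          using Cauchy_Schwarz_ineq2[of "g \<omega>" "f \<omega>"] by (simp add: mult.commute)
        also have "\<dots> \<le> norm (f \<omega>) powr p / p + norm (g \<omega>) powr r / r"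
          using greater by (intro Youngs_inequality) auto
        finally show ?thesis by simp
      qed
      then show "AE \<omega> in M. norm (g \<omega> \<bullet> f \<omega>) \<le> norm (norm (f \<omega>) powr p / p + norm (g \<omega>) powr r / r)"
        by simp
    qed
  qed
qed

text \<open>
  The bound by a power of the measure has two effects: it makes a finitely additive set function
  continuous at the empty set, hence a measure, and it makes this measure absolutely continuous, so that
  the Radon-Nikodym theorem provides a density.
\<close>

lemma nonneg_additive_density:
  fixes m :: "'a set \<Rightarrow> real"
  assumes "finite_measure M" and p: "0 < p"
    and nonneg: "\<And>A. A \<in> sets M \<Longrightarrow> 0 \<le> m A"
    and add: "\<And>A B. A \<in> sets M \<Longrightarrow> B \<in> sets M \<Longrightarrow> A \<inter> B = {} \<Longrightarrow> m (A \<union> B) = m A + m B"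
    and bound: "\<And>A. A \<in> sets M \<Longrightarrow> m A \<le> K * measure M A powr (1 / p)"
  shows "\<exists>g. integrable M g \<and> (\<forall>A\<in>sets M. m A = (LINT \<omega>|M. indicator A \<omega> * g \<omega>))"
proof -
  interpret finite_measure M by fact
  have m0: "m {} = 0" using add[of "{}" "{}"] by simp
  define N where "N = measure_of (space M) (sets M) (\<lambda>A. ennreal (m A))"
  have ca: "countably_additive (sets M) (\<lambda>A. ennreal (m A))"
  proof (rule sets.empty_continuous_imp_countably_additive)
    show "positive (sets M) (\<lambda>A. ennreal (m A))" using m0 by (auto simp: positive_def)
    show "additive (sets M) (\<lambda>A. ennreal (m A))"
      using add nonneg by (auto simp: additive_def ennreal_plus)
    fix A :: "nat \<Rightarrow> 'a set" assume A: "range A \<subseteq> sets M" "decseq A" "(\<Inter>i. A i) = {}"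
    have "(\<lambda>i. measure M (A i)) \<longlonglongrightarrow> measure M (\<Inter>i. A i)"
      using A by (intro finite_Lim_measure_decseq) auto
    then have "(\<lambda>i. measure M (A i)) \<longlonglongrightarrow> 0" using A by simp
    from tendsto_powr'[OF this, of "\<lambda>_. 1/p" "1/p"]
    have "(\<lambda>i. measure M (A i) powr (1 / p)) \<longlonglongrightarrow> 0" using p by simp
    from tendsto_mult_right_zero[OF this, of K]
    have lim: "(\<lambda>i. K * measure M (A i) powr (1 / p)) \<longlonglongrightarrow> 0" .
    have As: "A i \<in> sets M" for i using A(1) by auto
    have "norm (m (A i)) \<le> K * measure M (A i) powr (1 / p)" for i
      using nonneg[OF As] bound[OF As] by simp
    then have "(\<lambda>i. m (A i)) \<longlonglongrightarrow> 0"
      by (intro Lim_null_comparison[OF always_eventually lim] allI)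
    from tendsto_ennrealI[OF this] show "(\<lambda>i. ennreal (m (A i))) \<longlonglongrightarrow> 0" by simp
  qed auto
  have N: "emeasure N A = ennreal (m A)" if "A \<in> sets M" for A
    unfolding N_def using that m0 ca
    by (intro emeasure_measure_of_sigma sets.sigma_algebra_axioms) (auto simp: positive_def)
  have setsN: "sets N = sets M" and spaceN: "space N = space M"
    by (simp_all add: N_def)
  have finN: "finite_measure N"
    by (rule finite_measureI) (simp add: spaceN N)
  have "absolutely_continuous M N"
    unfolding absolutely_continuous_def
  proof
    fix A assume A: "A \<in> null_sets M"
    then have As: "A \<in> sets M" and "measure M A = 0" by (auto simp: null_sets_def measure_def)
    then have "m A \<le> 0" using bound[OF As] p by simp
    then show "A \<in> null_sets N" using As N by (auto simp: null_sets_def setsN ennreal_neg)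
  qed
  then obtain h where h [measurable]: "h \<in> borel_measurable M" and dens: "density M h = N"
    using Radon_Nikodym_finite_measure[OF finN setsN] by auto
  have hA: "(\<integral>\<^sup>+\<omega>. h \<omega> * indicator A \<omega> \<partial>M) = ennreal (m A)" if "A \<in> sets M" for A
    using N[OF that] emeasure_density[OF h that] dens by simp
  have "(\<integral>\<^sup>+\<omega>. h \<omega> \<partial>M) = (\<integral>\<^sup>+\<omega>. h \<omega> * indicator (space M) \<omega> \<partial>M)"
    by (intro nn_integral_cong) auto
  then have fin: "(\<integral>\<^sup>+\<omega>. h \<omega> \<partial>M) \<noteq> \<infinity>" using hA[of "space M"] by simp
  have real: "AE \<omega> in M. ennreal (enn2real (h \<omega>)) = h \<omega>"
    using nn_integral_PInf_AE[OF h fin] by eventually_elim (simp add: less_top)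
  let ?g = "\<lambda>\<omega>. enn2real (h \<omega>)"
  have "(\<integral>\<^sup>+\<omega>. ennreal (?g \<omega>) \<partial>M) = (\<integral>\<^sup>+\<omega>. h \<omega> \<partial>M)"
    by (intro nn_integral_cong_AE real)
  then have "integrable M ?g"
    using fin by (intro integrableI_nonneg) (auto simp: less_top)
  moreover have "m A = (LINT \<omega>|M. indicator A \<omega> * ?g \<omega>)" if A: "A \<in> sets M" for A
  proof -
    have "(LINT \<omega>|M. indicator A \<omega> * ?g \<omega>) = enn2real (\<integral>\<^sup>+\<omega>. ennreal (indicator A \<omega> * ?g \<omega>) \<partial>M)"
      using A by (intro integral_eq_nn_integral) auto
    also have "(\<integral>\<^sup>+\<omega>. ennreal (indicator A \<omega> * ?g \<omega>) \<partial>M) = (\<integral>\<^sup>+\<omega>. h \<omega> * indicator A \<omega> \<partial>M)"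
      by (intro nn_integral_cong_AE, use real in eventually_elim) (auto simp: indicator_def)
    finally show ?thesis using hA[OF A] nonneg[OF A] by simp
  qed
  ultimately show ?thesis by blast
qed

text \<open>
  The Jordan decomposition: the largest value of \<open>\<nu>\<close> on subsets is again additive and satisfies the
  same bound, and it dominates both \<open>\<nu>\<close> and zero.
\<close>

lemma additive_density:
  fixes \<nu> :: "'a set \<Rightarrow> real"
  assumes "finite_measure M" and p: "0 < p" and K: "0 \<le> K"
    and add: "\<And>A B. A \<in> sets M \<Longrightarrow> B \<in> sets M \<Longrightarrow> A \<inter> B = {} \<Longrightarrow> \<nu> (A \<union> B) = \<nu> A + \<nu> B"
    and bound: "\<And>A. A \<in> sets M \<Longrightarrow> \<bar>\<nu> A\<bar> \<le> K * measure M A powr (1 / p)"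
  shows "\<exists>g. integrable M g \<and> (\<forall>A\<in>sets M. \<nu> A = (LINT \<omega>|M. indicator A \<omega> * g \<omega>))"
proof -
  interpret finite_measure M by fact
  have \<nu>0: "\<nu> {} = 0" using add[of "{}" "{}"] by simp
  define \<mu> where "\<mu> A = (SUP B\<in>{B \<in> sets M. B \<subseteq> A}. \<nu> B)" for A
  have sub: "\<nu> B \<le> K * measure M A powr (1 / p)" if "A \<in> sets M" "B \<in> sets M" "B \<subseteq> A" for A B
  proof -
    have "\<nu> B \<le> K * measure M B powr (1 / p)" using bound[OF that(2)] by simp
    also have "\<dots> \<le> K * measure M A powr (1 / p)"
      using that p K by (intro mult_left_mono powr_mono2 finite_measure_mono) auto
    finally show ?thesis .
  qed
  have upper: "\<nu> B \<le> \<mu> A" if "A \<in> sets M" "B \<in> sets M" "B \<subseteq> A" for A B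
    unfolding \<mu>_def using that sub[OF that(1)]
    by (intro cSUP_upper bdd_aboveI2[where M = "K * measure M A powr (1 / p)"]) auto
  have least: "\<mu> A \<le> c" if "\<And>B. B \<in> sets M \<Longrightarrow> B \<subseteq> A \<Longrightarrow> \<nu> B \<le> c" for A c
    unfolding \<mu>_def using that by (intro cSUP_least) auto
  have \<mu>_add: "\<mu> (A \<union> B) = \<mu> A + \<mu> B" if AB: "A \<in> sets M" "B \<in> sets M" "A \<inter> B = {}" for A B
  proof (rule antisym)
    show "\<mu> (A \<union> B) \<le> \<mu> A + \<mu> B"
    proof (rule least)
      fix D assume D: "D \<in> sets M" "D \<subseteq> A \<union> B"
      have "\<nu> D = \<nu> ((D \<inter> A) \<union> (D \<inter> B))" using D by (intro arg_cong[where f = \<nu>]) auto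
      also have "\<dots> = \<nu> (D \<inter> A) + \<nu> (D \<inter> B)" using D AB by (intro add) auto
      also have "\<dots> \<le> \<mu> A + \<mu> B" using D AB by (intro add_mono upper) auto
      finally show "\<nu> D \<le> \<mu> A + \<mu> B" .
    qed
    have "\<nu> D + \<nu> G \<le> \<mu> (A \<union> B)" if "D \<in> sets M" "D \<subseteq> A" "G \<in> sets M" "G \<subseteq> B" for D G
    proof -
      have "\<nu> D + \<nu> G = \<nu> (D \<union> G)" using that AB by (intro add[symmetric]) auto
      also have "\<dots> \<le> \<mu> (A \<union> B)" using that AB by (intro upper) auto
      finally show ?thesis .
    qed
    then have "\<mu> A \<le> \<mu> (A \<union> B) - \<nu> G" if "G \<in> sets M" "G \<subseteq> B" for G
      using that by (intro least) (force simp: algebra_simps)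
    then have "\<mu> B \<le> \<mu> (A \<union> B) - \<mu> A" by (intro least) (force simp: algebra_simps)
    then show "\<mu> A + \<mu> B \<le> \<mu> (A \<union> B)" by simp
  qed
  have \<mu>_nonneg: "0 \<le> \<mu> A" if "A \<in> sets M" for A using upper[OF that, of "{}"] \<nu>0 by simp
  have \<mu>_bound: "\<mu> A \<le> K * measure M A powr (1 / p)" if "A \<in> sets M" for A
    by (intro least sub that)
  have "\<exists>g. integrable M g \<and> (\<forall>A\<in>sets M. \<mu> A = (LINT \<omega>|M. indicator A \<omega> * g \<omega>))"
    using \<mu>_nonneg \<mu>_add \<mu>_bound
    by (rule nonneg_additive_density[OF \<open>finite_measure M\<close> p, where K = K])
  then obtain g where g: "integrable M g" "\<And>A. A \<in> sets M \<Longrightarrow> \<mu> A = (LINT \<omega>|M. indicator A \<omega> * g \<omega>)"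
    by blast
  have "\<exists>h. integrable M h \<and> (\<forall>A\<in>sets M. \<mu> A - \<nu> A = (LINT \<omega>|M. indicator A \<omega> * h \<omega>))"
  proof (rule nonneg_additive_density[OF \<open>finite_measure M\<close> p, where K = "2 * K"])
    show "0 \<le> \<mu> A - \<nu> A" if "A \<in> sets M" for A using upper[OF that that] by simp
    show "\<mu> (A \<union> B) - \<nu> (A \<union> B) = \<mu> A - \<nu> A + (\<mu> B - \<nu> B)"
      if "A \<in> sets M" "B \<in> sets M" "A \<inter> B = {}" for A B
      using \<mu>_add[OF that] add[OF that] by simp
    show "\<mu> A - \<nu> A \<le> 2 * K * measure M A powr (1 / p)" if "A \<in> sets M" for A
      using \<mu>_bound[OF that] bound[OF that] by linarith
  qed
  then obtain h where h: "integrable M h"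
    "\<And>A. A \<in> sets M \<Longrightarrow> \<mu> A - \<nu> A = (LINT \<omega>|M. indicator A \<omega> * h \<omega>)"
    by blast
  have "\<nu> A = (LINT \<omega>|M. indicator A \<omega> * (g \<omega> - h \<omega>))" if A: "A \<in> sets M" for A
  proof -
    have "integrable M (\<lambda>\<omega>. indicator A \<omega> * g \<omega>)" "integrable M (\<lambda>\<omega>. indicator A \<omega> * h \<omega>)"
      using integrable_mult_indicator[OF A g(1)] integrable_mult_indicator[OF A h(1)] by auto
    then have "(LINT \<omega>|M. indicator A \<omega> * (g \<omega> - h \<omega>))
        = (LINT \<omega>|M. indicator A \<omega> * g \<omega>) - (LINT \<omega>|M. indicator A \<omega> * h \<omega>)"
      by (simp add: right_diff_distrib)
    then show ?thesis using g(2)[OF A] h(2)[OF A] by simp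
  qed
  then show ?thesis using g(1) h(1) by (intro exI[of _ "\<lambda>\<omega>. g \<omega> - h \<omega>"]) auto
qed

text \<open>
  The density \<open>g\<close> of the set function \<open>A \<mapsto> \<Phi> (indicator A)\<close> represents \<open>\<Phi>\<close> on bounded functions, by
  approximation with simple functions.  Bounded test functions built from \<open>g\<close> itself then show that
  \<open>g\<close> lies in the dual space, after which the same approximation covers all of the space.
\<close>

theorem Lp_functional_representation:
  fixes \<Phi> :: "('a \<Rightarrow> real) \<Rightarrow> real"
  assumes M: "finite_measure M" and p: "1 \<le> p" "1 / ennreal p + 1 / q = 1"
    and add: "\<And>f g. f \<in> Lspace (ennreal p) M \<Longrightarrow> g \<in> Lspace (ennreal p) M \<Longrightarrow>
        \<Phi> (\<lambda>\<omega>. f \<omega> + g \<omega>) = \<Phi> f + \<Phi> g"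
    and scale: "\<And>f c. f \<in> Lspace (ennreal p) M \<Longrightarrow> \<Phi> (\<lambda>\<omega>. c * f \<omega>) = c * \<Phi> f"
    and bound: "\<And>f. f \<in> Lspace (ennreal p) M \<Longrightarrow> \<Phi> f \<le> K * Lnorm p M f"
  shows "\<exists>g\<in>Lspace q M. \<forall>f\<in>Lspace (ennreal p) M. \<Phi> f = pairing M g f"
proof -
  interpret finite_measure M by fact
  let ?L = "Lspace (ennreal p) M :: ('a \<Rightarrow> real) set"
  have p0: "0 < p" using p by simp
  define K' where "K' = \<bar>K\<bar>"
  have abs_bound: "\<bar>\<Phi> f\<bar> \<le> K' * Lnorm p M f" if f: "f \<in> ?L" for f
  proof -
    have "K * Lnorm p M f \<le> K' * Lnorm p M f"
      unfolding K'_def by (intro mult_right_mono Lnorm_nonneg) auto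
    moreover have "\<Phi> (\<lambda>\<omega>. - 1 * f \<omega>) \<le> K * Lnorm p M (\<lambda>\<omega>. - 1 * f \<omega>)"
      using Lspace_scale[OF f, of "-1"] by (intro bound) simp
    moreover have "Lnorm p M (\<lambda>\<omega>. - 1 * f \<omega>) = Lnorm p M f" using Lnorm_scale[OF p0, of M "-1" f] by simp
    ultimately show ?thesis using bound[OF f] scale[OF f, of "-1"] by (simp add: abs_le_iff)
  qed
  have diff_bound: "\<bar>\<Phi> f - \<Phi> g\<bar> \<le> K' * Lnorm p M (\<lambda>\<omega>. f \<omega> - g \<omega>)" if fg: "f \<in> ?L" "g \<in> ?L" for f g
  proof -
    have "\<Phi> (\<lambda>\<omega>. (f \<omega> - g \<omega>) + g \<omega>) = \<Phi> (\<lambda>\<omega>. f \<omega> - g \<omega>) + \<Phi> g"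
      using fg by (intro add Lspace_diff)
    then show ?thesis using abs_bound[OF Lspace_diff[OF fg]] by simp
  qed
  have ind: "(\<lambda>\<omega>. c * indicator A \<omega>) \<in> ?L" if "A \<in> sets M" for A c
    using that by (intro Lspace_bounded[OF M, where C = "\<bar>c\<bar>"]) (auto simp: indicator_def)
  have ind1: "indicator A \<in> ?L" if "A \<in> sets M" for A
    using ind[OF that, of 1] by simp
  have Lnorm_ind: "Lnorm p M (indicator A :: 'a \<Rightarrow> real) = measure M A powr (1 / p)" if "A \<in> sets M" for A
  proof -
    have "(\<lambda>\<omega>. norm (indicator A \<omega> :: real) powr p) = indicator A"
      by (auto simp: indicator_def fun_eq_iff)
    then show ?thesis using that by (simp add: Lnorm_def Int_absorb1 sets.sets_into_space)
  qed
  have "\<exists>g. integrable M g \<and> (\<forall>A\<in>sets M. \<Phi> (indicator A) = (LINT \<omega>|M. indicator A \<omega> * g \<omega>))"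
  proof (rule additive_density[OF M p0, where K = K'])
    show "\<Phi> (indicator (A \<union> B)) = \<Phi> (indicator A) + \<Phi> (indicator B)"
      if "A \<in> sets M" "B \<in> sets M" "A \<inter> B = {}" for A B
    proof -
      have "indicator (A \<union> B) = (\<lambda>\<omega>. indicator A \<omega> + indicator B \<omega> :: real)"
        using that by (auto simp: indicator_def fun_eq_iff)
      then show ?thesis using add[OF ind1[OF that(1)] ind1[OF that(2)]] by simp
    qed
    show "\<bar>\<Phi> (indicator A)\<bar> \<le> K' * measure M A powr (1 / p)" if "A \<in> sets M" for A
      using abs_bound[OF ind1[OF that]] Lnorm_ind[OF that] by simp
  qed (simp add: K'_def)
  then obtain g where g: "integrable M g"
    and g_ind: "\<And>A. A \<in> sets M \<Longrightarrow> \<Phi> (indicator A) = (LINT \<omega>|M. indicator A \<omega> * g \<omega>)"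
    by blast
  have gm [measurable]: "g \<in> borel_measurable M" using g by auto
  have simple: "\<Phi> s = (LINT \<omega>|M. g \<omega> * s \<omega>)" if s: "simple_function M s" "s \<in> ?L" for s
  proof -
    let ?A = "\<lambda>y. s -` {y} \<inter> space M"
    have A: "?A y \<in> sets M" for y using s(1) by (rule simple_functionD)
    have fin: "finite (s ` space M)" using s(1) by (rule simple_functionD)
    define s' where "s' \<omega> = (\<Sum>y\<in>s ` space M. y * indicator (?A y) \<omega>)" for \<omega>
    have s'_eq: "s' \<omega> = s \<omega>" if "\<omega> \<in> space M" for \<omega>
    proof -
      have "s' \<omega> = (\<Sum>y\<in>s ` space M. if y = s \<omega> then s \<omega> else 0)"
        unfolding s'_def using that by (intro sum.cong) (auto simp: indicator_def)
      then show ?thesis using fin that by simp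
    qed
    have sum: "\<Phi> (\<lambda>\<omega>. \<Sum>y\<in>I. y * indicator (?A y) \<omega>) = (\<Sum>y\<in>I. y * \<Phi> (indicator (?A y)))"
      if "finite I" for I
      using that
    proof induction
      case empty
      show ?case using scale[OF ind1[of "{}"], of 0] by simp
    next
      case (insert y I)
      have "(\<lambda>\<omega>. \<Sum>y\<in>I. y * indicator (?A y) \<omega>) \<in> ?L" by (intro Lspace_sum ind A)
      then show ?case
        unfolding sum.insert[OF insert(1,2)]
        by (simp only: add[OF ind[OF A]] insert(3) scale[OF ind1[OF A]])
    qed
    have int: "integrable M (\<lambda>\<omega>. y * (indicator (?A y) \<omega> * g \<omega>))" for y
      using integrable_mult_indicator[OF A g, of y] by simp
    have s': "s' \<in> ?L" unfolding s'_def by (intro Lspace_sum ind A)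
    have "Lnorm p M (\<lambda>\<omega>. s \<omega> - s' \<omega>) = Lnorm p M (\<lambda>_. 0::real)"
      unfolding Lnorm_def using s'_eq by (intro arg_cong2[where f = "(powr)"] Bochner_Integration.integral_cong) auto
    then have "\<Phi> s = \<Phi> s'" using diff_bound[OF s(2) s'] by (simp add: Lnorm_zero)
    also have "\<dots> = (\<Sum>y\<in>s ` space M. y * \<Phi> (indicator (?A y)))"
      using sum[OF fin] by (simp add: s'_def[abs_def])
    also have "\<dots> = (\<Sum>y\<in>s ` space M. LINT \<omega>|M. y * (indicator (?A y) \<omega> * g \<omega>))"
      using g_ind[OF A] by simp
    also have "\<dots> = (LINT \<omega>|M. (\<Sum>y\<in>s ` space M. y * (indicator (?A y) \<omega> * g \<omega>)))"
      using int by (subst Bochner_Integration.integral_sum) auto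
    also have "\<dots> = (LINT \<omega>|M. g \<omega> * s' \<omega>)"
      by (intro Bochner_Integration.integral_cong) (auto simp: s'_def sum_distrib_left algebra_simps)
    also have "\<dots> = (LINT \<omega>|M. g \<omega> * s \<omega>)"
      using s'_eq by (intro Bochner_Integration.integral_cong) auto
    finally show ?thesis .
  qed
  \<comment> \<open>Simple functions approximate every \<open>f\<close> in the norm, while their integrals against \<open>g\<close> converge
    as soon as \<open>g * f\<close> is integrable; this is used first for bounded \<open>f\<close> and then for all \<open>f\<close>.\<close>
  have repr: "\<Phi> f = (LINT \<omega>|M. g \<omega> * f \<omega>)" if f: "f \<in> ?L" and gf: "integrable M (\<lambda>\<omega>. g \<omega> * f \<omega>)" for f
  proof -
    have fm [measurable]: "f \<in> borel_measurable M" using f by (rule Lspace_measurable)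
    obtain s where s: "\<And>i. simple_function M (s i)" "\<And>\<omega>. \<omega> \<in> space M \<Longrightarrow> (\<lambda>i. s i \<omega>) \<longlonglongrightarrow> f \<omega>"
      "\<And>i \<omega>. \<omega> \<in> space M \<Longrightarrow> dist (s i \<omega>) 0 \<le> 2 * dist (f \<omega>) 0"
      using borel_measurable_implies_sequence_metric[OF fm, of 0] by blast
    have sm [measurable]: "s i \<in> borel_measurable M" for i
      using s(1) by (rule borel_measurable_simple_function)
    have sL: "s i \<in> ?L" for i
      using s(3) by (intro Lspace_dominated[OF f sm, where C = 2]) (auto simp: dist_norm)
    have "(\<lambda>i. Lnorm p M (\<lambda>\<omega>. s i \<omega> - f \<omega>)) \<longlonglongrightarrow> 0"
    proof (rule Lnorm_dominated_convergence[OF p0 _ f, where C = 3])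
      show "AE \<omega> in M. norm (s i \<omega> - f \<omega>) \<le> 3 * norm (f \<omega>)" for i
      proof (rule AE_I2)
        fix \<omega> assume "\<omega> \<in> space M"
        then show "norm (s i \<omega> - f \<omega>) \<le> 3 * norm (f \<omega>)"
          using s(3)[of \<omega> i] norm_triangle_ineq4[of "s i \<omega>" "f \<omega>"] by (simp add: dist_norm)
      qed
      show "AE \<omega> in M. (\<lambda>i. s i \<omega> - f \<omega>) \<longlonglongrightarrow> 0"
        using s(2) by (intro AE_I2) (simp add: LIM_zero)
    qed measurable
    then have "(\<lambda>i. K' * Lnorm p M (\<lambda>\<omega>. s i \<omega> - f \<omega>)) \<longlonglongrightarrow> 0" by (rule tendsto_mult_right_zero)
    then have "(\<lambda>i. \<Phi> (s i) - \<Phi> f) \<longlonglongrightarrow> 0"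
      by (rule Lim_null_comparison[rotated]) (use diff_bound[OF sL f] in auto)
    then have "(\<lambda>i. \<Phi> (s i)) \<longlonglongrightarrow> \<Phi> f" by (simp add: LIM_zero_iff)
    moreover have "(\<lambda>i. LINT \<omega>|M. g \<omega> * s i \<omega>) \<longlonglongrightarrow> (LINT \<omega>|M. g \<omega> * f \<omega>)"
    proof (rule integral_dominated_convergence)
      show "integrable M (\<lambda>\<omega>. 2 * norm (g \<omega> * f \<omega>))" using gf by auto
      show "AE \<omega> in M. (\<lambda>i. g \<omega> * s i \<omega>) \<longlonglongrightarrow> g \<omega> * f \<omega>"
        using s(2) by (intro AE_I2 tendsto_mult_left)
      show "AE \<omega> in M. norm (g \<omega> * s i \<omega>) \<le> 2 * norm (g \<omega> * f \<omega>)" for i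
      proof (rule AE_I2)
        fix \<omega> assume "\<omega> \<in> space M"
        then have "\<bar>g \<omega>\<bar> * \<bar>s i \<omega>\<bar> \<le> \<bar>g \<omega>\<bar> * (2 * \<bar>f \<omega>\<bar>)"
          using s(3)[of \<omega> i] by (intro mult_left_mono) (auto simp: dist_norm)
        then show "norm (g \<omega> * s i \<omega>) \<le> 2 * norm (g \<omega> * f \<omega>)" by (simp add: abs_mult)
      qed
    qed measurable
    ultimately show ?thesis using simple[OF s(1) sL] LIMSEQ_unique by auto
  qed
  have repr_bounded: "\<Phi> f = (LINT \<omega>|M. g \<omega> * f \<omega>)"
    if f: "f \<in> borel_measurable M" and le: "\<And>\<omega>. \<bar>f \<omega>\<bar> \<le> c" for f c
  proof (rule repr)
    show "f \<in> ?L" using f le by (intro Lspace_bounded[OF M, where C = c]) auto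
    have "integrable M (\<lambda>\<omega>. c * g \<omega>)" using g by auto
    then show "integrable M (\<lambda>\<omega>. g \<omega> * f \<omega>)"
    proof (rule Bochner_Integration.integrable_bound)
      have "\<bar>g \<omega>\<bar> * \<bar>f \<omega>\<bar> \<le> \<bar>g \<omega>\<bar> * \<bar>c\<bar>" for \<omega>
        using le[of \<omega>] by (intro mult_left_mono) auto
      then show "AE \<omega> in M. norm (g \<omega> * f \<omega>) \<le> norm (c * g \<omega>)"
        by (intro AE_I2) (simp add: abs_mult mult.commute)
    qed (use f in measurable)
  qed
  have "g \<in> Lspace q M"
    using p
  proof (cases rule: conjugate_exponent_cases)
    case one
    \<comment> \<open>Testing with the sign of \<open>g\<close> on the set where \<open>\<bar>g\<bar>\<close> exceeds \<open>K'\<close> shows that this set is null.\<close>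
    define A where "A = {\<omega> \<in> space M. K' < \<bar>g \<omega>\<bar>}"
    have A [measurable]: "A \<in> sets M" unfolding A_def by measurable
    let ?f = "\<lambda>\<omega>. sgn (g \<omega>) * indicator A \<omega>"
    have fb: "\<bar>?f \<omega>\<bar> \<le> 1" for \<omega> by (auto simp: indicator_def sgn_if)
    have fm: "?f \<in> borel_measurable M" by measurable
    have fL: "?f \<in> ?L" using fb fm by (intro Lspace_bounded[OF M, where C = 1]) auto
    have intA: "integrable M (\<lambda>\<omega>. indicator A \<omega> * \<bar>g \<omega>\<bar>)" "integrable M (\<lambda>\<omega>. indicator A \<omega> * K')"
      using integrable_mult_indicator[OF A integrable_abs[OF g]]
        integrable_mult_indicator[OF A integrable_const[of K']] by auto
    have "(LINT \<omega>|M. indicator A \<omega> * \<bar>g \<omega>\<bar>) = \<Phi> ?f"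
      unfolding repr_bounded[OF fm fb]
      by (intro Bochner_Integration.integral_cong) (auto simp: indicator_def abs_sgn)
    also have "\<dots> \<le> K' * Lnorm p M ?f" using abs_bound[OF fL] by simp
    also have "\<dots> \<le> K' * Lnorm p M (indicator A :: 'a \<Rightarrow> real)"
      using ind1[OF A] p0 fm by (intro mult_left_mono Lnorm_mono) (auto simp: K'_def indicator_def abs_sgn_eq)
    also have "\<dots> = (LINT \<omega>|M. indicator A \<omega> * K')"
      using Lnorm_ind[OF A] one A by (simp add: Int_absorb1 sets.sets_into_space)
    finally have "(LINT \<omega>|M. indicator A \<omega> * (\<bar>g \<omega>\<bar> - K')) \<le> 0"
      using intA by (simp add: right_diff_distrib)
    moreover have nn: "0 \<le> indicator A \<omega> * (\<bar>g \<omega>\<bar> - K')" for \<omega> by (auto simp: indicator_def A_def)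
    ultimately have "(LINT \<omega>|M. indicator A \<omega> * (\<bar>g \<omega>\<bar> - K')) = 0"
      by (intro antisym integral_nonneg_AE) auto
    moreover have "integrable M (\<lambda>\<omega>. indicator A \<omega> * (\<bar>g \<omega>\<bar> - K'))"
      using intA by (simp add: right_diff_distrib)
    ultimately have "AE \<omega> in M. indicator A \<omega> * (\<bar>g \<omega>\<bar> - K') = 0"
      using nn by (simp add: integral_nonneg_eq_0_iff_AE)
    then have "AE \<omega> in M. norm (g \<omega>) \<le> K'"
      using AE_space by eventually_elim (auto simp: A_def indicator_def split: if_splits)
    then show ?thesis unfolding one(2) Lspace_infinity using gm by blast
  next
    case (greater r)
    \<comment> \<open>Testing with truncations of \<open>sgn g * \<bar>g\<bar> powr (r - 1)\<close>, for which the norm inequality is self-improving.\<close>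
    define I where "I k = (LINT \<omega>|M. indicator {\<omega>. \<bar>g \<omega>\<bar> \<le> real k} \<omega> * \<bar>g \<omega>\<bar> powr r)" for k :: nat
    let ?ind = "\<lambda>k \<omega>. indicator {\<omega>. \<bar>g \<omega>\<bar> \<le> real k} \<omega> :: real"
    have [measurable]: "?ind k \<in> borel_measurable M" for k
    proof -
      have "?ind k = (\<lambda>\<omega>. if \<bar>g \<omega>\<bar> \<le> real k then 1 else 0)" by (auto simp: indicator_def)
      then show ?thesis by simp
    qed
    have rp: "(r - 1) * p = r" using greater by (simp add: field_simps)
    have I_bound: "I k \<le> K' powr r" for k
    proof -
      let ?f = "\<lambda>\<omega>. ?ind k \<omega> * (sgn (g \<omega>) * \<bar>g \<omega>\<bar> powr (r - 1))"
      have fm: "?f \<in> borel_measurable M" by measurable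
      have fb: "\<bar>?f \<omega>\<bar> \<le> real k powr (r - 1)" for \<omega>
        using greater by (auto simp: indicator_def abs_mult abs_sgn_eq intro: powr_mono2)
      have fL: "?f \<in> ?L" using fb fm by (intro Lspace_bounded[OF M, where C = "real k powr (r - 1)"]) auto
      have I_nonneg: "0 \<le> I k" unfolding I_def by (intro integral_nonneg_AE) auto
      have absr: "\<bar>g \<omega>\<bar> * \<bar>g \<omega>\<bar> powr (r - 1) = \<bar>g \<omega>\<bar> powr r" for \<omega>
        using powr_mult_base[of "\<bar>g \<omega>\<bar>" "r - 1"] greater by simp
      have "I k = \<Phi> ?f"
        unfolding repr_bounded[OF fm fb] I_def
      proof (intro Bochner_Integration.integral_cong refl)
        fix \<omega>
        have "g \<omega> * (sgn (g \<omega>) * \<bar>g \<omega>\<bar> powr (r - 1)) = \<bar>g \<omega>\<bar> powr r"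
          using absr[of \<omega>] by (simp add: abs_sgn mult.assoc[symmetric])
        then show "?ind k \<omega> * \<bar>g \<omega>\<bar> powr r = g \<omega> * ?f \<omega>" by (simp add: indicator_def)
      qed
      also have "\<dots> \<le> K' * Lnorm p M ?f" using abs_bound[OF fL] by simp
      also have "Lnorm p M ?f = I k powr (1 / p)"
        unfolding Lnorm_def I_def
      proof (intro arg_cong2[where f = "(powr)"] refl Bochner_Integration.integral_cong)
        fix \<omega>
        show "norm (?f \<omega>) powr p = ?ind k \<omega> * \<bar>g \<omega>\<bar> powr r"
          using greater rp by (auto simp: indicator_def abs_mult abs_sgn_eq powr_powr)
      qed
      finally have le: "I k \<le> K' * I k powr (1 / p)" .
      show ?thesis
      proof (cases "I k = 0")
        case False
        then have pos: "0 < I k" using I_nonneg by simp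
        have "I k powr (1 / p) * I k powr (1 / r) = I k"
          using greater pos by (simp add: powr_add[symmetric])
        then have "I k powr (1 / p) * I k powr (1 / r) \<le> I k powr (1 / p) * K'"
          using le by (simp add: mult.commute)
        then have "I k powr (1 / r) \<le> K'" using pos by simp
        then have "(I k powr (1 / r)) powr r \<le> K' powr r" using greater by (intro powr_mono2) auto
        then show ?thesis using greater pos by (simp add: powr_powr)
      qed simp
    qed
    have int: "integrable M (\<lambda>\<omega>. ?ind k \<omega> * \<bar>g \<omega>\<bar> powr r)" for k
      using greater
      by (intro integrable_const_bound[where B = "real k powr r"])
         (auto simp: indicator_def intro!: AE_I2 powr_mono2)
    have mono: "?ind j \<omega> * \<bar>g \<omega>\<bar> powr r \<le> ?ind k \<omega> * \<bar>g \<omega>\<bar> powr r" if "j \<le> k" for j k \<omega>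
      using that by (auto simp: indicator_def)
    have "incseq I" unfolding incseq_def I_def using int mono by (auto intro!: integral_mono)
    then obtain L where L: "I \<longlonglongrightarrow> L" using incseq_convergent[of I "K' powr r"] I_bound by blast
    have "integrable M (\<lambda>\<omega>. \<bar>g \<omega>\<bar> powr r)"
    proof (rule integrable_monotone_convergence[OF int])
      show "AE \<omega> in M. mono (\<lambda>k. ?ind k \<omega> * \<bar>g \<omega>\<bar> powr r)" using mono by (auto simp: mono_def)
      have "(\<lambda>k. ?ind k \<omega> * \<bar>g \<omega>\<bar> powr r) \<longlonglongrightarrow> \<bar>g \<omega>\<bar> powr r" for \<omega>
      proof (rule tendsto_eventually)
        obtain k0 where "\<bar>g \<omega>\<bar> \<le> real k0" using real_arch_simple by blast
        then show "\<forall>\<^sub>F k in sequentially. ?ind k \<omega> * \<bar>g \<omega>\<bar> powr r = \<bar>g \<omega>\<bar> powr r"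
          by (auto simp: eventually_sequentially indicator_def intro!: exI[of _ k0])
      qed
      then show "AE \<omega> in M. (\<lambda>k. ?ind k \<omega> * \<bar>g \<omega>\<bar> powr r) \<longlonglongrightarrow> \<bar>g \<omega>\<bar> powr r" by simp
      show "(\<lambda>k. LINT \<omega>|M. ?ind k \<omega> * \<bar>g \<omega>\<bar> powr r) \<longlonglongrightarrow> L" using L by (simp add: I_def[abs_def])
    qed measurable
    then show ?thesis using greater by (simp add: Lspace_ennreal)
  qed
  moreover have "\<Phi> f = pairing M g f" if "f \<in> ?L" for f
    using repr[OF that] integrable_inner_conjugate[OF p \<open>g \<in> Lspace q M\<close> that]
    by (simp add: pairing_def)
  ultimately show ?thesis by blast
qed

lemma pairing_zero: "pairing M g (\<lambda>_. 0) = 0"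
  by (simp add: pairing_def)

abbreviation policy_pairing ::
  "'a measure \<Rightarrow> ('t::finite \<Rightarrow> 'a \<Rightarrow> 'b::euclidean_space) \<Rightarrow> ('t \<Rightarrow> 'a \<Rightarrow> 'b) \<Rightarrow> real" where
  "policy_pairing M g v \<equiv> (\<Sum>t\<in>UNIV. pairing M (g t) (v t))"

text \<open>
  A policy is the finite sum of its scalar coordinates at the single stages, and the scalar theorem
  applies to each of them.
\<close>

theorem policy_functional_representation:
  fixes L :: "('t::finite \<Rightarrow> 'a \<Rightarrow> 'b::euclidean_space) \<Rightarrow> real"
  assumes M: "finite_measure M" and p: "1 \<le> p" "1 / ennreal p + 1 / q = 1"
    and L: "linear L"
    and bound: "\<And>v. v \<in> policies (ennreal p) M \<Longrightarrow> L v \<le> K * (\<Sum>t\<in>UNIV. Lnorm p M (v t))"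
  shows "\<exists>g\<in>policies q M. \<forall>v\<in>policies (ennreal p) M. L v = policy_pairing M g v"
proof -
  have p0: "0 < p" using p by simp
  define emb :: "'t \<Rightarrow> 'b \<Rightarrow> ('a \<Rightarrow> real) \<Rightarrow> 't \<Rightarrow> 'a \<Rightarrow> 'b" where
    "emb t b a = (\<lambda>s \<omega>. if s = t then a \<omega> *\<^sub>R b else 0)" for t b a
  have emb_add: "emb t b (\<lambda>\<omega>. f \<omega> + g \<omega>) = emb t b f + emb t b g" for t b f g
    by (auto simp: emb_def fun_eq_iff scaleR_add_left)
  have emb_scale: "emb t b (\<lambda>\<omega>. c * f \<omega>) = c *\<^sub>R emb t b f" for t b c f
    by (auto simp: emb_def fun_eq_iff scaleR_fun_def)
  have emb_Lspace: "emb t b f s \<in> Lspace (ennreal p) M" if f: "f \<in> Lspace (ennreal p) M" for t b f s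
  proof (cases "s = t")
    case True
    have [measurable]: "f \<in> borel_measurable M" using f by (rule Lspace_measurable)
    show ?thesis using True
      by (intro Lspace_dominated[OF f, where C = "norm b"]) (auto simp: emb_def)
  qed (auto simp: emb_def Lspace_zero)
  have "\<exists>g\<in>Lspace q M. \<forall>f\<in>Lspace (ennreal p) M. L (emb t b f) = pairing M g f"
    if b: "b \<in> Basis" for t b
  proof (rule Lp_functional_representation[OF M p])
    show "L (emb t b (\<lambda>\<omega>. f \<omega> + g \<omega>)) = L (emb t b f) + L (emb t b g)" for f g
      unfolding emb_add by (rule linear_add[OF L])
    show "L (emb t b (\<lambda>\<omega>. c * f \<omega>)) = c * L (emb t b f)" for c f
      unfolding emb_scale using linear_scale[OF L] by simp
    show "L (emb t b f) \<le> K * Lnorm p M f" if f: "f \<in> Lspace (ennreal p) M" for f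
    proof -
      have "Lnorm p M (emb t b f s) = (if s = t then Lnorm p M f else 0)" for s
        using b by (auto simp: emb_def Lnorm_def)
      then show ?thesis using bound[of "emb t b f"] emb_Lspace[OF f] by (auto simp: policies_def)
    qed
  qed
  then have ex: "\<exists>g. g \<in> Lspace q M \<and> (\<forall>f\<in>Lspace (ennreal p) M. L (emb t b f) = pairing M g f)"
    if "b \<in> Basis" for t b using that by blast
  define G where "G t b = (SOME g. g \<in> Lspace q M \<and>
      (\<forall>f\<in>Lspace (ennreal p) M. L (emb t b f) = pairing M g f))" for t b
  have G: "G t b \<in> Lspace q M"
    and G_repr: "\<And>f. f \<in> Lspace (ennreal p) M \<Longrightarrow> L (emb t b f) = pairing M (G t b) f"
    if "b \<in> Basis" for t b
    using someI_ex[OF ex[OF that, of t]] by (auto simp: G_def)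
  define g where "g t \<omega> = (\<Sum>b\<in>Basis. G t b \<omega> *\<^sub>R b)" for t \<omega>
  have gL: "g t \<in> Lspace q M" for t
    unfolding g_def
  proof (rule Lspace_sum)
    fix b :: 'b assume b: "b \<in> Basis"
    have [measurable]: "G t b \<in> borel_measurable M" using G[OF b] by (rule Lspace_measurable)
    show "(\<lambda>\<omega>. G t b \<omega> *\<^sub>R b) \<in> Lspace q M"
      using b by (intro Lspace_dominated[OF G[OF b, of t], where C = 1]) auto
  qed
  have "L v = policy_pairing M g v" if v: "v \<in> policies (ennreal p) M" for v
  proof -
    have comp: "(\<lambda>\<omega>. v t \<omega> \<bullet> b) \<in> Lspace (ennreal p) M" if b: "b \<in> Basis" for t b
    proof -
      have vt: "v t \<in> Lspace (ennreal p) M" using v by (rule policiesD)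
      have [measurable]: "v t \<in> borel_measurable M" using vt by (rule Lspace_measurable)
      show ?thesis
        using b by (intro Lspace_dominated[OF vt, where C = 1]) (auto simp: Basis_le_norm)
    qed
    have "v = (\<Sum>t\<in>UNIV. \<Sum>b\<in>Basis. emb t b (\<lambda>\<omega>. v t \<omega> \<bullet> b))"
    proof (intro ext)
      fix s \<omega>
      have "(\<Sum>t\<in>UNIV. \<Sum>b\<in>Basis. emb t b (\<lambda>\<omega>. v t \<omega> \<bullet> b)) s \<omega>
          = (\<Sum>t\<in>UNIV. if s = t then (\<Sum>b\<in>Basis. (v t \<omega> \<bullet> b) *\<^sub>R b) else 0)"
        unfolding sum_fun_apply by (intro sum.cong refl) (auto simp: emb_def)
      then show "v s \<omega> = (\<Sum>t\<in>UNIV. \<Sum>b\<in>Basis. emb t b (\<lambda>\<omega>. v t \<omega> \<bullet> b)) s \<omega>"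
        by (simp add: euclidean_representation)
    qed
    then have "L v = L (\<Sum>t\<in>UNIV. \<Sum>b\<in>Basis. emb t b (\<lambda>\<omega>. v t \<omega> \<bullet> b))" by simp
    also have "\<dots> = (\<Sum>t\<in>UNIV. \<Sum>b\<in>Basis. L (emb t b (\<lambda>\<omega>. v t \<omega> \<bullet> b)))"
      using L by (simp add: linear_sum)
    also have "\<dots> = (\<Sum>t\<in>UNIV. \<Sum>b\<in>Basis. pairing M (G t b) (\<lambda>\<omega>. v t \<omega> \<bullet> b))"
      using comp by (intro sum.cong refl G_repr) auto
    also have "\<dots> = policy_pairing M g v"
    proof (intro sum.cong refl)
      fix t
      have "integrable M (\<lambda>\<omega>. G t b \<omega> \<bullet> (v t \<omega> \<bullet> b))" if "b \<in> Basis" for b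
        using integrable_inner_conjugate[OF p G[OF that] comp[OF that]] .
      then have "(\<Sum>b\<in>Basis. pairing M (G t b) (\<lambda>\<omega>. v t \<omega> \<bullet> b))
          = (LINT \<omega>|M. (\<Sum>b\<in>Basis. G t b \<omega> \<bullet> (v t \<omega> \<bullet> b)))"
        unfolding pairing_def by (rule Bochner_Integration.integral_sum[symmetric])
      moreover have "(\<Sum>b\<in>Basis. G t b \<omega> \<bullet> (v t \<omega> \<bullet> b)) = g t \<omega> \<bullet> v t \<omega>" for \<omega>
        unfolding g_def inner_sum_left inner_scaleR_left
        by (intro sum.cong refl) (simp add: inner_commute)
      ultimately show "(\<Sum>b\<in>Basis. pairing M (G t b) (\<lambda>\<omega>. v t \<omega> \<bullet> b)) = pairing M (g t) (v t)"
        by (simp only: pairing_def)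
    qed
    finally show ?thesis .
  qed
  then show ?thesis using gL by (intro bexI[of _ g]) (auto simp: policies_def)
qed

section \<open>Measurable multifunctions and selections\<close>

text \<open>
  Distances to a multifunction are detected on a countable dense set, through the balls that the
  multifunction meets.
\<close>

lemma borel_measurable_infdist_multifunction:
  fixes S :: "'a \<Rightarrow> 'b::euclidean_space set"
  assumes S: "measurable_multifunction G S" and g [measurable]: "g \<in> borel_measurable G"
  shows "(\<lambda>\<omega>. infdist (g \<omega>) (S \<omega>)) \<in> borel_measurable G"
  unfolding borel_measurable_iff_less
proof
  fix a :: real
  obtain D :: "'b set" where D: "countable D" "\<And>X. open X \<Longrightarrow> X \<noteq> {} \<Longrightarrow> \<exists>d\<in>D. d \<in> X"
    by (rule countable_dense_setE) blast
  have hit: "{\<omega> \<in> space G. S \<omega> \<inter> U \<noteq> {}} \<in> sets G" if "open U" for U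
    using S that by (auto simp: measurable_multifunction_def)
  let ?E = "{\<omega> \<in> space G. S \<omega> = {} \<and> 0 < a}"
  let ?H = "\<lambda>d r. {\<omega> \<in> space G. S \<omega> \<inter> ball d r \<noteq> {}} \<inter> {\<omega> \<in> space G. dist (g \<omega>) d + r < a}"
  have "infdist (g \<omega>) (S \<omega>) < a \<longleftrightarrow>
      S \<omega> = {} \<and> 0 < a \<or> (\<exists>d\<in>D. \<exists>r\<in>\<rat>. S \<omega> \<inter> ball d r \<noteq> {} \<and> dist (g \<omega>) d + r < a)" for \<omega>
  proof (cases "S \<omega> = {}")
    case True
    then show ?thesis by (simp add: infdist_def)
  next
    case False
    show ?thesis
    proof
      assume "infdist (g \<omega>) (S \<omega>) < a"
      then obtain y where y: "y \<in> S \<omega>" "dist (g \<omega>) y < a"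
        using False by (auto simp: infdist_def cINF_less_iff)
      then obtain r where r: "r \<in> \<rat>" "0 < r" "r < (a - dist (g \<omega>) y) / 2"
        using Rats_dense_in_real[of 0 "(a - dist (g \<omega>) y) / 2"] by auto
      have "y \<in> ball y r" using r by simp
      then obtain d where d: "d \<in> D" "d \<in> ball y r" using D(2)[of "ball y r"] by auto
      have "dist (g \<omega>) d \<le> dist (g \<omega>) y + dist y d" by (rule dist_triangle)
      then have "dist (g \<omega>) d + r < a" using r d by (simp add: field_simps)
      moreover have "y \<in> S \<omega> \<inter> ball d r" using y d by (simp add: dist_commute)
      ultimately show "S \<omega> = {} \<and> 0 < a \<or> (\<exists>d\<in>D. \<exists>r\<in>\<rat>. S \<omega> \<inter> ball d r \<noteq> {} \<and> dist (g \<omega>) d + r < a)"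
        using d r by blast
    next
      assume "S \<omega> = {} \<and> 0 < a \<or> (\<exists>d\<in>D. \<exists>r\<in>\<rat>. S \<omega> \<inter> ball d r \<noteq> {} \<and> dist (g \<omega>) d + r < a)"
      then obtain d r y where "y \<in> S \<omega>" "dist d y < r" "dist (g \<omega>) d + r < a" using False by auto
      moreover have "dist (g \<omega>) y \<le> dist (g \<omega>) d + dist d y" by (rule dist_triangle)
      ultimately show "infdist (g \<omega>) (S \<omega>) < a" using infdist_le[of y "S \<omega>" "g \<omega>"] by linarith
    qed
  qed
  then have "{\<omega> \<in> space G. infdist (g \<omega>) (S \<omega>) < a} = ?E \<union> (\<Union>d\<in>D. \<Union>r\<in>\<rat>. ?H d r)"
    by blast
  moreover have "?E \<in> sets G"
  proof -
    have "?E = (if 0 < a then space G - {\<omega> \<in> space G. S \<omega> \<inter> UNIV \<noteq> {}} else {})" by auto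
    then show ?thesis using hit[of UNIV] by auto
  qed
  moreover have "?H d r \<in> sets G" for d r
  proof (rule sets.Int)
    show "{\<omega> \<in> space G. dist (g \<omega>) d + r < a} \<in> sets G" by measurable
  qed (simp add: hit)
  ultimately show "{\<omega> \<in> space G. infdist (g \<omega>) (S \<omega>) < a} \<in> sets G"
    using D(1) countable_rat by (auto intro!: sets.Un sets.countable_UN'')
qed

text \<open>
  One step of a lexicographic minimization over the zero set of \<open>h\<close>: the least value \<open>v\<close> of the
  linear functional \<open>\<xi> \<mapsto> \<xi> \<bullet> b\<close> on this set is a measurable function.  By compactness the zero set
  meets the half-space \<open>\<xi> \<bullet> b \<le> a\<close> exactly if a continuous penalty has infimum zero,
  and this infimum may be taken over a countable dense set.  On the exceptional points, where \<open>h\<close> need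
  not be continuous, the same formula defines \<open>v\<close>, so that measurability is not affected by them.
\<close>

lemma measurable_least_coordinate_of_zeros:
  fixes h :: "'b::euclidean_space \<Rightarrow> 'a \<Rightarrow> real"
  assumes h [measurable]: "\<And>\<xi>. h \<xi> \<in> borel_measurable G" and nonneg: "\<And>\<xi> \<omega>. 0 \<le> h \<xi> \<omega>"
  shows "\<exists>v\<in>borel_measurable G. \<forall>\<omega>. continuous_on UNIV (\<lambda>\<xi>. h \<xi> \<omega>) \<longrightarrow> bounded {\<xi>. h \<xi> \<omega> \<le> 1} \<longrightarrow>
    (\<exists>\<xi>. h \<xi> \<omega> = 0) \<longrightarrow> (\<exists>\<xi>. h \<xi> \<omega> = 0 \<and> \<xi> \<bullet> b = v \<omega>)"
proof -
  obtain D :: "'b set" where D: "countable D" "\<And>X. open X \<Longrightarrow> X \<noteq> {} \<Longrightarrow> \<exists>d\<in>D. d \<in> X"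
    by (rule countable_dense_setE) blast
  define pen where "pen a \<xi> \<omega> = h \<xi> \<omega> + max 0 (\<xi> \<bullet> b - a)" for a \<xi> \<omega>
  define W where "W a \<omega> \<longleftrightarrow> (\<forall>k::nat. \<exists>d\<in>D. pen a d \<omega> < 1 / Suc k)" for a \<omega>
  \<comment> \<open>Rational thresholds make the infimum countable; extended reals give it a meaning for every \<open>\<omega>\<close>.\<close>
  define v where "v \<omega> = real_of_ereal (INF a::rat. if W (of_rat a) \<omega> then ereal (of_rat a) else \<infinity>)" for \<omega>
  have W_sets [measurable]: "Measurable.pred G (W a)" for a
    unfolding W_def pen_def using D(1) by measurable
  have "v \<in> borel_measurable G" unfolding v_def by measurable
  moreover have "\<exists>\<xi>. h \<xi> \<omega> = 0 \<and> \<xi> \<bullet> b = v \<omega>"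
    if cont: "continuous_on UNIV (\<lambda>\<xi>. h \<xi> \<omega>)" and bdd: "bounded {\<xi>. h \<xi> \<omega> \<le> 1}" and ex: "\<exists>\<xi>. h \<xi> \<omega> = 0"
    for \<omega>
  proof -
    have pen_cont: "continuous_on UNIV (\<lambda>\<xi>. pen a \<xi> \<omega>)" for a
      unfolding pen_def by (intro continuous_intros cont)
    have pen_nonneg: "0 \<le> pen a \<xi> \<omega>" for a \<xi> unfolding pen_def using nonneg[of \<xi> \<omega>] by simp
    have pen_zero: "pen a \<xi> \<omega> = 0 \<longleftrightarrow> h \<xi> \<omega> = 0 \<and> \<xi> \<bullet> b \<le> a" for a \<xi>
      unfolding pen_def using nonneg[of \<xi> \<omega>] by (auto simp: max_def)
    have sub_compact: "compact {\<xi>. h \<xi> \<omega> \<le> 1}"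
      using bdd cont by (auto simp: compact_eq_bounded_closed intro!: closed_Collect_le)
    have W_iff: "W a \<omega> \<longleftrightarrow> (\<exists>\<xi>. h \<xi> \<omega> = 0 \<and> \<xi> \<bullet> b \<le> a)" for a
    proof
      assume W: "W a \<omega>"
      have "\<exists>d\<in>D. pen a d \<omega> < 1 / Suc 0" using W unfolding W_def by blast
      then obtain d where "pen a d \<omega> < 1" by auto
      then have "{\<xi>. h \<xi> \<omega> \<le> 1} \<noteq> {}" by (auto simp: pen_def max_def split: if_splits intro!: exI[of _ d])
      then obtain \<xi> where \<xi>: "\<And>\<zeta>. h \<zeta> \<omega> \<le> 1 \<Longrightarrow> pen a \<xi> \<omega> \<le> pen a \<zeta> \<omega>"
        using continuous_attains_inf[OF sub_compact _ continuous_on_subset[OF pen_cont[of a]]] by auto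
      have "pen a \<xi> \<omega> \<le> 1 / Suc k" for k
      proof -
        obtain d where d: "pen a d \<omega> < 1 / Suc k" using W unfolding W_def by blast
        moreover have "1 / Suc k \<le> (1::real)" by simp
        moreover have "h d \<omega> \<le> pen a d \<omega>" by (simp add: pen_def)
        ultimately have "h d \<omega> \<le> 1" by linarith
        then show ?thesis using \<xi>[of d] d by linarith
      qed
      then have "pen a \<xi> \<omega> \<le> 0"
        using LIMSEQ_inverse_real_of_nat by (intro LIMSEQ_le_const) (auto simp: inverse_eq_divide)
      then have "pen a \<xi> \<omega> = 0" using pen_nonneg[of a \<xi>] by simp
      then show "\<exists>\<xi>. h \<xi> \<omega> = 0 \<and> \<xi> \<bullet> b \<le> a" using pen_zero by blast
    next
      assume "\<exists>\<xi>. h \<xi> \<omega> = 0 \<and> \<xi> \<bullet> b \<le> a"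
      then obtain \<xi> where \<xi>: "pen a \<xi> \<omega> = 0" using pen_zero by blast
      show "W a \<omega>"
        unfolding W_def
      proof
        fix k :: nat
        have "open {\<zeta>. pen a \<zeta> \<omega> < 1 / Suc k}"
          by (intro open_Collect_less pen_cont continuous_intros)
        moreover have "\<xi> \<in> {\<zeta>. pen a \<zeta> \<omega> < 1 / Suc k}" using \<xi> by simp
        ultimately show "\<exists>d\<in>D. pen a d \<omega> < 1 / Suc k" using D(2) by blast
      qed
    qed
    have "closed {\<xi>. h \<xi> \<omega> = 0}" using cont by (intro closed_Collect_eq continuous_intros)
    moreover have "bounded {\<xi>. h \<xi> \<omega> = 0}" by (rule bounded_subset[OF bdd]) auto
    ultimately have "compact {\<xi>. h \<xi> \<omega> = 0}" by (simp add: compact_eq_bounded_closed)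
    moreover have "continuous_on {\<xi>. h \<xi> \<omega> = 0} (\<lambda>\<xi>. \<xi> \<bullet> b)" by (intro continuous_intros)
    ultimately obtain \<xi> where \<xi>: "h \<xi> \<omega> = 0" and least: "\<And>\<zeta>. h \<zeta> \<omega> = 0 \<Longrightarrow> \<xi> \<bullet> b \<le> \<zeta> \<bullet> b"
      using continuous_attains_inf[of "{\<xi>. h \<xi> \<omega> = 0}" "\<lambda>\<xi>. \<xi> \<bullet> b"] ex by auto
    have W_least: "W a \<omega> \<longleftrightarrow> \<xi> \<bullet> b \<le> a" for a
      unfolding W_iff using \<xi> least by (auto intro: order_trans)
    have "(INF a::rat. if W (of_rat a) \<omega> then ereal (of_rat a) else \<infinity>) = ereal (\<xi> \<bullet> b)"
    proof (rule antisym)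
      show "(INF a::rat. if W (of_rat a) \<omega> then ereal (of_rat a) else \<infinity>) \<le> ereal (\<xi> \<bullet> b)"
      proof (rule ereal_le_epsilon2)
        fix e :: real assume "0 < e"
        then obtain a where a: "\<xi> \<bullet> b < of_rat a" "of_rat a < \<xi> \<bullet> b + e"
          using of_rat_dense[of "\<xi> \<bullet> b" "\<xi> \<bullet> b + e"] by auto
        have "(INF a::rat. if W (of_rat a) \<omega> then ereal (of_rat a) else \<infinity>)
            \<le> (if W (of_rat a) \<omega> then ereal (of_rat a) else \<infinity>)" by (rule INF_lower) simp
        also have "\<dots> \<le> ereal (\<xi> \<bullet> b) + ereal e" using a by (simp add: W_least)
        finally show "(INF a::rat. if W (of_rat a) \<omega> then ereal (of_rat a) else \<infinity>) \<le> ereal (\<xi> \<bullet> b) + ereal e" .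
      qed
      show "ereal (\<xi> \<bullet> b) \<le> (INF a::rat. if W (of_rat a) \<omega> then ereal (of_rat a) else \<infinity>)"
        by (rule INF_greatest) (auto simp: W_least)
    qed
    then have "v \<omega> = \<xi> \<bullet> b" by (simp add: v_def)
    then show ?thesis using \<xi> by auto
  qed
  ultimately show ?thesis by blast
qed

text \<open>
  Adding \<open>\<bar>\<xi> \<bullet> b - v \<omega>\<bar>\<close> to \<open>h\<close> narrows the zero set to the points that are minimal in the direction
  \<open>b\<close>.  After all basis vectors have been processed a single point is left, namely the
  lexicographically least zero, and its coordinates are the measurable functions \<open>v\<close>.  The set of the
  points \<open>\<omega>\<close> where \<open>h\<close> behaves well enters pointwise only, so it may fail to be measurable; this matters
  because the \<open>\<sigma>\<close>-algebras of a filtration need not contain the null sets.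
\<close>

theorem measurable_selection_of_zeros:
  fixes h :: "'b::euclidean_space \<Rightarrow> 'a \<Rightarrow> real"
  assumes h: "\<And>\<xi>. h \<xi> \<in> borel_measurable G" and nonneg: "\<And>\<xi> \<omega>. 0 \<le> h \<xi> \<omega>"
  shows "\<exists>z\<in>borel_measurable G. \<forall>\<omega>. continuous_on UNIV (\<lambda>\<xi>. h \<xi> \<omega>) \<longrightarrow> bounded {\<xi>. h \<xi> \<omega> \<le> 1} \<longrightarrow>
    (\<exists>\<xi>. h \<xi> \<omega> = 0) \<longrightarrow> h (z \<omega>) \<omega> = 0"
proof -
  define good where "good k \<omega> \<longleftrightarrow> continuous_on UNIV (\<lambda>\<xi>. k \<xi> \<omega>) \<and> bounded {\<xi>. k \<xi> \<omega> \<le> 1} \<and> (\<exists>\<xi>. k \<xi> \<omega> = 0)"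
    for k :: "'b \<Rightarrow> 'a \<Rightarrow> real" and \<omega>
  have "\<exists>k c. (\<forall>\<xi>. k \<xi> \<in> borel_measurable G) \<and> (\<forall>\<xi> \<omega>. h \<xi> \<omega> \<le> k \<xi> \<omega>) \<and>
      (\<forall>b\<in>B. c b \<in> borel_measurable G) \<and>
      (\<forall>\<omega>. good h \<omega> \<longrightarrow> good k \<omega> \<and> (\<forall>\<xi>. k \<xi> \<omega> = 0 \<longrightarrow> (\<forall>b\<in>B. \<xi> \<bullet> b = c b \<omega>)))"
    if "finite B" for B :: "'b set"
    using that
  proof induction
    case empty
    show ?case using h by (intro exI[of _ h]) auto
  next
    case (insert b B)
    then obtain k c where k [measurable]: "\<And>\<xi>. k \<xi> \<in> borel_measurable G" and hk: "\<And>\<xi> \<omega>. h \<xi> \<omega> \<le> k \<xi> \<omega>"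
      and c: "\<And>b. b \<in> B \<Longrightarrow> c b \<in> borel_measurable G"
      and good: "\<And>\<omega>. good h \<omega> \<Longrightarrow> good k \<omega>"
      and coord: "\<And>\<omega> \<xi> b. good h \<omega> \<Longrightarrow> k \<xi> \<omega> = 0 \<Longrightarrow> b \<in> B \<Longrightarrow> \<xi> \<bullet> b = c b \<omega>"
      by blast
    have k_nonneg: "0 \<le> k \<xi> \<omega>" for \<xi> \<omega> using hk[of \<xi> \<omega>] nonneg[of \<xi> \<omega>] by simp
    obtain v where v [measurable]: "v \<in> borel_measurable G"
      and v_zero: "\<And>\<omega>. good k \<omega> \<Longrightarrow> \<exists>\<xi>. k \<xi> \<omega> = 0 \<and> \<xi> \<bullet> b = v \<omega>"
      using measurable_least_coordinate_of_zeros[where h = k and b = b, OF k k_nonneg] by (auto simp: good_def)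
    define k' where "k' \<xi> \<omega> = k \<xi> \<omega> + \<bar>\<xi> \<bullet> b - v \<omega>\<bar>" for \<xi> \<omega>
    define c' where "c' = c(b := v)"
    have k'm: "k' \<xi> \<in> borel_measurable G" for \<xi> unfolding k'_def by measurable
    have hk': "h \<xi> \<omega> \<le> k' \<xi> \<omega>" for \<xi> \<omega> using hk[of \<xi> \<omega>] by (simp add: k'_def)
    have c'm: "c' d \<in> borel_measurable G" if "d \<in> insert b B" for d
      using that c v by (auto simp: c'_def)
    have zero: "k' \<xi> \<omega> = 0 \<longleftrightarrow> k \<xi> \<omega> = 0 \<and> \<xi> \<bullet> b = v \<omega>" for \<xi> \<omega>
      unfolding k'_def using k_nonneg[of \<xi> \<omega>] by auto
    have "good k' \<omega>" if "good h \<omega>" for \<omega>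
    proof -
      have g: "good k \<omega>" using good that .
      have "bounded {\<xi>. k' \<xi> \<omega> \<le> 1}"
        by (rule bounded_subset[of "{\<xi>. k \<xi> \<omega> \<le> 1}"]) (use g in \<open>auto simp: good_def k'_def\<close>)
      moreover have "continuous_on UNIV (\<lambda>\<xi>. k' \<xi> \<omega>)"
        unfolding k'_def using g by (intro continuous_intros) (auto simp: good_def)
      ultimately show ?thesis using v_zero[OF g] by (auto simp: good_def zero)
    qed
    moreover have "\<xi> \<bullet> d = c' d \<omega>" if "good h \<omega>" "k' \<xi> \<omega> = 0" "d \<in> insert b B" for \<xi> \<omega> d
      using that coord[of \<omega> \<xi> d] zero[of \<xi> \<omega>] by (auto simp: c'_def)
    ultimately show ?case using k'm hk' c'm by blast
  qed
  from this[OF finite_Basis] obtain k c where hk: "\<And>\<xi> \<omega>. h \<xi> \<omega> \<le> k \<xi> \<omega>"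
    and c: "\<And>b. b \<in> Basis \<Longrightarrow> c b \<in> borel_measurable G"
    and good: "\<And>\<omega>. good h \<omega> \<Longrightarrow> good k \<omega>"
    and coord: "\<And>\<omega> \<xi> b. good h \<omega> \<Longrightarrow> k \<xi> \<omega> = 0 \<Longrightarrow> b \<in> Basis \<Longrightarrow> \<xi> \<bullet> b = c b \<omega>"
    by blast
  let ?z = "\<lambda>\<omega>. \<Sum>b\<in>Basis. c b \<omega> *\<^sub>R b"
  have "?z \<in> borel_measurable G"
    using c by (intro borel_measurable_sum borel_measurable_scaleR) auto
  moreover have "h (?z \<omega>) \<omega> = 0" if g: "good h \<omega>" for \<omega>
  proof -
    obtain \<xi> where \<xi>: "k \<xi> \<omega> = 0" using good[OF g] by (auto simp: good_def)
    have "?z \<omega> = (\<Sum>b\<in>Basis. (\<xi> \<bullet> b) *\<^sub>R b)" using coord[OF g \<xi>] by simp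
    then have "?z \<omega> = \<xi>" by (simp add: euclidean_representation)
    then show ?thesis using hk[of \<xi> \<omega>] nonneg[of \<xi> \<omega>] \<xi> by simp
  qed
  ultimately show ?thesis by (intro bexI[of _ ?z]) (auto simp: good_def)
qed

lemma infdist_convex_combination:
  fixes S :: "'b::euclidean_space set"
  assumes S: "convex S" "closed S" and u: "0 \<le> u" "0 \<le> v" "u + v = 1"
  shows "infdist (u *\<^sub>R a + v *\<^sub>R b) S \<le> u * infdist a S + v * infdist b S"
proof (cases "S = {}")
  case True
  then show ?thesis by (simp add: infdist_def)
next
  case False
  obtain x where x: "x \<in> S" "infdist a (S) = dist a x"
    using infdist_attains_inf[OF S(2) False] by blast
  obtain y where y: "y \<in> S" "infdist b (S) = dist b y"
    using infdist_attains_inf[OF S(2) False] by blast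
  have "u *\<^sub>R x + v *\<^sub>R y \<in> S"
    using S(1) x y u by (auto simp: convex_def)
  then have "infdist (u *\<^sub>R a + v *\<^sub>R b) (S) \<le> dist (u *\<^sub>R a + v *\<^sub>R b) (u *\<^sub>R x + v *\<^sub>R y)"
    by (rule infdist_le)
  also have "\<dots> = norm (u *\<^sub>R (a - x) + v *\<^sub>R (b - y))" by (simp add: dist_norm algebra_simps)
  also have "\<dots> \<le> u * dist a x + v * dist b y"
    using norm_triangle_ineq[of "u *\<^sub>R (a - x)" "v *\<^sub>R (b - y)"] u by (simp add: dist_norm)
  finally show ?thesis using x y by simp
qed

section \<open>Multistage systems with recourse\<close>

lemma borel_measurable_vec_lambda:
  fixes g :: "'t::finite \<Rightarrow> 'a \<Rightarrow> 'b::euclidean_space"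
  assumes "\<And>s. g s \<in> borel_measurable G"
  shows "(\<lambda>\<omega>. \<chi> s. g s \<omega>) \<in> borel_measurable G"
proof (subst borel_measurable_euclidean_space, rule ballI)
  fix e :: "'b^'t" assume "e \<in> Basis"
  then obtain s u where e: "e = axis s u" by (auto simp: Basis_vec_def)
  have "(\<lambda>\<omega>. (\<chi> s. g s \<omega>) \<bullet> e) = (\<lambda>\<omega>. g s \<omega> \<bullet> u)" by (simp add: e inner_axis)
  then show "(\<lambda>\<omega>. (\<chi> s. g s \<omega>) \<bullet> e) \<in> borel_measurable G"
    using borel_measurable_inner[OF assms[of s] borel_measurable_const[of u]] by simp
qed

lemma norm_vec_le_sum: "norm v \<le> (\<Sum>s\<in>UNIV. norm (v $ s))"
  unfolding norm_vec_def by (intro L2_set_le_sum) auto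

lemma Lspace_integrable:
  fixes g :: "'a \<Rightarrow> 'b::euclidean_space"
  assumes "finite_measure M" "1 \<le> p" "g \<in> Lspace (ennreal p) M"
  shows "integrable M g"
proof -
  interpret finite_measure M by fact
  have "integrable M (\<lambda>\<omega>. 1 + norm (g \<omega>) powr p)"
    using assms by (auto simp: Lspace_ennreal)
  then show ?thesis
  proof (rule Bochner_Integration.integrable_bound)
    have "norm (g \<omega>) \<le> 1 + norm (g \<omega>) powr p" for \<omega>
    proof (cases "norm (g \<omega>) \<le> 1")
      case False
      then have "norm (g \<omega>) powr 1 \<le> norm (g \<omega>) powr p" using assms(2) by (intro powr_mono) auto
      then show ?thesis using False by (simp split: if_splits)
    qed (simp add: add_increasing2)
    then show "AE \<omega> in M. norm (g \<omega>) \<le> norm (1 + norm (g \<omega>) powr p)" by simp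
  qed (use assms(3) in \<open>simp add: Lspace_measurable\<close>)
qed

lemma vec_cond_exp_of_measurable:
  fixes g :: "'a \<Rightarrow> real^'n"
  assumes M: "finite_measure M" and G: "subalgebra M G" and g: "integrable M g" "g \<in> borel_measurable G"
  shows "AE \<omega> in M. vec_cond_exp M G g \<omega> = g \<omega>"
proof -
  interpret finite_measure_subalgebra M G
    by (intro finite_measure_subalgebra.intro M finite_measure_subalgebra_axioms.intro G)
  have "AE \<omega> in M. real_cond_exp M G (\<lambda>\<omega>. g \<omega> $ i) \<omega> = g \<omega> $ i" for i
  proof (rule real_cond_exp_F_meas)
    have eq: "(\<lambda>\<omega>. g \<omega> $ i) = (\<lambda>\<omega>. g \<omega> \<bullet> axis i 1)" by (simp add: inner_axis)
    show "integrable M (\<lambda>\<omega>. g \<omega> $ i)" "(\<lambda>\<omega>. g \<omega> $ i) \<in> borel_measurable G"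
      unfolding eq using g by auto
  qed
  then have "AE \<omega> in M. \<forall>i. real_cond_exp M G (\<lambda>\<omega>. g \<omega> $ i) \<omega> = g \<omega> $ i"
    by (simp add: AE_all_countable)
  then show ?thesis by eventually_elim (simp add: vec_cond_exp_def vec_eq_iff)
qed

lemma borel_measurable_vec_cond_exp: "vec_cond_exp M G x \<in> borel_measurable G"
proof -
  have "(\<lambda>\<omega>. \<chi> i. real_cond_exp M G (\<lambda>\<omega>. x \<omega> $ i) \<omega>) \<in> borel_measurable G"
    by (intro borel_measurable_vec_lambda) simp
  then show ?thesis by (simp add: vec_cond_exp_def[abs_def])
qed

lemma nonanticipative_policiesD:
  assumes "x \<in> nonanticipative_policies r M F"
  shows "x t \<in> Lspace r M" and "AE \<omega> in M. x t \<omega> = vec_cond_exp M (F t) (x t) \<omega>"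
  using assms by (auto simp: nonanticipative_policies_def policies_def)

text \<open>
  Errors that each stage inherits from the earlier ones, with a fixed amplification, stay
  proportional to the initial error, as there are only finitely many stages.
\<close>

lemma finite_stage_Gronwall:
  fixes C L :: real
  assumes C: "0 \<le> C" and L: "0 \<le> L"
  shows "\<exists>K\<ge>0. \<forall>a :: 't::{finite,linorder} \<Rightarrow> real. \<forall>V\<ge>0.
    (\<forall>s. a s \<le> C * (V + L * (\<Sum>w\<in>{..<s}. a w))) \<longrightarrow> (\<forall>s. a s \<le> K * V)"
proof -
  let ?step = "\<lambda>(a :: 't \<Rightarrow> real) V s. a s \<le> C * (V + L * (\<Sum>w\<in>{..<s}. a w))"
  have "\<exists>K\<ge>0. \<forall>a V. 0 \<le> V \<longrightarrow> (\<forall>s. ?step a V s) \<longrightarrow> a s \<le> K * V" for s :: 't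
  proof (induction "card {..<s}" arbitrary: s rule: less_induct)
    case less
    have "\<exists>K\<ge>0. \<forall>a V. 0 \<le> V \<longrightarrow> (\<forall>s. ?step a V s) \<longrightarrow> a w \<le> K * V" if "w < s" for w
      using that by (intro less psubset_card_mono) auto
    then obtain K where K: "\<And>w. w < s \<Longrightarrow> 0 \<le> K w"
      "\<And>w a V. w < s \<Longrightarrow> 0 \<le> V \<Longrightarrow> (\<forall>s. ?step a V s) \<Longrightarrow> a w \<le> K w * V" by metis
    show ?case
    proof (intro exI[of _ "C * (1 + L * (\<Sum>w\<in>{..<s}. K w))"] conjI allI impI)
      show "0 \<le> C * (1 + L * (\<Sum>w\<in>{..<s}. K w))"
        using C L K(1) by (intro mult_nonneg_nonneg add_nonneg_nonneg sum_nonneg) auto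
      fix a :: "'t \<Rightarrow> real" and V :: real assume V: "0 \<le> V" and step: "\<forall>s. ?step a V s"
      have "(\<Sum>w\<in>{..<s}. a w) \<le> (\<Sum>w\<in>{..<s}. K w * V)" using K(2) V step by (intro sum_mono) auto
      then have "C * (V + L * (\<Sum>w\<in>{..<s}. a w)) \<le> C * (V + L * (\<Sum>w\<in>{..<s}. K w * V))"
        using C L by (intro mult_left_mono add_left_mono) auto
      also have "\<dots> = C * (1 + L * (\<Sum>w\<in>{..<s}. K w)) * V"
        unfolding sum_distrib_right[symmetric] by (simp add: algebra_simps)
      finally show "a s \<le> C * (1 + L * (\<Sum>w\<in>{..<s}. K w)) * V"
        by (rule order_trans[OF step[rule_format]])
    qed
  qed
  then obtain K where K: "\<And>s. 0 \<le> K s" "\<And>s a V. 0 \<le> V \<Longrightarrow> (\<forall>s. ?step a V s) \<Longrightarrow> a s \<le> K s * V"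
    by metis
  show ?thesis
  proof (intro exI[of _ "\<Sum>s\<in>UNIV. K s"] conjI allI impI sum_nonneg K(1))
    fix a :: "'t \<Rightarrow> real" and V :: real and s
    assume V: "0 \<le> V" and step: "\<forall>s. ?step a V s"
    have "a s \<le> K s * V" using V step by (rule K(2))
    also have "\<dots> \<le> (\<Sum>s\<in>UNIV. K s) * V"
      using K(1) V by (intro mult_right_mono member_le_sum) auto
    finally show "a s \<le> (\<Sum>s\<in>UNIV. K s) * V" .
  qed
qed

locale multistage_recourse =
  fixes M :: "'a measure" and F :: "'t::{finite,linorder} \<Rightarrow> 'a measure" and p :: real
    and f :: "'t \<Rightarrow> (real^'n, 't) vec \<Rightarrow> 'a \<Rightarrow> real^'m"
    and X :: "'t \<Rightarrow> 'a \<Rightarrow> (real^'n) set" and Y :: "'t \<Rightarrow> 'a \<Rightarrow> (real^'m) set"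
  assumes prob: "prob_space M" and filtration: "stage_filtration M F" and p: "1 \<le> p"
    and causal: "causal M F f" and smooth: "smoothness_assumption (ennreal p) M F f"
    and Y: "\<And>t. convex_closed_multifunction (F t) (Y t)"
    and X: "\<And>t. convex_closed_multifunction (F t) (X t)"
    and recourse: "complete_subregular_recourse M f X Y"
begin

abbreviation "Lp \<equiv> Lspace (ennreal p) M"
abbreviation "pol \<equiv> policies (ennreal p) M"
abbreviation "adapted \<equiv> nonanticipative_policies (ennreal p) M F :: ('t \<Rightarrow> 'a \<Rightarrow> real^'n) set"
abbreviation "feas \<equiv> feasible (ennreal p) M F f X Y"

lemma p_pos: "0 < p" using p by simp

lemma finite_measure_M: "finite_measure M" using prob by (simp add: prob_space_def)

lemma subalg: "subalgebra M (F t)" using filtration by (simp add: stage_filtration_def)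

lemma space_F: "space (F t) = space M" using subalg by (simp add: subalgebra_def)

lemma measurable_F_M: "g \<in> borel_measurable (F t) \<Longrightarrow> g \<in> borel_measurable M"
  using measurable_from_subalg[OF subalg] .

lemma measurable_F_mono: "s \<le> t \<Longrightarrow> g \<in> borel_measurable (F s) \<Longrightarrow> g \<in> borel_measurable (F t)"
  using filtration measurable_from_subalg[of "F t" "F s" g borel] by (simp add: stage_filtration_def)

lemma history: "\<omega> \<in> space M \<Longrightarrow> (\<And>s. s \<le> t \<Longrightarrow> \<xi> $ s = \<zeta> $ s) \<Longrightarrow> f t \<xi> \<omega> = f t \<zeta> \<omega>"
  using causal by (auto simp: causal_def depends_on_history_def)

lemma superposition_F: "z \<in> borel_measurable (F t) \<Longrightarrow> (\<lambda>\<omega>. f t (z \<omega>) \<omega>) \<in> borel_measurable (F t)"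
  using causal by (auto simp: causal_def superpositionally_measurable_def)

lemma superposition_M: "z \<in> borel_measurable M \<Longrightarrow> (\<lambda>\<omega>. f t (z \<omega>) \<omega>) \<in> borel_measurable M"
  using causal by (auto simp: causal_def superpositionally_measurable_def)

lemma measurable_causal_op:
  "(\<And>s. x s \<in> borel_measurable M) \<Longrightarrow> causal_op f t x \<in> borel_measurable M"
  using superposition_M[OF borel_measurable_vec_lambda, of x t] by (simp add: causal_op_def[abs_def])

lemma closed_XY: "\<omega> \<in> space M \<Longrightarrow> closed (X t \<omega>)" "\<omega> \<in> space M \<Longrightarrow> closed (Y t \<omega>)"
  and convex_XY: "\<omega> \<in> space M \<Longrightarrow> convex (X t \<omega>)" "\<omega> \<in> space M \<Longrightarrow> convex (Y t \<omega>)"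
  using X[of t] Y[of t] space_F[of t] by (auto simp: convex_closed_multifunction_def)

lemma infdist_measurable_F:
  "g \<in> borel_measurable (F t) \<Longrightarrow> (\<lambda>\<omega>. infdist (g \<omega>) (X t \<omega>)) \<in> borel_measurable (F t)"
  "h \<in> borel_measurable (F t) \<Longrightarrow> (\<lambda>\<omega>. infdist (h \<omega>) (Y t \<omega>)) \<in> borel_measurable (F t)"
  using X[of t] Y[of t] by (auto simp: convex_closed_multifunction_def intro: borel_measurable_infdist_multifunction)

lemma multifunction_M: "measurable_multifunction M (X t)" "measurable_multifunction M (Y t)"
  using X[of t] Y[of t] subalg[of t]
  unfolding convex_closed_multifunction_def measurable_multifunction_def subalgebra_def by auto

lemma differentiable_AE: "AE \<omega> in M. \<forall>t \<xi>. (\<lambda>\<xi>. f t \<xi> \<omega>) differentiable (at \<xi>)"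
proof -
  have "AE \<omega> in M. \<forall>t. continuously_differentiable (\<lambda>\<xi>. f t \<xi> \<omega>)"
    using smooth by (auto simp: smoothness_assumption_def AE_all_countable)
  then show ?thesis
    by eventually_elim (auto simp: continuously_differentiable_def differentiable_def)
qed

definition Lipschitz_at :: "real \<Rightarrow> 'a \<Rightarrow> bool" where
  "Lipschitz_at L \<omega> \<longleftrightarrow>
     (\<forall>t \<xi> \<zeta>. norm (f t \<xi> \<omega> - f t \<zeta> \<omega>) \<le> L * (\<Sum>s\<in>{..t}. norm (\<xi> $ s - \<zeta> $ s)))"

definition recourse_at :: "real \<Rightarrow> 'a \<Rightarrow> bool" where
  "recourse_at C \<omega> \<longleftrightarrow> (\<forall>t \<zeta>. (\<forall>s<t. \<zeta> $ s \<in> X s \<omega>) \<longrightarrow>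
     (\<forall>\<eta>. \<exists>\<xi>. f t (replace_block \<zeta> t \<xi>) \<omega> \<in> Y t \<omega> \<and> \<xi> \<in> X t \<omega> \<and>
        norm (\<xi> - \<eta>) \<le>
          C * (infdist (f t (replace_block \<zeta> t \<eta>) \<omega>) (Y t \<omega>) + infdist \<eta> (X t \<omega>))))"

text \<open>
  Since \<open>f t\<close> ignores the blocks after stage \<open>t\<close>, those of one argument may be replaced by those of
  the other before the bound on the Jacobian is applied.  Hence only the history enters the estimate.
\<close>

lemma Lipschitz_AE:
  obtains L where "0 \<le> L" "AE \<omega> in M. Lipschitz_at L \<omega>"
proof -
  obtain C where "AE \<omega> in M. \<forall>t \<xi>. onorm (frechet_derivative (\<lambda>\<zeta>. f t \<zeta> \<omega>) (at \<xi>)) \<le> C"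
    using smooth by (auto simp: smoothness_assumption_def AE_all_countable)
  then have "AE \<omega> in M. Lipschitz_at \<bar>C\<bar> \<omega>"
    using differentiable_AE AE_space
  proof eventually_elim
    case (elim \<omega>)
    show ?case
      unfolding Lipschitz_at_def
    proof (intro allI)
      fix t :: 't and \<xi> \<zeta> :: "(real^'n, 't) vec"
      define \<zeta>' where "\<zeta>' = (\<chi> s. if s \<le> t then \<zeta> $ s else \<xi> $ s)"
      have "norm (f t \<xi> \<omega> - f t \<zeta>' \<omega>) \<le> \<bar>C\<bar> * norm (\<xi> - \<zeta>')"
      proof (rule differentiable_bound[OF convex_UNIV])
        show "((\<lambda>\<xi>. f t \<xi> \<omega>) has_derivative frechet_derivative (\<lambda>\<xi>. f t \<xi> \<omega>) (at u)) (at u within UNIV)" for u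
          using elim(2) by (simp add: frechet_derivative_works[symmetric])
        show "onorm (frechet_derivative (\<lambda>\<xi>. f t \<xi> \<omega>) (at u)) \<le> \<bar>C\<bar>" for u
          using elim(1) by (meson abs_ge_self order_trans)
      qed auto
      also have "norm (\<xi> - \<zeta>') \<le> (\<Sum>s\<in>UNIV. norm ((\<xi> - \<zeta>') $ s))" by (rule norm_vec_le_sum)
      also have "(\<Sum>s\<in>UNIV. norm ((\<xi> - \<zeta>') $ s)) = (\<Sum>s\<in>{..t}. norm (\<xi> $ s - \<zeta> $ s))"
        by (rule sum.mono_neutral_cong_right) (auto simp: \<zeta>'_def)
      also have "f t \<zeta>' \<omega> = f t \<zeta> \<omega>" using elim(3) by (intro history) (auto simp: \<zeta>'_def)
      finally show "norm (f t \<xi> \<omega> - f t \<zeta> \<omega>) \<le> \<bar>C\<bar> * (\<Sum>s\<in>{..t}. norm (\<xi> $ s - \<zeta> $ s))"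
        by (simp add: mult_left_mono)
    qed
  qed
  then show ?thesis using that[of "\<bar>C\<bar>"] by simp
qed

text \<open>
  Negative constants in the hypothesis are harmless, as the violation that they multiply is nonnegative.
\<close>

lemma recourse_AE:
  obtains C where "0 \<le> C" "AE \<omega> in M. recourse_at C \<omega>"
proof -
  obtain C where C: "AE \<omega> in M. recourse_at C \<omega>"
    using recourse by (auto simp: complete_subregular_recourse_def recourse_at_def AE_all_countable)
  have mono: "C * (infdist a A + infdist b B) \<le> \<bar>C\<bar> * (infdist a A + infdist b B)"
    for a :: "real^'m" and A and b :: "real^'n" and B
    by (intro mult_right_mono add_nonneg_nonneg infdist_nonneg) auto
  have "AE \<omega> in M. recourse_at \<bar>C\<bar> \<omega>"
    using C unfolding recourse_at_def by eventually_elim (meson mono order_trans)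
  then show ?thesis by (rule that[rotated]) simp
qed

end

section \<open>Repairing infeasible nonanticipative policies\<close>

lemma Lspace_infdist:
  fixes x a :: "'a \<Rightarrow> 'b::euclidean_space"
  assumes x: "x \<in> Lspace r M" and a: "a \<in> Lspace r M" "AE \<omega> in M. a \<omega> \<in> S \<omega>" and S: "measurable_multifunction M S"
  shows "(\<lambda>\<omega>. infdist (x \<omega>) (S \<omega>)) \<in> Lspace r M"
proof (rule Lspace_dominated[OF Lspace_diff[OF x a(1)], where C = 1])
  show "(\<lambda>\<omega>. infdist (x \<omega>) (S \<omega>)) \<in> borel_measurable M"
    by (rule borel_measurable_infdist_multifunction[OF S Lspace_measurable[OF x]])
  show "AE \<omega> in M. norm (infdist (x \<omega>) (S \<omega>)) \<le> 1 * norm (x \<omega> - a \<omega>)"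
    using a(2)
  proof eventually_elim
    case (elim \<omega>)
    then show ?case using infdist_le[OF elim, of "x \<omega>"] by (simp add: infdist_nonneg dist_norm)
  qed
qed

context multistage_recourse begin

text \<open>
  The blocks after stage \<open>t\<close> are set to zero: the vector is then measurable with respect to
  \<open>F t\<close>, while the value of \<open>f t\<close> stays the same.
\<close>

definition history_with :: "('t \<Rightarrow> 'a \<Rightarrow> real^'n) \<Rightarrow> 't \<Rightarrow> real^'n \<Rightarrow> 'a \<Rightarrow> (real^'n, 't) vec" where
  "history_with z t \<xi> \<omega> = (\<chi> s. if s < t then z s \<omega> else if s = t then \<xi> else 0)"

text \<open>
  The recourse estimate at stage \<open>t\<close>, where the earlier decisions are those of the repaired policy \<open>z\<close>
  and not those of \<open>y\<close>.
\<close>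

definition repairs :: "real \<Rightarrow> ('t \<Rightarrow> 'a \<Rightarrow> real^'n) \<Rightarrow> ('t \<Rightarrow> 'a \<Rightarrow> real^'n) \<Rightarrow> 't \<Rightarrow> 'a \<Rightarrow> bool" where
  "repairs C y z t \<omega> \<longleftrightarrow>
     f t (history_with z t (z t \<omega>) \<omega>) \<omega> \<in> Y t \<omega> \<and> z t \<omega> \<in> X t \<omega> \<and>
     norm (z t \<omega> - y t \<omega>) \<le>
       C * (infdist (f t (history_with z t (y t \<omega>) \<omega>) \<omega>) (Y t \<omega>) + infdist (y t \<omega>) (X t \<omega>))"

lemma history_with_cong: "(\<And>s. s < t \<Longrightarrow> z s \<omega> = z' s \<omega>) \<Longrightarrow> history_with z t \<xi> \<omega> = history_with z' t \<xi> \<omega>"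
  by (auto simp: history_with_def vec_eq_iff)

lemma measurable_history_with:
  assumes "\<And>s. s < t \<Longrightarrow> z s \<in> borel_measurable (F s)" "u \<in> borel_measurable (F t)"
  shows "(\<lambda>\<omega>. history_with z t (u \<omega>) \<omega>) \<in> borel_measurable (F t)"
  unfolding history_with_def
proof (rule borel_measurable_vec_lambda)
  fix s
  show "(\<lambda>\<omega>. if s < t then z s \<omega> else if s = t then u \<omega> else 0) \<in> borel_measurable (F t)"
    using assms(2) measurable_F_mono[of s t "z s"] assms(1)[of s]
    by (cases "s < t"; cases "s = t") auto
qed

text \<open>
  The decisions allowed by the recourse estimate are the zeros of the function \<open>h\<close> below, a sum of two distances
  and the excess over the radius of the estimate.  This excess is what bounds the sublevel sets, so
  that a zero can be selected measurably with respect to \<open>F t\<close>.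
\<close>

lemma adapted_repair_of_stage:
  assumes C: "AE \<omega> in M. recourse_at C \<omega>"
    and z: "\<And>s. s < t \<Longrightarrow> z s \<in> borel_measurable (F s)" and y: "y t \<in> borel_measurable (F t)"
  shows "\<exists>w\<in>borel_measurable (F t). AE \<omega> in M. (\<forall>s<t. z s \<omega> \<in> X s \<omega>) \<longrightarrow> repairs C y (z(t := w)) t \<omega>"
proof -
  let ?H = "\<lambda>\<xi> \<omega>. f t (history_with z t \<xi> \<omega>) \<omega>"
  define \<rho> where "\<rho> \<omega> = C * (infdist (?H (y t \<omega>) \<omega>) (Y t \<omega>) + infdist (y t \<omega>) (X t \<omega>))" for \<omega>
  define h where "h \<xi> \<omega> = infdist (?H \<xi> \<omega>) (Y t \<omega>) + infdist \<xi> (X t \<omega>) + max 0 (norm (\<xi> - y t \<omega>) - \<rho> \<omega>)"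
    for \<xi> \<omega>
  have Hm: "(\<lambda>\<omega>. ?H (u \<omega>) \<omega>) \<in> borel_measurable (F t)" if "u \<in> borel_measurable (F t)" for u
    using superposition_F[OF measurable_history_with[OF z that]] .
  have \<rho>m [measurable]: "\<rho> \<in> borel_measurable (F t)"
    unfolding \<rho>_def
    by (intro borel_measurable_times borel_measurable_add borel_measurable_const infdist_measurable_F Hm y)
  have hm: "h \<xi> \<in> borel_measurable (F t)" for \<xi>
  proof -
    have "(\<lambda>\<omega>. max 0 (norm (\<xi> - y t \<omega>) - \<rho> \<omega>)) \<in> borel_measurable (F t)" using y by measurable
    then show ?thesis unfolding h_def
      by (intro borel_measurable_add infdist_measurable_F Hm borel_measurable_const)
  qed
  have h_nonneg: "0 \<le> h \<xi> \<omega>" for \<xi> \<omega>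
    unfolding h_def by (intro add_nonneg_nonneg infdist_nonneg) auto
  obtain w where w: "w \<in> borel_measurable (F t)"
    and w_zero: "\<And>\<omega>. continuous_on UNIV (\<lambda>\<xi>. h \<xi> \<omega>) \<Longrightarrow> bounded {\<xi>. h \<xi> \<omega> \<le> 1} \<Longrightarrow>
      \<exists>\<xi>. h \<xi> \<omega> = 0 \<Longrightarrow> h (w \<omega>) \<omega> = 0"
    using measurable_selection_of_zeros[of h, OF hm h_nonneg] by blast
  have "AE \<omega> in M. (\<forall>s<t. z s \<omega> \<in> X s \<omega>) \<longrightarrow> repairs C y (z(t := w)) t \<omega>"
    using C differentiable_AE AE_space
  proof eventually_elim
    case (elim \<omega>)
    show ?case
    proof
      assume zX: "\<forall>s<t. z s \<omega> \<in> X s \<omega>"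
      have block: "?H \<xi> \<omega> = f t (replace_block (history_with z t 0 \<omega>) t \<xi>) \<omega>" for \<xi>
        using elim(3) by (intro history) (auto simp: history_with_def replace_block_def)
      obtain \<xi>0 where \<xi>0: "?H \<xi>0 \<omega> \<in> Y t \<omega>" "\<xi>0 \<in> X t \<omega>" "norm (\<xi>0 - y t \<omega>) \<le> \<rho> \<omega>"
      proof -
        have "\<forall>s<t. history_with z t 0 \<omega> $ s \<in> X s \<omega>" using zX by (simp add: history_with_def)
        then show ?thesis using elim(1) that unfolding recourse_at_def block \<rho>_def by blast
      qed
      have cont: "continuous_on UNIV (\<lambda>\<xi>. h \<xi> \<omega>)"
      proof -
        have "continuous_on UNIV (\<lambda>\<xi>. f t \<xi> \<omega>)"
          using elim(2) by (auto intro!: continuous_at_imp_continuous_on differentiable_imp_continuous_within)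
        moreover have "continuous_on UNIV (\<lambda>\<xi>. history_with z t \<xi> \<omega>)"
          unfolding history_with_def continuous_on_vec_lambda
        proof (rule continuous_on_vec_lambda)
          fix s show "continuous_on UNIV (\<lambda>\<xi>. if s < t then z s \<omega> else if s = t then \<xi> else 0)"
            by (cases "s < t"; cases "s = t") (auto intro: continuous_intros)
        qed
        ultimately have "continuous_on UNIV (\<lambda>\<xi>. ?H \<xi> \<omega>)"
          by (rule continuous_on_compose2) auto
        then show ?thesis unfolding h_def by (intro continuous_intros)
      qed
      have "{\<xi>. h \<xi> \<omega> \<le> 1} \<subseteq> cball (y t \<omega>) (\<rho> \<omega> + 1)"
      proof
        fix \<xi> assume "\<xi> \<in> {\<xi>. h \<xi> \<omega> \<le> 1}"
        then have "max 0 (norm (\<xi> - y t \<omega>) - \<rho> \<omega>) \<le> 1"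
          using infdist_nonneg[of "?H \<xi> \<omega>" "Y t \<omega>"] infdist_nonneg[of \<xi> "X t \<omega>"] by (simp add: h_def)
        then show "\<xi> \<in> cball (y t \<omega>) (\<rho> \<omega> + 1)" by (simp add: dist_norm norm_minus_commute)
      qed
      then have bdd: "bounded {\<xi>. h \<xi> \<omega> \<le> 1}" by (rule bounded_subset[OF bounded_cball])
      have "h \<xi>0 \<omega> = 0" using \<xi>0 by (simp add: h_def)
      then have "h (w \<omega>) \<omega> = 0" using w_zero[OF cont bdd] by blast
      then have zero: "infdist (?H (w \<omega>) \<omega>) (Y t \<omega>) = 0" "infdist (w \<omega>) (X t \<omega>) = 0" "norm (w \<omega> - y t \<omega>) \<le> \<rho> \<omega>"
        using infdist_nonneg[of "?H (w \<omega>) \<omega>" "Y t \<omega>"] infdist_nonneg[of "w \<omega>" "X t \<omega>"]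
        by (auto simp: h_def)
      have "?H (w \<omega>) \<omega> \<in> Y t \<omega>" "w \<omega> \<in> X t \<omega>"
        using zero(1,2) \<xi>0(1,2) closed_XY[OF elim(3), of t] in_closed_iff_infdist_zero by blast+
      moreover have "history_with (z(t := w)) t \<xi> \<omega> = history_with z t \<xi> \<omega>" for \<xi>
        by (rule history_with_cong) auto
      ultimately show "repairs C y (z(t := w)) t \<omega>"
        using zero(3) by (simp add: repairs_def \<rho>_def)
    qed
  qed
  then show ?thesis using w by blast
qed

text \<open>
  Stages are added in increasing order.  The induction runs over initial segments \<open>A\<close>, because the
  recourse estimate at a stage requires that all earlier decisions have been repaired.
\<close>

lemma adapted_repair:
  assumes C: "AE \<omega> in M. recourse_at C \<omega>"
    and y: "\<And>t. y t \<in> borel_measurable (F t)"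
  shows "\<exists>z. \<forall>t. z t \<in> borel_measurable (F t) \<and> (AE \<omega> in M. repairs C y z t \<omega>)"
proof -
  have "(\<forall>s\<in>A. \<forall>u<s. u \<in> A) \<longrightarrow>
      (\<exists>z. \<forall>s\<in>A. z s \<in> borel_measurable (F s) \<and> (AE \<omega> in M. repairs C y z s \<omega>))"
    if "finite A" for A :: "'t set"
    using that
  proof (induction rule: finite_linorder_max_induct)
    case (insert b A)
    show ?case
    proof
      assume closed: "\<forall>s\<in>insert b A. \<forall>u<s. u \<in> insert b A"
      then have "\<forall>s\<in>A. \<forall>u<s. u \<in> A" using insert(2) by fastforce
      with insert(3) obtain z where z: "\<And>s. s \<in> A \<Longrightarrow> z s \<in> borel_measurable (F s)"
        "\<And>s. s \<in> A \<Longrightarrow> AE \<omega> in M. repairs C y z s \<omega>" by blast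
      have below: "s \<in> A" if "s < b" for s using closed that by blast
      obtain w where w: "w \<in> borel_measurable (F b)"
        "AE \<omega> in M. (\<forall>s<b. z s \<omega> \<in> X s \<omega>) \<longrightarrow> repairs C y (z(b := w)) b \<omega>"
        using adapted_repair_of_stage[OF C, of b z y] z(1) below y by blast
      have "AE \<omega> in M. \<forall>s\<in>A. repairs C y z s \<omega>"
        using z(2) by (simp add: AE_finite_all insert(1))
      then have "AE \<omega> in M. \<forall>s<b. z s \<omega> \<in> X s \<omega>"
        by eventually_elim (use below in \<open>auto simp: repairs_def\<close>)
      with w(2) have "AE \<omega> in M. repairs C y (z(b := w)) b \<omega>" by eventually_elim auto
      moreover have "AE \<omega> in M. repairs C y (z(b := w)) s \<omega>" if s: "s \<in> A" for s
      proof -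
        have "s < b" using insert(2) s by blast
        then have "history_with (z(b := w)) s \<xi> \<omega> = history_with z s \<xi> \<omega>" for \<xi> \<omega>
          by (intro history_with_cong) auto
        then have "repairs C y (z(b := w)) s \<omega> = repairs C y z s \<omega>" for \<omega>
          using \<open>s < b\<close> by (simp add: repairs_def)
        then show ?thesis using z(2)[OF s] by simp
      qed
      ultimately show "\<exists>z. \<forall>s\<in>insert b A. z s \<in> borel_measurable (F s) \<and> (AE \<omega> in M. repairs C y z s \<omega>)"
        using w(1) z(1) by (intro exI[of _ "z(b := w)"]) auto
    qed
  qed simp
  from this[of UNIV] show ?thesis by auto
qed

definition violation :: "('t \<Rightarrow> 'a \<Rightarrow> real^'n) \<Rightarrow> 'a \<Rightarrow> real" where
  "violation y \<omega> = (\<Sum>s\<in>UNIV. infdist (causal_op f s y \<omega>) (Y s \<omega>) + infdist (y s \<omega>) (X s \<omega>))"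

lemma violation_nonneg: "0 \<le> violation y \<omega>"
  unfolding violation_def by (intro sum_nonneg add_nonneg_nonneg infdist_nonneg)

lemma feasibleD:
  assumes "x \<in> feas"
  shows "x t \<in> Lp" "causal_op f t x \<in> Lp" "AE \<omega> in M. causal_op f t x \<omega> \<in> Y t \<omega>"
    "AE \<omega> in M. x t \<omega> \<in> X t \<omega>" "x \<in> adapted"
  using assms
  by (auto simp: feasible_def policies_def Lselections_def nonanticipative_policies_def)

text \<open>
  The Lipschitz estimate bounds the difference of the values of the operator at two policies, so
  integrability is inherited from the value at the reference policy \<open>x\<close>.
\<close>

lemma Lspace_causal_op:
  assumes x: "\<And>s. x s \<in> Lp" "causal_op f t x \<in> Lp" and y: "\<And>s. y s \<in> Lp"
  shows "causal_op f t y \<in> Lp"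
proof -
  obtain L where L: "0 \<le> L"
    "AE \<omega> in M. Lipschitz_at L \<omega>"
    by (rule Lipschitz_AE)
  let ?d = "\<lambda>\<omega>. \<Sum>s\<in>{..t}. norm (y s \<omega> - x s \<omega>)"
  have "?d \<in> Lp" by (intro Lspace_sum Lspace_norm Lspace_diff x y)
  moreover have "(\<lambda>\<omega>. causal_op f t y \<omega> - causal_op f t x \<omega>) \<in> borel_measurable M"
    by (intro borel_measurable_diff measurable_causal_op Lspace_measurable[OF x(1)] Lspace_measurable[OF y])
  moreover have "AE \<omega> in M. norm (causal_op f t y \<omega> - causal_op f t x \<omega>) \<le> L * norm (?d \<omega>)"
    using L(2)
  proof eventually_elim
    case (elim \<omega>)
    have "norm (?d \<omega>) = ?d \<omega>" by (simp add: sum_nonneg)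
    then show ?case
      using elim[unfolded Lipschitz_at_def, rule_format, of t "\<chi> s. y s \<omega>" "\<chi> s. x s \<omega>"] by (simp add: causal_op_def)
  qed
  ultimately have "(\<lambda>\<omega>. causal_op f t y \<omega> - causal_op f t x \<omega>) \<in> Lp" by (rule Lspace_dominated)
  from Lspace_add[OF this x(2)] show ?thesis by simp
qed

lemma Lspace_violation:
  assumes x: "x \<in> feas" and y: "\<And>s. y s \<in> Lp"
  shows "violation y \<in> Lp"
proof -
  have "(\<lambda>\<omega>. \<Sum>s\<in>UNIV. infdist (causal_op f s y \<omega>) (Y s \<omega>) + infdist (y s \<omega>) (X s \<omega>)) \<in> Lp"
    using Lspace_causal_op[OF feasibleD(1,2)[OF x] y]
    by (intro Lspace_sum Lspace_add Lspace_infdist[OF _ feasibleD(1,4)[OF x]]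
        Lspace_infdist[OF _ feasibleD(2,3)[OF x]] y multifunction_M)
  then show ?thesis by (simp add: violation_def[abs_def])
qed

text \<open>
  The repaired policy stays close to \<open>y\<close>: at each stage the recourse estimate involves the violation at the
  partly repaired history, which exceeds the violation at \<open>y\<close> by at most a multiple of the
  corrections made before.  The estimate is pointwise, hence it holds in every norm.
\<close>

theorem nonanticipative_error_bound:
  assumes x: "x \<in> feas"
  shows "\<exists>K\<ge>0. \<forall>y\<in>adapted. \<exists>z\<in>feas. \<forall>t. AE \<omega> in M. norm (z t \<omega> - y t \<omega>) \<le> K * violation y \<omega>"
proof -
  obtain L where L: "0 \<le> L"
    "AE \<omega> in M. Lipschitz_at L \<omega>"
    by (rule Lipschitz_AE)
  obtain C where C: "0 \<le> C"
    "AE \<omega> in M. recourse_at C \<omega>"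
    by (rule recourse_AE)
  obtain K where K: "0 \<le> K" "\<And>(a :: 't \<Rightarrow> real) V s. 0 \<le> V \<Longrightarrow>
      (\<And>s. a s \<le> C * (V + L * (\<Sum>w\<in>{..<s}. a w))) \<Longrightarrow> a s \<le> K * V"
    using finite_stage_Gronwall[OF C(1) L(1), where ?'t = 't] by blast
  have "\<exists>z\<in>feas. \<forall>t. AE \<omega> in M. norm (z t \<omega> - y t \<omega>) \<le> K * violation y \<omega>" if y: "y \<in> adapted" for y
  proof -
    note yL = nonanticipative_policiesD(1)[OF y]
    define y' where "y' t = vec_cond_exp M (F t) (y t)" for t
    have y'm: "y' t \<in> borel_measurable (F t)" for t
      unfolding y'_def by (rule borel_measurable_vec_cond_exp)
    have y'_eq: "AE \<omega> in M. \<forall>t. y t \<omega> = y' t \<omega>"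
      using nonanticipative_policiesD(2)[OF y] by (simp add: y'_def AE_all_countable)
    obtain z where zF: "\<And>t. z t \<in> borel_measurable (F t)" and z: "\<And>t. AE \<omega> in M. repairs C y' z t \<omega>"
      using adapted_repair[OF C(2), of y'] y'm by blast
    have z_all: "AE \<omega> in M. \<forall>t. repairs C y' z t \<omega>" using z by (simp add: AE_all_countable)
    have full: "AE \<omega> in M. \<forall>t. causal_op f t z \<omega> \<in> Y t \<omega> \<and> z t \<omega> \<in> X t \<omega>"
      using z_all AE_space
    proof eventually_elim
      case (elim \<omega>)
      have "causal_op f t z \<omega> = f t (history_with z t (z t \<omega>) \<omega>) \<omega>" for t
        unfolding causal_op_def using elim(2) by (intro history) (auto simp: history_with_def)
      then show ?case using elim(1) by (simp add: repairs_def)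
    qed
    have close_all: "AE \<omega> in M. \<forall>t. norm (z t \<omega> - y t \<omega>) \<le> K * violation y \<omega>"
      using z_all AE_space y'_eq L(2)
    proof eventually_elim
      case (elim \<omega>)
      show ?case
      proof (intro allI K(2) violation_nonneg)
        fix s
        let ?y = "\<chi> s. y s \<omega>" and ?h = "history_with z s (y s \<omega>) \<omega>"
        have "norm (f s ?h \<omega> - f s ?y \<omega>) \<le> L * (\<Sum>w\<in>{..s}. norm (?h $ w - ?y $ w))"
          using elim(4) unfolding Lipschitz_at_def by blast
        also have "(\<Sum>w\<in>{..s}. norm (?h $ w - ?y $ w)) = (\<Sum>w\<in>{..<s}. norm (z w \<omega> - y w \<omega>))"
          by (rule sum.mono_neutral_cong_right) (auto simp: history_with_def)
        finally have lip: "norm (f s ?h \<omega> - f s ?y \<omega>) \<le> L * (\<Sum>w\<in>{..<s}. norm (z w \<omega> - y w \<omega>))" .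
        have "infdist (f s ?h \<omega>) (Y s \<omega>) \<le> infdist (f s ?y \<omega>) (Y s \<omega>) + dist (f s ?h \<omega>) (f s ?y \<omega>)"
          by (rule infdist_triangle)
        then have "infdist (f s ?h \<omega>) (Y s \<omega>) + infdist (y s \<omega>) (X s \<omega>)
            \<le> infdist (causal_op f s y \<omega>) (Y s \<omega>) + infdist (y s \<omega>) (X s \<omega>)
              + L * (\<Sum>w\<in>{..<s}. norm (z w \<omega> - y w \<omega>))"
          using lip by (simp add: causal_op_def dist_norm)
        also have "infdist (causal_op f s y \<omega>) (Y s \<omega>) + infdist (y s \<omega>) (X s \<omega>) \<le> violation y \<omega>"
          unfolding violation_def
          by (rule member_le_sum[where f = "\<lambda>s. infdist (causal_op f s y \<omega>) (Y s \<omega>) + infdist (y s \<omega>) (X s \<omega>)"])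
             (auto intro: add_nonneg_nonneg infdist_nonneg)
        finally have le: "infdist (f s ?h \<omega>) (Y s \<omega>) + infdist (y s \<omega>) (X s \<omega>)
            \<le> violation y \<omega> + L * (\<Sum>w\<in>{..<s}. norm (z w \<omega> - y w \<omega>))" by simp
        have "norm (z s \<omega> - y s \<omega>) \<le> C * (infdist (f s ?h \<omega>) (Y s \<omega>) + infdist (y s \<omega>) (X s \<omega>))"
          using elim(1,3) by (simp add: repairs_def)
        also have "\<dots> \<le> C * (violation y \<omega> + L * (\<Sum>w\<in>{..<s}. norm (z w \<omega> - y w \<omega>)))"
          using le C(1) by (rule mult_left_mono)
        finally show "norm (z s \<omega> - y s \<omega>) \<le> C * (violation y \<omega> + L * (\<Sum>w\<in>{..<s}. norm (z w \<omega> - y w \<omega>)))" .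
      qed
    qed
    have close: "AE \<omega> in M. norm (z t \<omega> - y t \<omega>) \<le> K * violation y \<omega>" for t
      using close_all by eventually_elim blast
    have zL: "z t \<in> Lp" for t
    proof -
      have "(\<lambda>\<omega>. z t \<omega> - y t \<omega>) \<in> Lp"
      proof (rule Lspace_dominated[OF Lspace_violation[OF x yL], where C = K])
        show "(\<lambda>\<omega>. z t \<omega> - y t \<omega>) \<in> borel_measurable M"
          by (intro borel_measurable_diff measurable_F_M[OF zF] Lspace_measurable[OF yL])
        show "AE \<omega> in M. norm (z t \<omega> - y t \<omega>) \<le> K * norm (violation y \<omega>)"
          using close by (simp add: violation_nonneg)
      qed
      from Lspace_add[OF this yL[of t]] show ?thesis by simp
    qed
    have "z \<in> feas"
      unfolding feasible_def Lselections_def mem_Collect_eq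
    proof (intro conjI allI)
      show "z \<in> pol" using zL by (simp add: policies_def)
      fix t
      show "causal_op f t z \<in> Lp" by (rule Lspace_causal_op[OF feasibleD(1,2)[OF x] zL])
      show "z t \<in> Lp" by (rule zL)
      show "AE \<omega> in M. causal_op f t z \<omega> \<in> Y t \<omega>" "AE \<omega> in M. z t \<omega> \<in> X t \<omega>"
        using full by (eventually_elim, blast)+
      have "AE \<omega> in M. vec_cond_exp M (F t) (z t) \<omega> = z t \<omega>"
        by (rule vec_cond_exp_of_measurable[OF finite_measure_M subalg
              Lspace_integrable[OF finite_measure_M p zL] zF])
      then show "AE \<omega> in M. z t \<omega> - vec_cond_exp M (F t) (z t) \<omega> = 0"
        by eventually_elim simp
    qed
    then show ?thesis using close by blast
  qed
  then show ?thesis using K(1) by blast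
qed

end

section \<open>The Clarke directional derivative\<close>

lemma policies_add:
  "x \<in> policies r M \<Longrightarrow> y \<in> policies r M \<Longrightarrow> (\<lambda>t \<omega>. x t \<omega> + y t \<omega>) \<in> policies r M"
  by (simp add: policies_def Lspace_add)

lemma policies_scale: "x \<in> policies r M \<Longrightarrow> (\<lambda>t \<omega>. c *\<^sub>R x t \<omega>) \<in> policies r M"
  by (simp add: policies_def Lspace_scale)

lemma policies_diff:
  "x \<in> policies r M \<Longrightarrow> y \<in> policies r M \<Longrightarrow> (\<lambda>t \<omega>. x t \<omega> - y t \<omega>) \<in> policies r M"
  by (simp add: policies_def Lspace_diff)

lemma subspace_policies: "subspace (policies r M)"
proof (rule subspaceI)
  show "0 \<in> policies r M" by (simp add: policies_def zero_fun_def Lspace_zero)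
  show "x + y \<in> policies r M" if "x \<in> policies r M" "y \<in> policies r M" for x y
    using policies_add[OF that] by (simp add: plus_fun_def)
  show "c *\<^sub>R x \<in> policies r M" if "x \<in> policies r M" for c x
    using policies_scale[OF that, of c] by (simp add: scaleR_fun_def)
qed

lemma policy_norm_nonneg: "0 \<le> policy_norm p M x"
  by (simp add: policy_norm_def)

lemma policy_norm_zero: "policy_norm p M (\<lambda>t \<omega>. 0) = 0"
  by (simp add: policy_norm_def)

lemma policy_norm_scale:
  assumes "0 < p" shows "policy_norm p M (\<lambda>t \<omega>. c *\<^sub>R x t \<omega>) = \<bar>c\<bar> * policy_norm p M x"
proof -
  have "(\<Sum>t\<in>UNIV. LINT \<omega>|M. norm (c *\<^sub>R x t \<omega>) powr p)
      = \<bar>c\<bar> powr p * (\<Sum>t\<in>UNIV. LINT \<omega>|M. norm (x t \<omega>) powr p)"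
    by (simp add: powr_mult sum_distrib_left)
  moreover have "0 \<le> (\<Sum>t\<in>UNIV. LINT \<omega>|M. norm (x t \<omega>) powr p)"
    by (intro sum_nonneg integral_nonneg_AE) auto
  ultimately show ?thesis
    using assms by (simp add: policy_norm_def powr_mult powr_powr)
qed

text \<open>
  The factor is not sharp, but neighbourhoods of a policy are compared up to a constant only.
\<close>

lemma policy_norm_triangle_weak:
  fixes x y :: "'t::finite \<Rightarrow> 'a \<Rightarrow> 'b::euclidean_space"
  assumes p: "1 \<le> p" and x: "x \<in> policies (ennreal p) M" and y: "y \<in> policies (ennreal p) M"
  shows "policy_norm p M (\<lambda>t \<omega>. x t \<omega> + y t \<omega>) \<le> CARD('t) * (policy_norm p M x + policy_norm p M y)"
proof -
  have "policy_norm p M (\<lambda>t \<omega>. x t \<omega> + y t \<omega>) \<le> (\<Sum>t\<in>UNIV. Lnorm p M (\<lambda>\<omega>. x t \<omega> + y t \<omega>))"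
    by (rule policy_norm_le_sum_Lnorm[OF p])
  also have "\<dots> \<le> (\<Sum>t\<in>(UNIV :: 't set). policy_norm p M x + policy_norm p M y)"
  proof (rule sum_mono)
    fix t
    have "Lnorm p M (\<lambda>\<omega>. x t \<omega> + y t \<omega>) \<le> Lnorm p M (x t) + Lnorm p M (y t)"
      by (rule Lnorm_triangle[OF p policiesD[OF x] policiesD[OF y]])
    then show "Lnorm p M (\<lambda>\<omega>. x t \<omega> + y t \<omega>) \<le> policy_norm p M x + policy_norm p M y"
      using Lnorm_le_policy_norm[of p M x t] Lnorm_le_policy_norm[of p M y t] p by simp
  qed
  finally show ?thesis by simp
qed

text \<open>
  The Clarke derivative of a Lipschitz functional is a real number.  It is described here as the
  infimum of the numbers that bound all difference quotients close to \<open>x\<close>.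
\<close>

definition clarke_bound ::
  "real \<Rightarrow> 'a measure \<Rightarrow> (('t::finite \<Rightarrow> 'a \<Rightarrow> 'b::euclidean_space) \<Rightarrow> real)
     \<Rightarrow> ('t \<Rightarrow> 'a \<Rightarrow> 'b) \<Rightarrow> ('t \<Rightarrow> 'a \<Rightarrow> 'b) \<Rightarrow> real \<Rightarrow> bool" where
  "clarke_bound p M \<phi> x v c \<longleftrightarrow>
     (\<exists>\<delta>>0. \<forall>y\<in>policies (ennreal p) M. policy_dist p M y x < \<delta> \<longrightarrow>
        (\<forall>s. 0 < s \<longrightarrow> s < \<delta> \<longrightarrow> (\<phi> (\<lambda>t \<omega>. y t \<omega> + s *\<^sub>R v t \<omega>) - \<phi> y) / s \<le> c))"

definition clarke_rate ::
  "real \<Rightarrow> 'a measure \<Rightarrow> (('t::finite \<Rightarrow> 'a \<Rightarrow> 'b::euclidean_space) \<Rightarrow> real)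
     \<Rightarrow> ('t \<Rightarrow> 'a \<Rightarrow> 'b) \<Rightarrow> ('t \<Rightarrow> 'a \<Rightarrow> 'b) \<Rightarrow> real" where
  "clarke_rate p M \<phi> x v = Inf {c. clarke_bound p M \<phi> x v c}"

lemma clarke_bound_mono: "clarke_bound p M \<phi> x v c \<Longrightarrow> c \<le> d \<Longrightarrow> clarke_bound p M \<phi> x v d"
  unfolding clarke_bound_def by (meson order_trans)

locale Lipschitz_policy_functional =
  fixes p :: real and M :: "'a measure" and \<phi> :: "('t::finite \<Rightarrow> 'a \<Rightarrow> 'b::euclidean_space) \<Rightarrow> real"
    and x :: "'t \<Rightarrow> 'a \<Rightarrow> 'b" and L :: real
  assumes p: "1 \<le> p" and x: "x \<in> policies (ennreal p) M" and L: "0 \<le> L"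
    and Lip: "\<And>y z. y \<in> policies (ennreal p) M \<Longrightarrow> z \<in> policies (ennreal p) M \<Longrightarrow>
      \<bar>\<phi> y - \<phi> z\<bar> \<le> L * policy_dist p M y z"
begin

abbreviation "pol \<equiv> policies (ennreal p) M"

lemma quotient_bound:
  assumes y: "y \<in> pol" and v: "v \<in> pol" and s: "0 < s"
  shows "(\<phi> (\<lambda>t \<omega>. y t \<omega> + s *\<^sub>R v t \<omega>) - \<phi> y) / s \<le> L * policy_norm p M v"
    and "- (L * policy_norm p M v) \<le> (\<phi> (\<lambda>t \<omega>. y t \<omega> + s *\<^sub>R v t \<omega>) - \<phi> y) / s"
proof -
  have "\<bar>\<phi> (\<lambda>t \<omega>. y t \<omega> + s *\<^sub>R v t \<omega>) - \<phi> y\<bar> \<le> L * policy_dist p M (\<lambda>t \<omega>. y t \<omega> + s *\<^sub>R v t \<omega>) y"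
    by (intro Lip policies_add policies_scale y v)
  also have "policy_dist p M (\<lambda>t \<omega>. y t \<omega> + s *\<^sub>R v t \<omega>) y = s * policy_norm p M v"
    using policy_norm_scale[of p M s v] p s by (simp add: policy_dist_def)
  finally have abs: "\<bar>\<phi> (\<lambda>t \<omega>. y t \<omega> + s *\<^sub>R v t \<omega>) - \<phi> y\<bar> \<le> L * (s * policy_norm p M v)" .
  show "(\<phi> (\<lambda>t \<omega>. y t \<omega> + s *\<^sub>R v t \<omega>) - \<phi> y) / s \<le> L * policy_norm p M v"
    using abs_le_D1[OF abs] s by (simp add: divide_le_eq ac_simps)
  show "- (L * policy_norm p M v) \<le> (\<phi> (\<lambda>t \<omega>. y t \<omega> + s *\<^sub>R v t \<omega>) - \<phi> y) / s"
    using abs_le_D2[OF abs] s by (simp add: le_divide_eq ac_simps)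
qed

lemma clarke_bound_Lipschitz:
  "v \<in> pol \<Longrightarrow> clarke_bound p M \<phi> x v (L * policy_norm p M v)"
  unfolding clarke_bound_def
  by (intro exI[of _ 1]) (use quotient_bound(1) in auto)

lemma policy_dist_self: "policy_dist p M x x = 0"
  by (simp add: policy_dist_def policy_norm_zero)

lemma clarke_bound_ge:
  assumes v: "v \<in> pol" and c: "clarke_bound p M \<phi> x v c"
  shows "- L * policy_norm p M v \<le> c"
proof -
  obtain \<delta> where "0 < \<delta>" and \<delta>: "\<And>y s. y \<in> pol \<Longrightarrow> policy_dist p M y x < \<delta> \<Longrightarrow>
      0 < s \<Longrightarrow> s < \<delta> \<Longrightarrow> (\<phi> (\<lambda>t \<omega>. y t \<omega> + s *\<^sub>R v t \<omega>) - \<phi> y) / s \<le> c"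
    using c by (auto simp: clarke_bound_def)
  then show ?thesis
    using order_trans[OF quotient_bound(2)[OF x v, of "\<delta> / 2"] \<delta>[OF x, of "\<delta> / 2"]] policy_dist_self
    by simp
qed

lemma clarke_rate_le:
  assumes "v \<in> pol" "clarke_bound p M \<phi> x v c"
  shows "clarke_rate p M \<phi> x v \<le> c"
  unfolding clarke_rate_def using assms clarke_bound_ge
  by (intro cInf_lower bdd_belowI[where m = "- L * policy_norm p M v"]) auto

lemma clarke_bound_of_less:
  assumes v: "v \<in> pol" and less: "clarke_rate p M \<phi> x v < c"
  shows "clarke_bound p M \<phi> x v c"
proof -
  have "{c. clarke_bound p M \<phi> x v c} \<noteq> {}" using clarke_bound_Lipschitz[OF v] by blast
  then obtain d where "clarke_bound p M \<phi> x v d" "d < c"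
    using cInf_lessD[OF _ less[unfolded clarke_rate_def]] by blast
  then show ?thesis using clarke_bound_mono less_imp_le by blast
qed

lemma clarke_rate_le_norm:
  "v \<in> pol \<Longrightarrow> clarke_rate p M \<phi> x v \<le> L * policy_norm p M v"
  by (intro clarke_rate_le clarke_bound_Lipschitz)

lemma clarke_rate_le_clarke_derivative:
  assumes v: "v \<in> pol"
  shows "ereal (clarke_rate p M \<phi> x v) \<le> clarke_derivative p M \<phi> x v"
proof (rule ccontr)
  let ?N = "\<lambda>\<epsilon>. {y \<in> pol. policy_dist p M y x < \<epsilon>}"
  let ?Q = "\<lambda>y s. (\<phi> (\<lambda>t \<omega>. y t \<omega> + s *\<^sub>R v t \<omega>) - \<phi> y) / s"
  assume "\<not> ?thesis"
  then have "clarke_derivative p M \<phi> x v < ereal (clarke_rate p M \<phi> x v)" by simp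
  then obtain c where c: "clarke_derivative p M \<phi> x v < ereal c" "ereal c < ereal (clarke_rate p M \<phi> x v)"
    using ereal_dense2 by blast
  have "\<forall>\<^sub>F (y, s) in policy_nhds p M x \<times>\<^sub>F at_right 0. ereal (?Q y s) < ereal c"
    using Limsup_lessD[OF c(1)[unfolded clarke_derivative_def]] by (simp add: case_prod_unfold)
  then obtain P R where P: "eventually P (policy_nhds p M x)" and R: "eventually R (at_right (0::real))"
    and PR: "\<And>y s. P y \<Longrightarrow> R s \<Longrightarrow> ?Q y s < c"
    by (auto simp: eventually_prod_filter)
  have "\<exists>\<epsilon>\<in>{0<..}. eventually P (principal (?N \<epsilon>))"
    using P unfolding policy_nhds_def
  proof (subst (asm) eventually_INF_base)
    show "\<exists>\<epsilon>\<in>{0<..}. principal (?N \<epsilon>) \<le> inf (principal (?N a)) (principal (?N b))"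
      if "a \<in> {0<..}" "b \<in> {0<..}" for a b
      using that by (intro bexI[of _ "min a b"]) auto
  qed auto
  then obtain \<epsilon> where \<epsilon>: "0 < \<epsilon>" "\<And>y. y \<in> pol \<Longrightarrow> policy_dist p M y x < \<epsilon> \<Longrightarrow> P y"
    by (auto simp: eventually_principal)
  obtain b where b: "0 < b" "\<And>s. 0 < s \<Longrightarrow> s < b \<Longrightarrow> R s"
    using R by (auto simp: eventually_at_right[OF zero_less_one])
  have "clarke_bound p M \<phi> x v c"
    unfolding clarke_bound_def
    using \<epsilon> b PR by (intro exI[of _ "min \<epsilon> b"]) (auto intro: less_imp_le)
  then have "clarke_rate p M \<phi> x v \<le> c" by (rule clarke_rate_le[OF v])
  then show False using c(2) by simp
qed

text \<open>
  For additivity, a step along \<open>v + w\<close> is a step along \<open>w\<close> followed by one along \<open>v\<close>, whose base point is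
  still close to \<open>x\<close>.  This is where varying the base point in the definition pays off.
\<close>

lemma sublinear_clarke_rate: "sublinear_on (pol) (clarke_rate p M \<phi> x)"
proof (rule sublinear_onI)
  fix v w :: "'t \<Rightarrow> 'a \<Rightarrow> 'b"
  assume v: "v \<in> pol" and w: "w \<in> pol"
  have vw: "v + w \<in> pol" using subspace_add[OF subspace_policies v w] .
  have bound: "clarke_rate p M \<phi> x (v + w) \<le> c + d"
    if c: "clarke_rate p M \<phi> x v < c" and d: "clarke_rate p M \<phi> x w < d" for c d
  proof (rule clarke_rate_le[OF vw])
    obtain \<delta>1 where \<delta>1: "0 < \<delta>1" "\<And>y s. y \<in> pol \<Longrightarrow> policy_dist p M y x < \<delta>1 \<Longrightarrow>
        0 < s \<Longrightarrow> s < \<delta>1 \<Longrightarrow> (\<phi> (\<lambda>t \<omega>. y t \<omega> + s *\<^sub>R v t \<omega>) - \<phi> y) / s \<le> c"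
      using clarke_bound_of_less[OF v c] by (auto simp: clarke_bound_def)
    obtain \<delta>2 where \<delta>2: "0 < \<delta>2" "\<And>y s. y \<in> pol \<Longrightarrow> policy_dist p M y x < \<delta>2 \<Longrightarrow>
        0 < s \<Longrightarrow> s < \<delta>2 \<Longrightarrow> (\<phi> (\<lambda>t \<omega>. y t \<omega> + s *\<^sub>R w t \<omega>) - \<phi> y) / s \<le> d"
      using clarke_bound_of_less[OF w d] by (auto simp: clarke_bound_def)
    \<comment> \<open>A step of length less than \<open>\<delta>\<close> along \<open>w\<close>, from a point within \<open>\<delta>\<close> of \<open>x\<close>, ends within \<open>k * \<delta>\<close> of \<open>x\<close>.\<close>
    define k where "k = CARD('t) * (1 + policy_norm p M w)"
    have "1 \<le> real CARD('t)" by (simp add: Suc_leI)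
    then have "1 * 1 \<le> k"
      unfolding k_def using policy_norm_nonneg[of p M w] by (intro mult_mono) auto
    then have k: "1 \<le> k" by simp
    define \<delta> where "\<delta> = min \<delta>2 (\<delta>1 / k)"
    have \<delta>: "0 < \<delta>" "\<delta> \<le> \<delta>2" "k * \<delta> \<le> \<delta>1" "\<delta> \<le> \<delta>1"
    proof -
      show "0 < \<delta>" "\<delta> \<le> \<delta>2" using \<delta>1 \<delta>2 k by (auto simp: \<delta>_def)
      have "\<delta> \<le> \<delta>1 / k" by (simp add: \<delta>_def)
      then show "k * \<delta> \<le> \<delta>1" using k by (simp add: field_simps)
      moreover have "1 * \<delta> \<le> k * \<delta>" using k \<open>0 < \<delta>\<close> by (intro mult_right_mono) auto
      ultimately show "\<delta> \<le> \<delta>1" by simp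
    qed
    show "clarke_bound p M \<phi> x (v + w) (c + d)"
      unfolding clarke_bound_def
    proof (intro exI[of _ \<delta>] conjI ballI allI impI \<delta>(1))
      fix y s assume y: "y \<in> pol" "policy_dist p M y x < \<delta>" and s: "0 < s" "s < \<delta>"
      let ?y = "\<lambda>t \<omega>. y t \<omega> + s *\<^sub>R w t \<omega>"
      have yp: "?y \<in> pol" by (intro policies_add policies_scale y w)
      have "policy_dist p M ?y x = policy_norm p M (\<lambda>t \<omega>. (y t \<omega> - x t \<omega>) + s *\<^sub>R w t \<omega>)"
        by (simp add: policy_dist_def algebra_simps)
      also have "\<dots> \<le> CARD('t) * (policy_norm p M (\<lambda>t \<omega>. y t \<omega> - x t \<omega>) + policy_norm p M (\<lambda>t \<omega>. s *\<^sub>R w t \<omega>))"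
        by (intro policy_norm_triangle_weak p policies_diff policies_scale x y w)
      also have "\<dots> = CARD('t) * (policy_dist p M y x + s * policy_norm p M w)"
        using policy_norm_scale[of p M s w] p s by (simp add: policy_dist_def)
      also have "\<dots> < CARD('t) * (\<delta> + \<delta> * policy_norm p M w)"
        using y s policy_norm_nonneg[of p M w]
        by (intro mult_strict_left_mono add_less_le_mono mult_right_mono) auto
      also have "\<dots> = k * \<delta>" by (simp add: k_def algebra_simps)
      finally have near: "policy_dist p M ?y x < \<delta>1" using \<delta>(3) by simp
      have "(\<phi> (\<lambda>t \<omega>. ?y t \<omega> + s *\<^sub>R v t \<omega>) - \<phi> ?y) / s \<le> c"
        using \<delta> s by (intro \<delta>1(2) yp near) auto
      moreover have "(\<phi> ?y - \<phi> y) / s \<le> d"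
        using \<delta> s y by (intro \<delta>2(2)) auto
      moreover have "(\<lambda>t \<omega>. ?y t \<omega> + s *\<^sub>R v t \<omega>) = (\<lambda>t \<omega>. y t \<omega> + s *\<^sub>R (v + w) t \<omega>)"
        by (simp add: algebra_simps)
      ultimately show "(\<phi> (\<lambda>t \<omega>. y t \<omega> + s *\<^sub>R (v + w) t \<omega>) - \<phi> y) / s \<le> c + d"
        by (simp add: diff_divide_distrib)
    qed
  qed
  show "clarke_rate p M \<phi> x (v + w) \<le> clarke_rate p M \<phi> x v + clarke_rate p M \<phi> x w"
  proof (rule field_le_epsilon)
    fix e :: real assume "0 < e"
    then have "clarke_rate p M \<phi> x (v + w) \<le> (clarke_rate p M \<phi> x v + e / 2) + (clarke_rate p M \<phi> x w + e / 2)"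
      by (intro bound) auto
    then show "clarke_rate p M \<phi> x (v + w) \<le> clarke_rate p M \<phi> x v + clarke_rate p M \<phi> x w + e" by simp
  qed
next
  fix a :: real and v :: "'t \<Rightarrow> 'a \<Rightarrow> 'b"
  assume a: "0 < a" and v: "v \<in> pol"
  have av: "a *\<^sub>R v \<in> pol" using subspace_scale[OF subspace_policies v] .
  have bound: "clarke_rate p M \<phi> x (a *\<^sub>R v) \<le> a * c" if c: "clarke_rate p M \<phi> x v < c" for c
  proof (rule clarke_rate_le[OF av])
    obtain \<delta> where \<delta>: "0 < \<delta>" "\<And>y s. y \<in> pol \<Longrightarrow> policy_dist p M y x < \<delta> \<Longrightarrow>
        0 < s \<Longrightarrow> s < \<delta> \<Longrightarrow> (\<phi> (\<lambda>t \<omega>. y t \<omega> + s *\<^sub>R v t \<omega>) - \<phi> y) / s \<le> c"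
      using clarke_bound_of_less[OF v c] by (auto simp: clarke_bound_def)
    show "clarke_bound p M \<phi> x (a *\<^sub>R v) (a * c)"
      unfolding clarke_bound_def
    proof (intro exI[of _ "min \<delta> (\<delta> / a)"] conjI ballI allI impI)
      show "0 < min \<delta> (\<delta> / a)" using \<delta> a by simp
      fix y s assume y: "y \<in> pol" "policy_dist p M y x < min \<delta> (\<delta> / a)"
        and s: "0 < s" "s < min \<delta> (\<delta> / a)"
      have "(\<phi> (\<lambda>t \<omega>. y t \<omega> + (s * a) *\<^sub>R v t \<omega>) - \<phi> y) / (s * a) \<le> c"
        using y s a by (intro \<delta>(2)) (auto simp: field_simps)
      then show "(\<phi> (\<lambda>t \<omega>. y t \<omega> + s *\<^sub>R (a *\<^sub>R v) t \<omega>) - \<phi> y) / s \<le> a * c"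
        using a s by (simp add: field_simps)
    qed
  qed
  show "clarke_rate p M \<phi> x (a *\<^sub>R v) \<le> a * clarke_rate p M \<phi> x v"
  proof (rule field_le_epsilon)
    fix e :: real assume "0 < e"
    then have "clarke_rate p M \<phi> x (a *\<^sub>R v) \<le> a * (clarke_rate p M \<phi> x v + e / a)"
      using a by (intro bound) auto
    then show "clarke_rate p M \<phi> x (a *\<^sub>R v) \<le> a * clarke_rate p M \<phi> x v + e"
      using a by (simp add: distrib_left)
  qed
qed

end

section \<open>Directional rates of the distance to a multifunction\<close>

text \<open>
  The one-sided derivative at \<open>0\<close> of the norm of the distance of \<open>a + s w\<close> to \<open>S\<close>.  If \<open>a\<close> is a
  selection of a convex-valued \<open>S\<close>, the difference quotients increase with \<open>s\<close>, so that the limit is an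
  infimum.
\<close>

definition dist_rate ::
  "real \<Rightarrow> 'a measure \<Rightarrow> ('a \<Rightarrow> 'b::euclidean_space set) \<Rightarrow> ('a \<Rightarrow> 'b) \<Rightarrow> ('a \<Rightarrow> 'b) \<Rightarrow> real" where
  "dist_rate p M S a w = (INF s\<in>{0<..}. Lnorm p M (\<lambda>\<omega>. infdist (a \<omega> + s *\<^sub>R w \<omega>) (S \<omega>)) / s)"

locale convex_selection =
  fixes p :: real and M :: "'a measure" and S :: "'a \<Rightarrow> 'b::euclidean_space set" and a :: "'a \<Rightarrow> 'b"
  assumes p: "1 \<le> p" and S: "measurable_multifunction M S"
    and convex_S: "\<And>\<omega>. \<omega> \<in> space M \<Longrightarrow> convex (S \<omega>)" and closed_S: "\<And>\<omega>. \<omega> \<in> space M \<Longrightarrow> closed (S \<omega>)"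
    and a: "a \<in> Lspace (ennreal p) M" and a_S: "AE \<omega> in M. a \<omega> \<in> S \<omega>"
begin

abbreviation "Lp \<equiv> Lspace (ennreal p) M"
abbreviation "rate \<equiv> dist_rate p M S a"

lemma p_pos: "0 < p" using p by simp

definition gap :: "('a \<Rightarrow> 'b) \<Rightarrow> real \<Rightarrow> 'a \<Rightarrow> real" where
  "gap w s \<omega> = infdist (a \<omega> + s *\<^sub>R w \<omega>) (S \<omega>)"

lemma gap_nonneg: "0 \<le> gap w s \<omega>" by (simp add: gap_def infdist_nonneg)

lemma dist_rate_gap: "rate w = (INF s\<in>{0<..}. Lnorm p M (gap w s) / s)"
  by (simp add: dist_rate_def gap_def[abs_def])

lemma gap_Lspace: "w \<in> Lp \<Longrightarrow> gap w s \<in> Lp"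
  unfolding gap_def[abs_def] by (intro Lspace_infdist[OF _ a a_S S] Lspace_add a Lspace_scale)

lemma dist_rate_le: "0 < s \<Longrightarrow> rate w \<le> Lnorm p M (gap w s) / s"
  unfolding dist_rate_gap by (intro cINF_lower bdd_belowI2[where m = 0]) (auto simp: Lnorm_nonneg)

lemma dist_rate_le_Lnorm:
  assumes w: "w \<in> Lp" shows "rate w \<le> Lnorm p M w"
proof -
  have "Lnorm p M (gap w 1) \<le> Lnorm p M w"
  proof (rule Lnorm_mono[OF p_pos Lspace_measurable[OF gap_Lspace[OF w]] w])
    show "AE \<omega> in M. norm (gap w 1 \<omega>) \<le> norm (w \<omega>)"
      using a_S
    proof eventually_elim
      case (elim \<omega>)
      show ?case using infdist_le[OF elim, of "a \<omega> + w \<omega>"] by (simp add: gap_def infdist_nonneg dist_norm)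
    qed
  qed
  then show ?thesis using dist_rate_le[of 1 w] by simp
qed

text \<open>
  The distance to a convex set is convex along the segment from \<open>a\<close>, where it vanishes.
\<close>

lemma gap_quotient_mono:
  assumes w: "w \<in> Lp" and s: "0 < s" "s \<le> s'"
  shows "Lnorm p M (gap w s) / s \<le> Lnorm p M (gap w s') / s'"
proof -
  have s': "0 < s'" using s by simp
  have "Lnorm p M (gap w s) \<le> Lnorm p M (\<lambda>\<omega>. (s / s') *\<^sub>R gap w s' \<omega>)"
  proof (rule Lnorm_mono[OF p_pos Lspace_measurable[OF gap_Lspace[OF w]] Lspace_scale[OF gap_Lspace[OF w]]])
    show "AE \<omega> in M. norm (gap w s \<omega>) \<le> norm ((s / s') *\<^sub>R gap w s' \<omega>)"
      using a_S AE_space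
    proof eventually_elim
      case (elim \<omega>)
      have "a \<omega> + s *\<^sub>R w \<omega> = (1 - s / s') *\<^sub>R a \<omega> + (s / s') *\<^sub>R (a \<omega> + s' *\<^sub>R w \<omega>)"
        using s' by (simp add: algebra_simps)
      then have "gap w s \<omega> \<le> (1 - s / s') * infdist (a \<omega>) (S \<omega>) + (s / s') * gap w s' \<omega>"
        unfolding gap_def using s s' convex_S[OF elim(2)] closed_S[OF elim(2)]
        by (simp only:) (intro infdist_convex_combination, auto)
      then show ?case using elim(1) s s' gap_nonneg by simp
    qed
  qed
  also have "\<dots> = (s / s') * Lnorm p M (gap w s')"
    using Lnorm_scale[OF p_pos, of M "s / s'" "gap w s'"] s s' by simp
  finally show ?thesis using s s' by (simp add: field_simps)
qed

lemma gap_quotient_less: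
  assumes w: "w \<in> Lp" and e: "rate w < c"
  shows "\<exists>\<delta>>0. \<forall>s. 0 < s \<longrightarrow> s \<le> \<delta> \<longrightarrow> Lnorm p M (gap w s) / s < c"
proof -
  obtain \<delta> where \<delta>: "0 < \<delta>" "Lnorm p M (gap w \<delta>) / \<delta> < c"
    using e unfolding dist_rate_gap by (subst (asm) cINF_less_iff) (auto intro: bdd_belowI2[where m = 0] simp: Lnorm_nonneg)
  then show ?thesis using gap_quotient_mono[OF w] by (intro exI[of _ \<delta>]) (meson le_less_trans)
qed

lemma gap_add:
  assumes v: "v \<in> Lp" and w: "w \<in> Lp"
  shows "2 * Lnorm p M (gap (\<lambda>\<omega>. v \<omega> + w \<omega>) s) \<le> Lnorm p M (gap v (2 * s)) + Lnorm p M (gap w (2 * s))"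
proof -
  let ?h = "\<lambda>\<omega>. gap v (2 * s) \<omega> + gap w (2 * s) \<omega>"
  have h: "?h \<in> Lp" by (intro Lspace_add gap_Lspace v w)
  have vw: "(\<lambda>\<omega>. v \<omega> + w \<omega>) \<in> Lp" by (intro Lspace_add v w)
  have "Lnorm p M (gap (\<lambda>\<omega>. v \<omega> + w \<omega>) s) \<le> Lnorm p M (\<lambda>\<omega>. (1 / 2) *\<^sub>R ?h \<omega>)"
  proof (rule Lnorm_mono[OF p_pos Lspace_measurable[OF gap_Lspace[OF vw]] Lspace_scale[OF h]])
    show "AE \<omega> in M. norm (gap (\<lambda>\<omega>. v \<omega> + w \<omega>) s \<omega>) \<le> norm ((1 / 2) *\<^sub>R ?h \<omega>)"
    proof (rule AE_I2)
      fix \<omega> assume \<omega>: "\<omega> \<in> space M"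
      have "a \<omega> + s *\<^sub>R (v \<omega> + w \<omega>)
          = (1 / 2) *\<^sub>R (a \<omega> + (2 * s) *\<^sub>R v \<omega>) + (1 / 2) *\<^sub>R (a \<omega> + (2 * s) *\<^sub>R w \<omega>)"
        by (simp add: algebra_simps flip: scaleR_add_left)
      then have "gap (\<lambda>\<omega>. v \<omega> + w \<omega>) s \<omega> \<le> (1 / 2) * gap v (2 * s) \<omega> + (1 / 2) * gap w (2 * s) \<omega>"
        unfolding gap_def using convex_S[OF \<omega>] closed_S[OF \<omega>]
        by (simp only:) (intro infdist_convex_combination, auto)
      then show "norm (gap (\<lambda>\<omega>. v \<omega> + w \<omega>) s \<omega>) \<le> norm ((1 / 2) *\<^sub>R ?h \<omega>)"
        using gap_nonneg[of v "2 * s" \<omega>] gap_nonneg[of w "2 * s" \<omega>]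
          gap_nonneg[of "\<lambda>\<omega>. v \<omega> + w \<omega>" s \<omega>] by simp
    qed
  qed
  also have "\<dots> = (1 / 2) * Lnorm p M ?h" using Lnorm_scale[OF p_pos, of M "1 / 2" ?h] by simp
  also have "Lnorm p M ?h \<le> Lnorm p M (gap v (2 * s)) + Lnorm p M (gap w (2 * s))"
    by (intro Lnorm_triangle p gap_Lspace v w)
  finally show ?thesis by simp
qed

text \<open>
  A step of length \<open>s\<close> along \<open>v + w\<close> ends in the midpoint of the ends of the steps of length \<open>2 * s\<close> along
  \<open>v\<close> and along \<open>w\<close>.
\<close>

lemma dist_rate_add:
  assumes v: "v \<in> Lp" and w: "w \<in> Lp"
  shows "rate (\<lambda>\<omega>. v \<omega> + w \<omega>) \<le> rate v + rate w"
proof (rule field_le_epsilon)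
  fix e :: real assume e: "0 < e"
  obtain \<delta>1 where \<delta>1: "0 < \<delta>1" "\<And>s. 0 < s \<Longrightarrow> s \<le> \<delta>1 \<Longrightarrow> Lnorm p M (gap v s) / s < rate v + e / 2"
    using gap_quotient_less[OF v, of "rate v + e / 2"] e by auto
  obtain \<delta>2 where \<delta>2: "0 < \<delta>2" "\<And>s. 0 < s \<Longrightarrow> s \<le> \<delta>2 \<Longrightarrow> Lnorm p M (gap w s) / s < rate w + e / 2"
    using gap_quotient_less[OF w, of "rate w + e / 2"] e by auto
  define s where "s = min \<delta>1 \<delta>2 / 2"
  have s: "0 < s" "2 * s \<le> \<delta>1" "2 * s \<le> \<delta>2" using \<delta>1 \<delta>2 by (auto simp: s_def)
  have "rate (\<lambda>\<omega>. v \<omega> + w \<omega>) \<le> Lnorm p M (gap (\<lambda>\<omega>. v \<omega> + w \<omega>) s) / s"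
    by (rule dist_rate_le[OF s(1)])
  also have "\<dots> = 2 * Lnorm p M (gap (\<lambda>\<omega>. v \<omega> + w \<omega>) s) / (2 * s)" by simp
  also have "\<dots> \<le> (Lnorm p M (gap v (2 * s)) + Lnorm p M (gap w (2 * s))) / (2 * s)"
    using gap_add[OF v w, of s] s(1) by (intro divide_right_mono) auto
  also have "\<dots> \<le> (rate v + e / 2) + (rate w + e / 2)"
    using \<delta>1(2)[of "2 * s"] \<delta>2(2)[of "2 * s"] s by (simp add: add_divide_distrib)
  finally show "rate (\<lambda>\<omega>. v \<omega> + w \<omega>) \<le> rate v + rate w + e" by simp
qed

lemma dist_rate_scale:
  assumes c: "0 < c"
  shows "rate (\<lambda>\<omega>. c *\<^sub>R w \<omega>) \<le> c * rate w"
proof -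
  have "rate (\<lambda>\<omega>. c *\<^sub>R w \<omega>) / c \<le> rate w"
    unfolding dist_rate_gap[of w]
  proof (rule cINF_greatest)
    fix s :: real assume s: "s \<in> {0<..}"
    have "gap (\<lambda>\<omega>. c *\<^sub>R w \<omega>) (s / c) = gap w s" using c by (auto simp: gap_def)
    then have "rate (\<lambda>\<omega>. c *\<^sub>R w \<omega>) \<le> Lnorm p M (gap w s) / (s / c)"
      using dist_rate_le[of "s / c" "\<lambda>\<omega>. c *\<^sub>R w \<omega>"] s c by simp
    then show "rate (\<lambda>\<omega>. c *\<^sub>R w \<omega>) / c \<le> Lnorm p M (gap w s) / s"
      using s c by (simp add: field_simps)
  qed simp
  then show ?thesis using c by (simp add: field_simps)
qed

text \<open>
  The step of length one along \<open>z - a\<close> ends in \<open>S\<close>.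
\<close>

lemma dist_rate_selection:
  assumes z: "z \<in> Lselections (ennreal p) M S"
  shows "rate (\<lambda>\<omega>. z \<omega> - a \<omega>) \<le> 0"
proof -
  have "Lnorm p M (gap (\<lambda>\<omega>. z \<omega> - a \<omega>) 1) \<le> Lnorm p M (\<lambda>_. 0 :: real)"
  proof (rule Lnorm_mono[OF p_pos _ Lspace_zero])
    show "gap (\<lambda>\<omega>. z \<omega> - a \<omega>) 1 \<in> borel_measurable M"
      using z by (intro Lspace_measurable[OF gap_Lspace] Lspace_diff a) (auto simp: Lselections_def)
    have "AE \<omega> in M. z \<omega> \<in> S \<omega>" using z by (simp add: Lselections_def)
    then show "AE \<omega> in M. norm (gap (\<lambda>\<omega>. z \<omega> - a \<omega>) 1 \<omega>) \<le> norm (0 :: real)"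
      by eventually_elim (simp add: gap_def)
  qed
  then show ?thesis using dist_rate_le[of 1 "\<lambda>\<omega>. z \<omega> - a \<omega>"] by (simp add: Lnorm_zero)
qed

end

section \<open>Linearization of the causal operator\<close>

lemma borel_measurable_vec_nth:
  fixes g :: "'a \<Rightarrow> 'b::euclidean_space^'n"
  assumes "g \<in> borel_measurable G" shows "(\<lambda>\<omega>. g \<omega> $ i) \<in> borel_measurable G"
  by (rule borel_measurable_continuous_on[OF _ assms]) (intro continuous_intros)

lemma borel_measurable_matrix_vector_mult:
  fixes A :: "'a \<Rightarrow> real^'n^'m" and v :: "'a \<Rightarrow> real^'n"
  assumes "A \<in> borel_measurable G" "v \<in> borel_measurable G"
  shows "(\<lambda>\<omega>. A \<omega> *v v \<omega>) \<in> borel_measurable G"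
  unfolding matrix_vector_mult_def
  using borel_measurable_vec_nth[OF borel_measurable_vec_nth[OF assms(1)]] borel_measurable_vec_nth[OF assms(2)]
  by (intro borel_measurable_vec_lambda borel_measurable_sum borel_measurable_times)

lemma borel_measurable_transpose:
  fixes A :: "'a \<Rightarrow> real^'n^'m"
  assumes "A \<in> borel_measurable G" shows "(\<lambda>\<omega>. transpose (A \<omega>)) \<in> borel_measurable G"
  unfolding transpose_def
  using borel_measurable_vec_nth[OF borel_measurable_vec_nth[OF assms(1)]]
  by (intro borel_measurable_vec_lambda)

lemma transpose_inner: "(transpose A *v \<psi>) \<bullet> u = \<psi> \<bullet> (A *v u)"
  for A :: "real^'n^'m"
  by (simp add: dot_lmul_matrix transpose_matrix_vector)

text \<open>
  A matrix and its transpose obey the same operator norm bound, by duality.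
\<close>

lemma norm_transpose_mult_le:
  fixes A :: "real^'n^'m"
  assumes "\<And>u. norm (A *v u) \<le> L * norm u"
  shows "norm (transpose A *v \<psi>) \<le> L * norm \<psi>"
proof (cases "transpose A *v \<psi> = 0")
  case True
  have "0 \<le> norm (A *v axis undefined 1)" by simp
  also have "\<dots> \<le> L" using assms[of "axis undefined 1"] by simp
  finally show ?thesis using True by simp
next
  case False
  let ?u = "transpose A *v \<psi>"
  have "norm ?u * norm ?u = \<psi> \<bullet> (A *v ?u)"
    using transpose_inner[of A \<psi> ?u] by (simp add: dot_square_norm power2_eq_square)
  also have "\<dots> \<le> norm \<psi> * norm (A *v ?u)" by (rule norm_cauchy_schwarz)
  also have "\<dots> \<le> norm \<psi> * (L * norm ?u)" by (intro mult_left_mono assms) auto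
  finally have "norm ?u * norm ?u \<le> (L * norm \<psi>) * norm ?u" by (simp add: mult.commute mult.left_commute)
  then show ?thesis using False by simp
qed

lemma difference_quotient_tendsto:
  fixes G :: "'b::real_normed_vector \<Rightarrow> 'c::real_normed_vector"
  assumes D: "(G has_derivative D) (at \<zeta>)"
  shows "(\<lambda>k. real (Suc k) *\<^sub>R (G (\<zeta> + (1 / real (Suc k)) *\<^sub>R h) - G \<zeta>)) \<longlonglongrightarrow> D h"
proof -
  have line: "((\<lambda>s. \<zeta> + s *\<^sub>R h) has_derivative (\<lambda>s. s *\<^sub>R h)) (at (0::real))"
    by (auto intro!: derivative_eq_intros)
  have "((\<lambda>s. G (\<zeta> + s *\<^sub>R h)) has_derivative (\<lambda>s. D (s *\<^sub>R h))) (at 0)"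
    using has_derivative_compose[OF line, of G D] D by simp
  then have "((\<lambda>s. norm (G (\<zeta> + s *\<^sub>R h) - G \<zeta> - s *\<^sub>R D h) / norm s) \<longlongrightarrow> 0) (at 0)"
    using linear_scale[OF has_derivative_linear[OF D]] by (simp add: has_derivative_at)
  moreover have "\<forall>\<^sub>F s in at 0. norm (G (\<zeta> + s *\<^sub>R h) - G \<zeta> - s *\<^sub>R D h) / norm s
      = norm ((1 / s) *\<^sub>R (G (\<zeta> + s *\<^sub>R h) - G \<zeta>) - D h)"
    unfolding eventually_at_filter
  proof (intro always_eventually allI impI)
    fix s :: real assume "s \<noteq> 0"
    then have "(1 / s) *\<^sub>R (G (\<zeta> + s *\<^sub>R h) - G \<zeta>) - D h
        = (1 / s) *\<^sub>R (G (\<zeta> + s *\<^sub>R h) - G \<zeta> - s *\<^sub>R D h)" by (simp add: scaleR_diff_right)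
    then show "norm (G (\<zeta> + s *\<^sub>R h) - G \<zeta> - s *\<^sub>R D h) / norm s
      = norm ((1 / s) *\<^sub>R (G (\<zeta> + s *\<^sub>R h) - G \<zeta>) - D h)" by simp
  qed
  ultimately have "((\<lambda>s. norm ((1 / s) *\<^sub>R (G (\<zeta> + s *\<^sub>R h) - G \<zeta>) - D h)) \<longlongrightarrow> 0) (at 0)"
    by (rule Lim_transform_eventually)
  then have lim: "((\<lambda>s. (1 / s) *\<^sub>R (G (\<zeta> + s *\<^sub>R h) - G \<zeta>)) \<longlongrightarrow> D h) (at 0)"
    by (rule LIM_zero_cancel[OF tendsto_norm_zero_cancel])
  have "filterlim (\<lambda>k. 1 / real (Suc k)) (at 0) sequentially"
    unfolding filterlim_at using LIMSEQ_inverse_real_of_nat by (auto simp: inverse_eq_divide)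
  from filterlim_compose[OF lim this] show ?thesis by simp
qed

context multistage_recourse begin

definition perturb :: "('t \<Rightarrow> 'a \<Rightarrow> real^'n) \<Rightarrow> nat \<Rightarrow> ('t \<Rightarrow> 'a \<Rightarrow> real^'n) \<Rightarrow> 't \<Rightarrow> 'a \<Rightarrow> real^'n" where
  "perturb x k v = (\<lambda>s \<omega>. x s \<omega> + (1 / real (Suc k)) *\<^sub>R v s \<omega>)"

definition op_quotient :: "('t \<Rightarrow> 'a \<Rightarrow> real^'n) \<Rightarrow> ('t \<Rightarrow> 'a \<Rightarrow> real^'n) \<Rightarrow> nat \<Rightarrow> 't \<Rightarrow> 'a \<Rightarrow> real^'m" where
  "op_quotient x v k t \<omega> =
     real (Suc k) *\<^sub>R (causal_op f t (perturb x k v) \<omega> - causal_op f t x \<omega>)"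

text \<open>
  The Jacobian blocks as limits of difference quotients.  These limits are measurable by construction, whereas
  a \<open>jacobian_block\<close> has arbitrary values on the null set where \<open>f t\<close> is not differentiable.
\<close>

definition jac :: "('t \<Rightarrow> 'a \<Rightarrow> real^'n) \<Rightarrow> 't \<Rightarrow> 't \<Rightarrow> 'a \<Rightarrow> real^'n^'m" where
  "jac x t l \<omega> =
     (\<chi> i j. lim (\<lambda>k. op_quotient x (\<lambda>s \<omega>. if s = l then axis j 1 else 0) k t \<omega>) $ i)"

definition linearized :: "('t \<Rightarrow> 'a \<Rightarrow> real^'n) \<Rightarrow> ('t \<Rightarrow> 'a \<Rightarrow> real^'n) \<Rightarrow> 't \<Rightarrow> 'a \<Rightarrow> real^'m" where
  "linearized x v t \<omega> = (\<Sum>l\<in>UNIV. jac x t l \<omega> *v v l \<omega>)"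

lemma measurable_op_quotient:
  assumes "\<And>s. x s \<in> borel_measurable M" "\<And>s. v s \<in> borel_measurable M"
  shows "op_quotient x v k t \<in> borel_measurable M"
proof -
  have "(\<lambda>\<omega>. real (Suc k) *\<^sub>R (causal_op f t (perturb x k v) \<omega> - causal_op f t x \<omega>)) \<in> borel_measurable M"
    using assms
    by (intro borel_measurable_scaleR borel_measurable_const borel_measurable_diff measurable_causal_op)
       (auto simp: perturb_def)
  then show ?thesis by (simp add: op_quotient_def[abs_def])
qed

lemma measurable_jac:
  assumes "\<And>s. x s \<in> borel_measurable M" shows "jac x t l \<in> borel_measurable M"
proof -
  have "(\<lambda>\<omega>. \<chi> i j. lim (\<lambda>k. op_quotient x (\<lambda>s \<omega>. if s = l then axis j 1 else 0) k t \<omega>) $ i) \<in> borel_measurable M"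
    using assms
    by (intro borel_measurable_vec_lambda borel_measurable_vec_nth borel_measurable_lim_metric measurable_op_quotient)
       auto
  then show ?thesis by (simp add: jac_def[abs_def])
qed

lemma jac_eq_0: assumes "\<omega> \<in> space M" "t < l" shows "jac x t l \<omega> = 0"
proof -
  have "op_quotient x (\<lambda>s \<omega>. if s = l then axis j 1 else 0) k t \<omega> = 0" for j k
  proof -
    have "causal_op f t (perturb x k (\<lambda>s \<omega>. if s = l then axis j 1 else 0)) \<omega> = causal_op f t x \<omega>"
      unfolding causal_op_def using assms by (intro history) (auto simp: perturb_def)
    then show ?thesis by (simp add: op_quotient_def)
  qed
  then show ?thesis by (simp add: jac_def limI[OF tendsto_const] zero_vec_def)
qed

lemma op_quotient_Lipschitz:
  assumes L: "Lipschitz_at L \<omega>" and L0: "0 \<le> L"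
  shows "norm (op_quotient x v k t \<omega>) \<le> L * (\<Sum>s\<in>UNIV. norm (v s \<omega>))"
proof -
  have "norm (causal_op f t (perturb x k v) \<omega> - causal_op f t x \<omega>)
      \<le> L * (\<Sum>s\<in>{..t}. norm ((1 / real (Suc k)) *\<^sub>R v s \<omega>))"
    using L[unfolded Lipschitz_at_def, rule_format, of t "\<chi> s. perturb x k v s \<omega>" "\<chi> s. x s \<omega>"]
    by (simp add: causal_op_def perturb_def)
  also have "\<dots> \<le> L * (\<Sum>s\<in>UNIV. norm ((1 / real (Suc k)) *\<^sub>R v s \<omega>))"
    using L0 by (intro mult_left_mono sum_mono2) auto
  also have "\<dots> = L * (\<Sum>s\<in>UNIV. norm (v s \<omega>)) / real (Suc k)"
    by (simp flip: sum_divide_distrib)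
  finally have "norm (causal_op f t (perturb x k v) \<omega> - causal_op f t x \<omega>) * real (Suc k)
      \<le> L * (\<Sum>s\<in>UNIV. norm (v s \<omega>))"
    by (simp add: le_divide_eq del: of_nat_Suc)
  moreover have "norm (op_quotient x v k t \<omega>)
      = norm (causal_op f t (perturb x k v) \<omega> - causal_op f t x \<omega>) * real (Suc k)"
    unfolding op_quotient_def norm_scaleR by (simp add: mult.commute del: of_nat_Suc)
  ultimately show ?thesis by simp
qed

text \<open>
  At a point of differentiability the difference quotients converge to the derivative of \<open>f t\<close>
  applied to the direction, and the chain rule for the affine map \<open>replace_block\<close> identifies the
  Jacobian blocks as the restrictions of this derivative to the single stages.
\<close>

lemma jac_AE:
  "AE \<omega> in M. \<forall>t. (\<forall>l. jac x t l \<omega> = jacobian_block f x t l \<omega>) \<and>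
     (\<forall>v. (\<lambda>k. op_quotient x v k t \<omega>) \<longlonglongrightarrow> linearized x v t \<omega>)"
  using differentiable_AE
proof eventually_elim
  case (elim \<omega>)
  show ?case
  proof (intro allI conjI)
    fix t
    let ?G = "\<lambda>\<xi>. f t \<xi> \<omega>" and ?\<zeta> = "\<chi> s. x s \<omega>"
    obtain D where D: "(?G has_derivative D) (at ?\<zeta>)" using elim by (auto simp: differentiable_def)
    note linD = has_derivative_linear[OF D]
    have lim: "(\<lambda>k. op_quotient x v k t \<omega>) \<longlonglongrightarrow> D (\<chi> s. v s \<omega>)" for v
    proof -
      have "(\<chi> s. perturb x k v s \<omega>) = ?\<zeta> + (1 / real (Suc k)) *\<^sub>R (\<chi> s. v s \<omega>)" for k
        by (simp add: vec_eq_iff perturb_def)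
      then show ?thesis
        using difference_quotient_tendsto[OF D, of "\<chi> s. v s \<omega>"]
        by (simp add: op_quotient_def causal_op_def)
    qed
    have axis: "(\<chi> s. if s = l then u else 0) = axis l u" for l and u :: "real^'n"
      by (simp add: vec_eq_iff axis_def)
    have part: "jacobian_block f x t l \<omega> = matrix (\<lambda>u. D (axis l u))" for l
    proof -
      have bl: "bounded_linear (axis l :: real^'n \<Rightarrow> (real^'n, 't) vec)"
        by (intro linear_conv_bounded_linear[THEN iffD1] linearI) (auto simp: vec_eq_iff axis_def)
      have aff: "replace_block ?\<zeta> l = (\<lambda>u. ?\<zeta> + axis l (u - x l \<omega>))"
        by (auto simp: fun_eq_iff vec_eq_iff replace_block_def axis_def)
      have "(replace_block ?\<zeta> l has_derivative axis l) (at (x l \<omega>))"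
        unfolding aff
        by (rule has_derivative_eq_rhs, (rule derivative_intros bounded_linear.has_derivative[OF bl])+) auto
      moreover have "replace_block ?\<zeta> l (x l \<omega>) = ?\<zeta>" by (simp add: aff linear_0[OF bounded_linear.linear[OF bl]])
      ultimately have "((\<lambda>u. ?G (replace_block ?\<zeta> l u)) has_derivative (\<lambda>u. D (axis l u))) (at (x l \<omega>))"
        using has_derivative_compose[of "replace_block ?\<zeta> l" "axis l" "x l \<omega>" UNIV ?G D] D by simp
      from frechet_derivative_at[OF this] show ?thesis
        by (simp add: jacobian_block_def partial_jacobian_def)
    qed
    have lin: "linear (\<lambda>u. D (axis l u))" for l
    proof (rule linearI)
      have "axis l (a + b) = axis l a + axis l b" for a b :: "real^'n" by (auto simp: vec_eq_iff axis_def)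
      then show "D (axis l (a + b)) = D (axis l a) + D (axis l b)" for a b by (simp add: linear_add[OF linD])
      have "axis l (c *\<^sub>R a) = c *\<^sub>R axis l a" for c and a :: "real^'n" by (auto simp: vec_eq_iff axis_def)
      then show "D (axis l (c *\<^sub>R a)) = c *\<^sub>R D (axis l a)" for c a by (simp add: linear_scale[OF linD])
    qed
    show eq: "jac x t l \<omega> = jacobian_block f x t l \<omega>" for l
    proof -
      have "lim (\<lambda>k. op_quotient x (\<lambda>s \<omega>. if s = l then axis j 1 else 0) k t \<omega>) = D (axis l (axis j 1))" for j
        using limI[OF lim[of "\<lambda>s \<omega>. if s = l then axis j 1 else 0"]] by (simp add: axis)
      then show ?thesis by (simp add: part jac_def matrix_def)
    qed
    fix v
    have "linearized x v t \<omega> = (\<Sum>l\<in>UNIV. D (axis l (v l \<omega>)))"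
      unfolding linearized_def eq part using lin by (simp add: matrix_works)
    also have "\<dots> = D (\<Sum>l\<in>UNIV. axis l (v l \<omega>))" 
      by (rule linear_sum[OF linD, symmetric])
    also have "(\<Sum>l\<in>UNIV. axis l (v l \<omega>)) = (\<chi> s. v s \<omega>)"
      by (simp add: vec_eq_iff axis_def)
    finally show "(\<lambda>k. op_quotient x v k t \<omega>) \<longlonglongrightarrow> linearized x v t \<omega>" using lim by simp
  qed
qed

lemma jac_bound_AE:
  obtains L where "0 \<le> L" "AE \<omega> in M. \<forall>t l u. norm (jac x t l \<omega> *v u) \<le> L * norm u"
proof -
  obtain L where L: "0 \<le> L"
    "AE \<omega> in M. Lipschitz_at L \<omega>"
    by (rule Lipschitz_AE)
  have "AE \<omega> in M. \<forall>t l u. norm (jac x t l \<omega> *v u) \<le> L * norm u"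
    using L(2) jac_AE[of x]
  proof eventually_elim
    case (elim \<omega>)
    show ?case
    proof (intro allI)
      fix t l :: 't and u :: "real^'n"
      let ?v = "\<lambda>(s::'t) (\<omega>::'a). if s = l then u else 0"
      have "(\<lambda>k. norm (op_quotient x ?v k t \<omega>)) \<longlonglongrightarrow> norm (linearized x ?v t \<omega>)"
        using elim(2) by (intro tendsto_norm) blast
      moreover have "norm (op_quotient x ?v k t \<omega>) \<le> L * norm u" for k
      proof -
        have "(\<Sum>s\<in>UNIV. norm (?v s \<omega>)) = norm u" by (simp add: if_distrib cong: if_cong)
        then show ?thesis using op_quotient_Lipschitz[OF elim(1) L(1), of x ?v k t] by simp
      qed
      ultimately have "norm (linearized x ?v t \<omega>) \<le> L * norm u"
        by (intro LIMSEQ_le_const2) auto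
      moreover have "linearized x ?v t \<omega> = jac x t l \<omega> *v u"
      proof -
        have "linearized x ?v t \<omega> = (\<Sum>s\<in>UNIV. if s = l then jac x t l \<omega> *v u else 0)"
          unfolding linearized_def by (intro sum.cong) auto
        then show ?thesis by simp
      qed
      ultimately show "norm (jac x t l \<omega> *v u) \<le> L * norm u" by simp
    qed
  qed
  then show ?thesis using that L(1) by blast
qed

lemma linearized_Lspace:
  assumes x: "\<And>s. x s \<in> borel_measurable M" and v: "v \<in> pol"
  shows "linearized x v t \<in> Lp"
proof -
  obtain L where L: "0 \<le> L" "AE \<omega> in M. \<forall>t l u. norm (jac x t l \<omega> *v u) \<le> L * norm u"
    by (rule jac_bound_AE)
  have "(\<lambda>\<omega>. \<Sum>l\<in>UNIV. jac x t l \<omega> *v v l \<omega>) \<in> Lp"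
  proof (rule Lspace_sum)
    fix l
    show "(\<lambda>\<omega>. jac x t l \<omega> *v v l \<omega>) \<in> Lp"
    proof (rule Lspace_dominated[OF policiesD[OF v, of l], where C = L])
      show "(\<lambda>\<omega>. jac x t l \<omega> *v v l \<omega>) \<in> borel_measurable M"
        by (intro borel_measurable_matrix_vector_mult measurable_jac x Lspace_measurable[OF policiesD[OF v]])
      show "AE \<omega> in M. norm (jac x t l \<omega> *v v l \<omega>) \<le> L * norm (v l \<omega>)"
        using L(2) by eventually_elim blast
    qed
  qed
  then show ?thesis by (simp add: linearized_def[abs_def])
qed

text \<open>
  Nonanticipativity without conditional expectations: each stage has a version that is measurable
  with respect to its \<open>\<sigma>\<close>-algebra.  In this form closure under linear operations is evident.
\<close>

lemma adapted_iff:
  "y \<in> adapted \<longleftrightarrow> y \<in> pol \<and>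
     (\<forall>t. \<exists>g\<in>borel_measurable (F t). AE \<omega> in M. y t \<omega> = g \<omega>)"
proof
  assume y: "y \<in> adapted"
  have "\<exists>g\<in>borel_measurable (F t). AE \<omega> in M. y t \<omega> = g \<omega>" for t
    using nonanticipative_policiesD(2)[OF y, of t]
    by (intro bexI[of _ "vec_cond_exp M (F t) (y t)"] borel_measurable_vec_cond_exp)
  then show "y \<in> pol \<and> (\<forall>t. \<exists>g\<in>borel_measurable (F t). AE \<omega> in M. y t \<omega> = g \<omega>)"
    using y by (auto simp: nonanticipative_policies_def)
next
  assume y: "y \<in> pol \<and> (\<forall>t. \<exists>g\<in>borel_measurable (F t). AE \<omega> in M. y t \<omega> = g \<omega>)"
  have "AE \<omega> in M. y t \<omega> = vec_cond_exp M (F t) (y t) \<omega>" for t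
  proof -
    interpret finite_measure_subalgebra M "F t"
      by (intro finite_measure_subalgebra.intro finite_measure_M finite_measure_subalgebra_axioms.intro subalg)
    obtain g where g: "g \<in> borel_measurable (F t)" and eq: "AE \<omega> in M. y t \<omega> = g \<omega>" using y by blast
    have yL: "y t \<in> Lp" using y by (auto dest: policiesD)
    have gM: "g \<in> borel_measurable M" by (rule measurable_F_M[OF g])
    have "integrable M g"
      using Lspace_integrable[OF finite_measure_M p yL] eq gM
      by (subst integrable_cong_AE[of g M "y t"]) (auto simp: Lspace_measurable[OF yL])
    then have "AE \<omega> in M. vec_cond_exp M (F t) g \<omega> = g \<omega>"
      by (intro vec_cond_exp_of_measurable finite_measure_M subalg g)
    moreover have "AE \<omega> in M. real_cond_exp M (F t) (\<lambda>\<omega>. y t \<omega> $ i) \<omega> = real_cond_exp M (F t) (\<lambda>\<omega>. g \<omega> $ i) \<omega>" for i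
      using eq by (intro real_cond_exp_cong borel_measurable_vec_nth gM Lspace_measurable[OF yL]) auto
    then have "AE \<omega> in M. \<forall>i. real_cond_exp M (F t) (\<lambda>\<omega>. y t \<omega> $ i) \<omega> = real_cond_exp M (F t) (\<lambda>\<omega>. g \<omega> $ i) \<omega>"
      by (simp add: AE_all_countable)
    ultimately show ?thesis using eq by eventually_elim (simp add: vec_cond_exp_def vec_eq_iff)
  qed
  then show "y \<in> adapted" using y by (auto simp: nonanticipative_policies_def)
qed

lemma subspace_adapted: "subspace adapted"
proof (rule subspaceI)
  show "0 \<in> adapted"
    unfolding adapted_iff using subspace_0[OF subspace_policies]
    by (auto intro!: bexI[of _ "\<lambda>_. 0"] simp: zero_fun_def)
  fix y z assume y: "y \<in> adapted" and z: "z \<in> adapted"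
  show "y + z \<in> adapted"
    unfolding adapted_iff
  proof (intro conjI allI subspace_add[OF subspace_policies])
    show "y \<in> pol" "z \<in> pol" using y z by (auto simp: adapted_iff)
    fix t
    obtain g where g: "g \<in> borel_measurable (F t)" "AE \<omega> in M. y t \<omega> = g \<omega>"
      using y unfolding adapted_iff by blast
    obtain h where h: "h \<in> borel_measurable (F t)" "AE \<omega> in M. z t \<omega> = h \<omega>"
      using z unfolding adapted_iff by blast
    show "\<exists>g\<in>borel_measurable (F t). AE \<omega> in M. (y + z) t \<omega> = g \<omega>"
      using g h by (intro bexI[of _ "\<lambda>\<omega>. g \<omega> + h \<omega>"]) auto
  qed
next
  fix c y assume y: "y \<in> adapted"
  show "c *\<^sub>R y \<in> adapted"
    unfolding adapted_iff
  proof (intro conjI allI subspace_scale[OF subspace_policies])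
    show "y \<in> pol" using y by (auto simp: adapted_iff)
    fix t
    obtain g where "g \<in> borel_measurable (F t)" "AE \<omega> in M. y t \<omega> = g \<omega>" using y unfolding adapted_iff by blast
    then show "\<exists>g\<in>borel_measurable (F t). AE \<omega> in M. (c *\<^sub>R y) t \<omega> = g \<omega>"
      by (intro bexI[of _ "\<lambda>\<omega>. c *\<^sub>R g \<omega>"]) auto
  qed
qed

end

section \<open>Multipliers at a local minimum\<close>

lemma LIMSEQ_inverse_Suc: "(\<lambda>k. 1 / real (Suc k)) \<longlonglongrightarrow> 0"
  using LIMSEQ_inverse_real_of_nat by (simp add: inverse_eq_divide)

context convex_selection begin

lemma gap_quotient_tendsto:
  assumes w: "w \<in> Lspace (ennreal p) M"
  shows "(\<lambda>k. real (Suc k) * Lnorm p M (gap w (1 / real (Suc k)))) \<longlonglongrightarrow> dist_rate p M S a w"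
proof (rule order_tendstoI)
  have eq: "real (Suc k) * Lnorm p M (gap w (1 / real (Suc k))) = Lnorm p M (gap w (1 / real (Suc k))) / (1 / real (Suc k))"
    for k by simp
  show "\<forall>\<^sub>F k in sequentially. c < real (Suc k) * Lnorm p M (gap w (1 / real (Suc k)))"
    if "c < dist_rate p M S a w" for c
    unfolding eq using dist_rate_le[of "1 / real (Suc _)" w] that
    by (intro always_eventually allI) (rule less_le_trans, auto)
  show "\<forall>\<^sub>F k in sequentially. real (Suc k) * Lnorm p M (gap w (1 / real (Suc k))) < c"
    if c: "dist_rate p M S a w < c" for c
  proof -
    obtain \<delta> where \<delta>: "0 < \<delta>" "\<And>s. 0 < s \<Longrightarrow> s \<le> \<delta> \<Longrightarrow> Lnorm p M (gap w s) / s < c"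
      using gap_quotient_less[OF w c] by blast
    have "\<forall>\<^sub>F k in sequentially. 1 / real (Suc k) < \<delta>"
      using order_tendstoD(2)[OF LIMSEQ_inverse_Suc \<delta>(1)] .
    then show ?thesis
    proof eventually_elim
      case (elim k)
      then show ?case unfolding eq by (intro \<delta>(2)) auto
    qed
  qed
qed

end

locale multistage_optimum = multistage_recourse M F p f X Y
  for M :: "'a measure" and F :: "'t::{finite,linorder} \<Rightarrow> 'a measure" and p :: real
    and f :: "'t \<Rightarrow> (real^'n, 't) vec \<Rightarrow> 'a \<Rightarrow> real^'m"
    and X :: "'t \<Rightarrow> 'a \<Rightarrow> (real^'n) set" and Y :: "'t \<Rightarrow> 'a \<Rightarrow> (real^'m) set" +
  fixes q :: ennreal and \<phi> :: "('t \<Rightarrow> 'a \<Rightarrow> real^'n) \<Rightarrow> real" and x :: "'t \<Rightarrow> 'a \<Rightarrow> real^'n"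
  assumes q: "1 / ennreal p + 1 / q = 1"
    and Lipschitz: "Lipschitz_functional p M (policies (ennreal p) M) \<phi>"
    and minimum: "local_minimum p M \<phi> feas x"
begin

lemma x_feas: "x \<in> feas" using minimum by (simp add: local_minimum_def)

lemma x_policy: "x \<in> pol"
  using feasibleD(1)[OF x_feas] by (simp add: policies_def)

lemma x_meas: "x s \<in> borel_measurable M"
  by (rule Lspace_measurable[OF feasibleD(1)[OF x_feas]])

definition rate_X :: "('t \<Rightarrow> 'a \<Rightarrow> real^'n) \<Rightarrow> real" where
  "rate_X u = (\<Sum>t\<in>UNIV. dist_rate p M (X t) (x t) (u t))"

definition rate_Y :: "('t \<Rightarrow> 'a \<Rightarrow> real^'m) \<Rightarrow> real" where
  "rate_Y w = (\<Sum>t\<in>UNIV. dist_rate p M (Y t) (causal_op f t x) (w t))"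

lemma selection_X: "convex_selection p M (X t) (x t)"
  using p multifunction_M convex_XY closed_XY feasibleD[OF x_feas] by unfold_locales auto

lemma selection_Y: "convex_selection p M (Y t) (causal_op f t x)"
  using p multifunction_M convex_XY closed_XY feasibleD[OF x_feas] by unfold_locales auto

text \<open>
  Passing from \<open>f t\<close> at the perturbed policy to its linearization costs the linearization error, and the
  distance of the linearized path to \<open>Y t\<close> is the one whose rate is known.
\<close>

lemma violation_quotient_le:
  assumes v: "v \<in> pol"
  shows "real (Suc k) * Lnorm p M (violation (perturb x k v)) \<le>
    (\<Sum>t\<in>UNIV. real (Suc k) * Lnorm p M (convex_selection.gap (Y t) (causal_op f t x) (linearized x v t) (1 / real (Suc k)))
      + Lnorm p M (\<lambda>\<omega>. op_quotient x v k t \<omega> - linearized x v t \<omega>)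
      + real (Suc k) * Lnorm p M (convex_selection.gap (X t) (x t) (v t) (1 / real (Suc k))))"
proof -
  let ?y = "perturb x k v" and ?r = "real (Suc k)"
  let ?gY = "\<lambda>t. convex_selection.gap (Y t) (causal_op f t x) (linearized x v t) (1 / ?r)"
  let ?gX = "\<lambda>t. convex_selection.gap (X t) (x t) (v t) (1 / ?r)"
  let ?R = "\<lambda>t \<omega>. op_quotient x v k t \<omega> - linearized x v t \<omega>"
  have yL: "?y s \<in> Lp" for s
    unfolding perturb_def by (intro Lspace_add Lspace_scale feasibleD[OF x_feas] policiesD[OF v])
  have lin: "linearized x v t \<in> Lp" for t by (rule linearized_Lspace[OF x_meas v])
  have quo: "op_quotient x v k t \<in> Lp" for t
  proof -
    have "(\<lambda>\<omega>. ?r *\<^sub>R (causal_op f t ?y \<omega> - causal_op f t x \<omega>)) \<in> Lp"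
      by (intro Lspace_scale Lspace_diff Lspace_causal_op[OF feasibleD(1,2)[OF x_feas] yL] feasibleD(2)[OF x_feas])
    then show ?thesis by (simp add: op_quotient_def[abs_def])
  qed
  have R: "?R t \<in> Lp" for t by (intro Lspace_diff quo lin)
  have gY: "?gY t \<in> Lp" for t by (rule convex_selection.gap_Lspace[OF selection_Y lin])
  have gX: "?gX t \<in> Lp" for t by (rule convex_selection.gap_Lspace[OF selection_X policiesD[OF v]])
  have infY: "(\<lambda>\<omega>. infdist (causal_op f t ?y \<omega>) (Y t \<omega>)) \<in> Lp" for t
    by (intro Lspace_infdist[OF _ feasibleD(2,3)[OF x_feas] multifunction_M(2)]
        Lspace_causal_op[OF feasibleD(1,2)[OF x_feas] yL])
  have infX: "(\<lambda>\<omega>. infdist (?y t \<omega>) (X t \<omega>)) \<in> Lp" for t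
    by (intro Lspace_infdist[OF _ feasibleD(1,4)[OF x_feas] multifunction_M(1)] yL)
  have partY: "Lnorm p M (\<lambda>\<omega>. infdist (causal_op f t ?y \<omega>) (Y t \<omega>))
      \<le> Lnorm p M (?gY t) + (1 / ?r) * Lnorm p M (?R t)" for t
  proof -
    have sR: "(\<lambda>\<omega>. (1 / ?r) *\<^sub>R norm (?R t \<omega>)) \<in> Lp" by (intro Lspace_scale Lspace_norm R)
    have "Lnorm p M (\<lambda>\<omega>. infdist (causal_op f t ?y \<omega>) (Y t \<omega>))
        \<le> Lnorm p M (\<lambda>\<omega>. ?gY t \<omega> + (1 / ?r) *\<^sub>R norm (?R t \<omega>))"
    proof (rule Lnorm_mono[OF p_pos Lspace_measurable[OF infY] Lspace_add[OF gY sR]], rule AE_I2)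
      fix \<omega>
      let ?l = "causal_op f t x \<omega> + (1 / ?r) *\<^sub>R linearized x v t \<omega>"
      have "causal_op f t ?y \<omega> - ?l = (1 / ?r) *\<^sub>R ?R t \<omega>"
        by (simp add: op_quotient_def scaleR_diff_right del: of_nat_Suc)
      then have "dist (causal_op f t ?y \<omega>) ?l = (1 / ?r) * norm (?R t \<omega>)"
        by (simp add: dist_norm del: of_nat_Suc)
      moreover have "infdist (causal_op f t ?y \<omega>) (Y t \<omega>) \<le> infdist ?l (Y t \<omega>) + dist (causal_op f t ?y \<omega>) ?l"
        by (rule infdist_triangle)
      moreover have "?gY t \<omega> = infdist ?l (Y t \<omega>)" by (simp add: convex_selection.gap_def[OF selection_Y])
      ultimately show "norm (infdist (causal_op f t ?y \<omega>) (Y t \<omega>)) \<le> norm (?gY t \<omega> + (1 / ?r) *\<^sub>R norm (?R t \<omega>))"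
        using infdist_nonneg[of "causal_op f t ?y \<omega>" "Y t \<omega>"] infdist_nonneg[of ?l "Y t \<omega>"] by simp
    qed
    also have "\<dots> \<le> Lnorm p M (?gY t) + Lnorm p M (\<lambda>\<omega>. (1 / ?r) *\<^sub>R norm (?R t \<omega>))"
      by (rule Lnorm_triangle[OF p gY sR])
    also have "Lnorm p M (\<lambda>\<omega>. (1 / ?r) *\<^sub>R norm (?R t \<omega>)) = (1 / ?r) * Lnorm p M (\<lambda>\<omega>. norm (?R t \<omega>))"
      using Lnorm_scale[OF p_pos, of M "1 / ?r" "\<lambda>\<omega>. norm (?R t \<omega>)"] by (simp del: of_nat_Suc)
    also have "Lnorm p M (\<lambda>\<omega>. norm (?R t \<omega>)) = Lnorm p M (?R t)" by (simp add: Lnorm_def)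
    finally show ?thesis .
  qed
  have partX: "Lnorm p M (\<lambda>\<omega>. infdist (?y t \<omega>) (X t \<omega>)) = Lnorm p M (?gX t)" for t
    by (simp add: convex_selection.gap_def[OF selection_X, abs_def] perturb_def)
  have "Lnorm p M (violation ?y)
      \<le> (\<Sum>t\<in>UNIV. Lnorm p M (\<lambda>\<omega>. infdist (causal_op f t ?y \<omega>) (Y t \<omega>) + infdist (?y t \<omega>) (X t \<omega>)))"
    unfolding violation_def[abs_def] by (intro Lnorm_sum_le p Lspace_add infY infX)
  also have "\<dots> \<le> (\<Sum>t\<in>UNIV. Lnorm p M (?gY t) + (1 / ?r) * Lnorm p M (?R t) + Lnorm p M (?gX t))"
  proof (rule sum_mono)
    fix t
    show "Lnorm p M (\<lambda>\<omega>. infdist (causal_op f t ?y \<omega>) (Y t \<omega>) + infdist (?y t \<omega>) (X t \<omega>))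
        \<le> Lnorm p M (?gY t) + (1 / ?r) * Lnorm p M (?R t) + Lnorm p M (?gX t)"
      using Lnorm_triangle[OF p infY[of t] infX[of t]] partY[of t] partX[of t] by linarith
  qed
  finally have "?r * Lnorm p M (violation ?y)
      \<le> ?r * (\<Sum>t\<in>UNIV. Lnorm p M (?gY t) + (1 / ?r) * Lnorm p M (?R t) + Lnorm p M (?gX t))"
    by (intro mult_left_mono) auto
  also have "\<dots> = (\<Sum>t\<in>UNIV. ?r * Lnorm p M (?gY t) + Lnorm p M (?R t) + ?r * Lnorm p M (?gX t))"
    by (simp add: sum_distrib_left distrib_left del: of_nat_Suc)
  finally show ?thesis .
qed

text \<open>
  Dominated convergence: the Lipschitz estimate bounds all quotients by one integrable function.
\<close>

lemma linearization_error_tendsto: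
  assumes v: "v \<in> pol"
  shows "(\<lambda>k. Lnorm p M (\<lambda>\<omega>. op_quotient x v k t \<omega> - linearized x v t \<omega>)) \<longlonglongrightarrow> 0"
proof -
  obtain L where L: "0 \<le> L"
    "AE \<omega> in M. Lipschitz_at L \<omega>"
    by (rule Lipschitz_AE)
  let ?V = "\<lambda>\<omega>. \<Sum>s\<in>UNIV. norm (v s \<omega>)"
  have V: "?V \<in> Lp" by (intro Lspace_sum Lspace_norm policiesD[OF v])
  show ?thesis
  proof (rule Lnorm_dominated_convergence[OF p_pos _ V, where C = "2 * L"])
    show "(\<lambda>\<omega>. op_quotient x v k t \<omega> - linearized x v t \<omega>) \<in> borel_measurable M" for k
      by (intro borel_measurable_diff measurable_op_quotient x_meas Lspace_measurable[OF policiesD[OF v]]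
          Lspace_measurable[OF linearized_Lspace[OF x_meas v]])
    show "AE \<omega> in M. (\<lambda>k. op_quotient x v k t \<omega> - linearized x v t \<omega>) \<longlonglongrightarrow> 0"
      using jac_AE[of x] by eventually_elim (simp add: LIM_zero)
    show "AE \<omega> in M. norm (op_quotient x v k t \<omega> - linearized x v t \<omega>) \<le> 2 * L * norm (?V \<omega>)" for k
      using L(2) jac_AE[of x]
    proof eventually_elim
      case (elim \<omega>)
      note quo = op_quotient_Lipschitz[OF elim(1) L(1), of x v _ t]
      have "(\<lambda>k. norm (op_quotient x v k t \<omega>)) \<longlonglongrightarrow> norm (linearized x v t \<omega>)"
        using elim(2) by (intro tendsto_norm) blast
      then have "norm (linearized x v t \<omega>) \<le> L * ?V \<omega>"
        by (rule LIMSEQ_le_const2) (use quo in auto)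
      moreover have "norm (?V \<omega>) = ?V \<omega>" by (simp add: sum_nonneg)
      ultimately show ?case
        using quo[of k] norm_triangle_ineq4[of "op_quotient x v k t \<omega>" "linearized x v t \<omega>"] by simp
    qed
  qed
qed

lemma Lipschitz_constant:
  obtains L where "Lipschitz_policy_functional p M \<phi> x L"
proof -
  obtain L where L: "\<And>y z. y \<in> pol \<Longrightarrow> z \<in> pol \<Longrightarrow> \<bar>\<phi> y - \<phi> z\<bar> \<le> L * policy_dist p M y z"
    using Lipschitz by (auto simp: Lipschitz_functional_def)
  have "\<bar>\<phi> y - \<phi> z\<bar> \<le> \<bar>L\<bar> * policy_dist p M y z" if "y \<in> pol" "z \<in> pol" for y z
  proof -
    have "L * policy_dist p M y z \<le> \<bar>L\<bar> * policy_dist p M y z"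
      unfolding policy_dist_def by (intro mult_right_mono policy_norm_nonneg) auto
    then show ?thesis using L[OF that] by simp
  qed
  then have "Lipschitz_policy_functional p M \<phi> x \<bar>L\<bar>"
    using p x_policy by unfold_locales auto
  then show ?thesis by (rule that)
qed

text \<open>
  The violation of the constraints is an exact penalty on the nonanticipative policies.  Along
  \<open>x + s v\<close>, repairing costs at most a constant times the norm of the violation, so a decrease of \<open>\<phi>\<close>
  that outweighs \<open>\<kappa>\<close> times the rate of the violation would survive the repair and contradict minimality.
\<close>

theorem directional_stationarity:
  "\<exists>\<kappa>\<ge>0. \<forall>v\<in>adapted. 0 \<le> clarke_rate p M \<phi> x v + \<kappa> * (rate_Y (linearized x v) + rate_X v)"
proof -
  obtain L where "Lipschitz_policy_functional p M \<phi> x L" by (rule Lipschitz_constant)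
  then interpret Lip: Lipschitz_policy_functional p M \<phi> x L .
  obtain K where K: "0 \<le> K"
    "\<And>y. y \<in> adapted \<Longrightarrow> \<exists>z\<in>feas. \<forall>t. AE \<omega> in M. norm (z t \<omega> - y t \<omega>) \<le> K * violation y \<omega>"
    using nonanticipative_error_bound[OF x_feas] by blast
  obtain \<epsilon> where \<epsilon>: "0 < \<epsilon>" "\<And>y. y \<in> feas \<Longrightarrow> policy_dist p M y x < \<epsilon> \<Longrightarrow> \<phi> x \<le> \<phi> y"
    using minimum by (auto simp: local_minimum_def)
  let ?T = "real CARD('t)"
  define \<kappa> where "\<kappa> = L * (?T * K)"
  have "0 \<le> clarke_rate p M \<phi> x v + \<kappa> * (rate_Y (linearized x v) + rate_X v)" if v: "v \<in> adapted" for v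
  proof -
    have vp: "v \<in> pol" using v by (simp add: adapted_iff)
    \<comment> \<open>\<open>B k\<close> bounds the norm of the violation relative to the step length \<open>s k\<close>.\<close>
    define B where "B k = (\<Sum>t\<in>UNIV.
        real (Suc k) * Lnorm p M (convex_selection.gap (Y t) (causal_op f t x) (linearized x v t) (1 / real (Suc k)))
      + Lnorm p M (\<lambda>\<omega>. op_quotient x v k t \<omega> - linearized x v t \<omega>)
      + real (Suc k) * Lnorm p M (convex_selection.gap (X t) (x t) (v t) (1 / real (Suc k))))" for k
    have "B \<longlonglongrightarrow> (\<Sum>t\<in>UNIV. dist_rate p M (Y t) (causal_op f t x) (linearized x v t) + 0
        + dist_rate p M (X t) (x t) (v t))"
      unfolding B_def
      by (intro tendsto_sum tendsto_add convex_selection.gap_quotient_tendsto[OF selection_Y]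
          convex_selection.gap_quotient_tendsto[OF selection_X] linearization_error_tendsto[OF vp]
          linearized_Lspace[OF x_meas vp] policiesD[OF vp])
    then have B: "B \<longlonglongrightarrow> rate_Y (linearized x v) + rate_X v"
      by (simp add: rate_X_def rate_Y_def sum.distrib)
    define s where "s k = 1 / real (Suc k)" for k
    have s: "0 < s k" for k by (simp add: s_def)
    have s0: "s \<longlonglongrightarrow> 0" unfolding s_def by (rule LIMSEQ_inverse_Suc)
    have yA: "perturb x k v \<in> adapted" for k
    proof -
      have "x + s k *\<^sub>R v \<in> adapted"
        using v feasibleD(5)[OF x_feas] by (intro subspace_add subspace_scale subspace_adapted)
      moreover have "x + s k *\<^sub>R v = perturb x k v" by (simp add: perturb_def s_def fun_eq_iff)
      ultimately show ?thesis by simp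
    qed
    have yp: "perturb x k v \<in> pol" for k using yA by (simp add: adapted_iff)
    have "\<forall>k. \<exists>z. z \<in> feas \<and>
        (\<forall>t. AE \<omega> in M. norm (z t \<omega> - perturb x k v t \<omega>) \<le> K * violation (perturb x k v) \<omega>)"
      using K(2)[OF yA] by blast
    from choice[OF this] obtain z where z: "\<And>k. z k \<in> feas"
      "\<And>k t. AE \<omega> in M. norm (z k t \<omega> - perturb x k v t \<omega>) \<le> K * violation (perturb x k v) \<omega>"
      by blast
    have zp: "z k \<in> pol" for k using feasibleD(1)[OF z(1)] by (simp add: policies_def)
    have dist_zy: "policy_dist p M (z k) (perturb x k v) \<le> ?T * K * (s k * B k)" for k
    proof -
      let ?y = "perturb x k v"
      have viol: "violation ?y \<in> Lp" by (rule Lspace_violation[OF x_feas policiesD[OF yp]])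
      have "policy_dist p M (z k) ?y \<le> (\<Sum>t\<in>UNIV. Lnorm p M (\<lambda>\<omega>. z k t \<omega> - ?y t \<omega>))"
        unfolding policy_dist_def by (rule policy_norm_le_sum_Lnorm[OF p])
      also have "\<dots> \<le> (\<Sum>t\<in>(UNIV :: 't set). K * Lnorm p M (violation ?y))"
      proof (rule sum_mono)
        fix t
        have "Lnorm p M (\<lambda>\<omega>. z k t \<omega> - ?y t \<omega>) \<le> Lnorm p M (\<lambda>\<omega>. K *\<^sub>R violation ?y \<omega>)"
        proof (rule Lnorm_mono[OF p_pos _ Lspace_scale[OF viol]])
          show "(\<lambda>\<omega>. z k t \<omega> - ?y t \<omega>) \<in> borel_measurable M"
            by (rule borel_measurable_diff[OF Lspace_measurable[OF policiesD[OF zp]] Lspace_measurable[OF policiesD[OF yp]]])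
          show "AE \<omega> in M. norm (z k t \<omega> - ?y t \<omega>) \<le> norm (K *\<^sub>R violation ?y \<omega>)"
            using z(2)[of k t] by eventually_elim (use K(1) violation_nonneg in \<open>simp add: abs_mult\<close>)
        qed
        also have "\<dots> = K * Lnorm p M (violation ?y)" using Lnorm_scale[OF p_pos, of M K "violation ?y"] K(1) by simp
        finally show "Lnorm p M (\<lambda>\<omega>. z k t \<omega> - ?y t \<omega>) \<le> K * Lnorm p M (violation ?y)" .
      qed
      also have "\<dots> = ?T * K * Lnorm p M (violation ?y)" by simp
      also have "\<dots> \<le> ?T * K * (s k * B k)"
      proof (intro mult_left_mono)
        have "real (Suc k) * Lnorm p M (violation ?y) \<le> B k"
          unfolding B_def by (rule violation_quotient_le[OF vp])
        then show "Lnorm p M (violation ?y) \<le> s k * B k" by (simp add: s_def field_simps del: of_nat_Suc)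
      qed (use K(1) in auto)
      finally show ?thesis .
    qed
    have near: "policy_dist p M (z k) x \<le> ?T * (?T * K * (s k * B k) + s k * policy_norm p M v)" for k
    proof -
      have "policy_dist p M (z k) x
          = policy_norm p M (\<lambda>t \<omega>. (z k t \<omega> - perturb x k v t \<omega>) + s k *\<^sub>R v t \<omega>)"
        by (simp add: policy_dist_def perturb_def s_def)
      also have "\<dots> \<le> ?T * (policy_dist p M (z k) (perturb x k v) + policy_norm p M (\<lambda>t \<omega>. s k *\<^sub>R v t \<omega>))"
        unfolding policy_dist_def by (intro policy_norm_triangle_weak p policies_diff policies_scale zp yp vp)
      also have "\<dots> \<le> ?T * (?T * K * (s k * B k) + s k * policy_norm p M v)"
        using dist_zy[of k] policy_norm_scale[OF p_pos, of M "s k" v] s[of k]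
        by (intro mult_left_mono add_mono) auto
      finally show ?thesis .
    qed
    have "(\<lambda>k. ?T * (?T * K * (s k * B k) + s k * policy_norm p M v))
        \<longlonglongrightarrow> ?T * (?T * K * (0 * (rate_Y (linearized x v) + rate_X v)) + 0 * policy_norm p M v)"
      by (intro tendsto_intros s0 B)
    then have "\<forall>\<^sub>F k in sequentially. ?T * (?T * K * (s k * B k) + s k * policy_norm p M v) < \<epsilon>"
      using order_tendstoD(2)[of _ 0 sequentially \<epsilon>] \<epsilon>(1) by simp
    then have le_z: "\<forall>\<^sub>F k in sequentially. \<phi> x \<le> \<phi> (z k)"
      by eventually_elim (use near z(1) \<epsilon>(2) in \<open>blast intro: le_less_trans\<close>)
    have bound: "0 \<le> c + \<kappa> * (rate_Y (linearized x v) + rate_X v)" if c: "clarke_rate p M \<phi> x v < c" for c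
    proof -
      obtain \<delta> where \<delta>: "0 < \<delta>" "\<And>y s. y \<in> pol \<Longrightarrow> policy_dist p M y x < \<delta> \<Longrightarrow>
          0 < s \<Longrightarrow> s < \<delta> \<Longrightarrow> (\<phi> (\<lambda>t \<omega>. y t \<omega> + s *\<^sub>R v t \<omega>) - \<phi> y) / s \<le> c"
        using Lip.clarke_bound_of_less[OF vp c] by (auto simp: clarke_bound_def)
      have "\<forall>\<^sub>F k in sequentially. s k < \<delta>" using order_tendstoD(2)[OF s0 \<delta>(1)] .
      then have "\<forall>\<^sub>F k in sequentially. 0 \<le> c + \<kappa> * B k"
        using le_z
      proof eventually_elim
        case (elim k)
        have "(\<phi> (perturb x k v) - \<phi> x) / s k \<le> c"
          using \<delta>(2)[OF x_policy, of "s k"] elim(1) s[of k] \<delta>(1) Lip.policy_dist_self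
          by (simp add: perturb_def s_def)
        then have "\<phi> (perturb x k v) - \<phi> x \<le> c * s k" using s[of k] by (simp add: divide_le_eq)
        moreover have "\<phi> (z k) - \<phi> (perturb x k v) \<le> L * (?T * K * (s k * B k))"
          using Lip.Lip[OF zp yp, of k k] mult_left_mono[OF dist_zy[of k] Lip.L] by linarith
        ultimately have "0 \<le> c * s k + L * (?T * K * (s k * B k))" using elim(2) by linarith
        also have "\<dots> = s k * (c + \<kappa> * B k)" by (simp add: \<kappa>_def algebra_simps)
        finally show ?case using s[of k] by (simp add: zero_le_mult_iff)
      qed
      moreover have "(\<lambda>k. c + \<kappa> * B k) \<longlonglongrightarrow> c + \<kappa> * (rate_Y (linearized x v) + rate_X v)"
        by (intro tendsto_intros B)
      ultimately show ?thesis by (intro tendsto_lowerbound) auto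
    qed
    have "- (\<kappa> * (rate_Y (linearized x v) + rate_X v)) \<le> clarke_rate p M \<phi> x v"
    proof (rule dense_ge)
      show "- (\<kappa> * (rate_Y (linearized x v) + rate_X v)) \<le> c" if "clarke_rate p M \<phi> x v < c" for c
        using bound[OF that] by linarith
    qed
    then show ?thesis by simp
  qed
  then show ?thesis using Lip.L K(1) by (intro exI[of _ \<kappa>]) (auto simp: \<kappa>_def)
qed

text \<open>
  The test policies vanish except at stage \<open>t\<close>, where they are the indicator of a set in \<open>F t\<close> times a
  unit vector.
\<close>

lemma vec_cond_exp_zero_of_annihilator:
  assumes lam: "\<And>t. lam t \<in> Lspace q M"
    and ann: "\<And>v. v \<in> adapted \<Longrightarrow> policy_pairing M lam v = 0"
  shows "AE \<omega> in M. vec_cond_exp M (F t) (lam t) \<omega> = 0"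
proof -
  have subM: "subalgebra M (F t)" by (rule subalg)
  interpret finite_measure_subalgebra M "F t"
    by (intro finite_measure_subalgebra.intro finite_measure_M finite_measure_subalgebra_axioms.intro subalg)
  have "AE \<omega> in M. real_cond_exp M (F t) (\<lambda>\<omega>. lam t \<omega> $ i) \<omega> = 0" for i
  proof (rule real_cond_exp_charact)
    have unit: "(\<lambda>_. axis i 1 :: real^'n) \<in> Lp"
      by (rule Lspace_bounded[OF finite_measure_M, where C = 1]) auto
    show "integrable M (\<lambda>\<omega>. lam t \<omega> $ i)"
      using integrable_inner_conjugate[OF p q lam[of t] unit] by (simp add: inner_axis)
    fix A assume A: "A \<in> sets (F t)"
    define v :: "'t \<Rightarrow> 'a \<Rightarrow> real^'n" where
      "v = (\<lambda>s \<omega>. if s = t then indicator A \<omega> *\<^sub>R axis i 1 else 0)"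
    have AM: "A \<in> sets M" using A subM by (auto simp: subalgebra_def)
    have "v \<in> adapted"
      unfolding adapted_iff
    proof (intro conjI allI)
      show "v \<in> pol"
        unfolding policies_def mem_Collect_eq
      proof
        fix s
        show "v s \<in> Lp"
          using AM by (intro Lspace_bounded[OF finite_measure_M, where C = 1]) (auto simp: v_def indicator_def)
      qed
      fix s
      have "v s \<in> borel_measurable (F s)" using A by (cases "s = t") (auto simp: v_def)
      then show "\<exists>g\<in>borel_measurable (F s). AE \<omega> in M. v s \<omega> = g \<omega>" by auto
    qed
    then have "0 = policy_pairing M lam v" using ann by simp
    also have "\<dots> = (\<Sum>s\<in>UNIV. if s = t then pairing M (lam t) (v t) else 0)"
      by (intro sum.cong) (auto simp: v_def pairing_zero)
    also have "\<dots> = (LINT \<omega>:A|M. lam t \<omega> $ i)"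
      by (simp add: pairing_def v_def set_lebesgue_integral_def inner_axis)
    finally show "(LINT \<omega>:A|M. lam t \<omega> $ i) = (LINT \<omega>:A|M. 0)" by (simp add: set_lebesgue_integral_def)
  qed auto
  then have "AE \<omega> in M. \<forall>i. real_cond_exp M (F t) (\<lambda>\<omega>. lam t \<omega> $ i) \<omega> = 0"
    by (simp add: AE_all_countable)
  then show ?thesis by eventually_elim (simp add: vec_cond_exp_def vec_eq_iff)
qed

lemma sublinear_dist_rate_sum:
  fixes S :: "'t \<Rightarrow> 'a \<Rightarrow> 'b::euclidean_space set" and a :: "'t \<Rightarrow> 'a \<Rightarrow> 'b"
  assumes "\<And>t. convex_selection p M (S t) (a t)"
  shows "sublinear_on (pol) (\<lambda>w. \<Sum>t\<in>(UNIV :: 't set). dist_rate p M (S t) (a t) (w t))"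
proof (rule sublinear_onI)
  fix v w :: "'t \<Rightarrow> 'a \<Rightarrow> 'b" assume vw: "v \<in> pol" "w \<in> pol"
  have "dist_rate p M (S t) (a t) ((v + w) t) \<le> dist_rate p M (S t) (a t) (v t) + dist_rate p M (S t) (a t) (w t)" for t
    using convex_selection.dist_rate_add[OF assms[of t] policiesD[OF vw(1), of t] policiesD[OF vw(2), of t]]
    by (simp add: plus_fun_def)
  then show "(\<Sum>t\<in>UNIV. dist_rate p M (S t) (a t) ((v + w) t))
      \<le> (\<Sum>t\<in>UNIV. dist_rate p M (S t) (a t) (v t)) + (\<Sum>t\<in>UNIV. dist_rate p M (S t) (a t) (w t))"
    unfolding sum.distrib[symmetric] by (rule sum_mono)
next
  fix c :: real and w :: "'t \<Rightarrow> 'a \<Rightarrow> 'b" assume c: "0 < c"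
  have "dist_rate p M (S t) (a t) ((c *\<^sub>R w) t) \<le> c * dist_rate p M (S t) (a t) (w t)" for t
    using convex_selection.dist_rate_scale[OF assms[of t] c, of "w t"] by (simp add: scaleR_fun_def)
  then show "(\<Sum>t\<in>UNIV. dist_rate p M (S t) (a t) ((c *\<^sub>R w) t))
      \<le> c * (\<Sum>t\<in>UNIV. dist_rate p M (S t) (a t) (w t))"
    unfolding sum_distrib_left by (rule sum_mono)
qed

text \<open>
  Test with the direction from \<open>a t\<close> to a selection \<open>z\<close> at stage \<open>t\<close> and zero at all other stages:
  no rate is positive there.
\<close>

lemma normal_cone_of_minorant:
  fixes S :: "'t \<Rightarrow> 'a \<Rightarrow> 'b::euclidean_space set" and a :: "'t \<Rightarrow> 'a \<Rightarrow> 'b"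
  assumes sel: "\<And>t. convex_selection p M (S t) (a t)" and \<psi>: "\<psi> \<in> policies q M" and \<kappa>: "0 \<le> \<kappa>"
    and le: "\<And>w. w \<in> pol \<Longrightarrow>
      policy_pairing M \<psi> w \<le> \<kappa> * (\<Sum>t\<in>(UNIV :: 't set). dist_rate p M (S t) (a t) (w t))"
  shows "\<psi> t \<in> normal_cone q M (Lselections (ennreal p) M (S t)) (a t)"
  unfolding normal_cone_def mem_Collect_eq
proof (intro conjI ballI policiesD[OF \<psi>])
  fix z assume z: "z \<in> Lselections (ennreal p) M (S t)"
  interpret at_t: convex_selection p M "S t" "a t" by (rule sel)
  let ?w = "\<lambda>s \<omega>. if s = t then z \<omega> - a t \<omega> else 0"
  have zL: "z \<in> Lspace (ennreal p) M" using z by (simp add: Lselections_def)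
  have w: "?w \<in> pol"
    unfolding policies_def mem_Collect_eq
  proof
    fix s show "?w s \<in> Lspace (ennreal p) M"
      using Lspace_diff[OF zL at_t.a] by (cases "s = t") (auto simp: Lspace_zero)
  qed
  have rate: "dist_rate p M (S s) (a s) (?w s) \<le> 0" for s
  proof (cases "s = t")
    case True
    then show ?thesis using at_t.dist_rate_selection[OF z] by simp
  next
    case False
    then show ?thesis
      using convex_selection.dist_rate_le_Lnorm[OF sel Lspace_zero, of s] by (simp add: Lnorm_zero)
  qed
  have "pairing M (\<psi> t) (\<lambda>\<omega>. z \<omega> - a t \<omega>) = (\<Sum>s\<in>UNIV. if s = t then pairing M (\<psi> t) (\<lambda>\<omega>. z \<omega> - a t \<omega>) else 0)"
    by simp
  also have "\<dots> = policy_pairing M \<psi> ?w"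
    by (intro sum.cong) (auto simp: pairing_zero)
  also have "\<dots> \<le> \<kappa> * (\<Sum>s\<in>UNIV. dist_rate p M (S s) (a s) (?w s))" by (rule le[OF w])
  also have "\<dots> \<le> 0" using \<kappa> rate by (intro mult_nonneg_nonpos sum_nonpos) auto
  finally show "pairing M (\<psi> t) (\<lambda>\<omega>. z \<omega> - a t \<omega>) \<le> 0" .
qed

lemma linearized_add: "linearized x (v + w) = linearized x v + linearized x w"
  by (auto simp: linearized_def fun_eq_iff matrix_vector_right_distrib sum.distrib)

lemma linearized_scale: "linearized x (c *\<^sub>R v) = c *\<^sub>R linearized x v"
  by (auto simp: linearized_def fun_eq_iff matrix_vector_mult_scaleR scaleR_sum_right)

text \<open>
  The three terms of the stationarity inequality depend on three directions, which are decoupled to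
  form a sublinear functional on triples \<open>(v, w, u)\<close>.  The inequality says that it is nonnegative
  on the subspace of the triples \<open>(v, linearized x v, v)\<close> with nonanticipative \<open>v\<close>.  A linear minorant that
  vanishes on this subspace is a sum of one functional of each direction, and each of them lies below
  one of the three terms.
\<close>

theorem separated_multipliers:
  "\<exists>g\<in>policies q M. \<exists>\<psi>\<in>policies q M. \<exists>\<nu>\<in>policies q M.
     g \<in> clarke_subdifferential p q M \<phi> x \<and>
     (\<forall>t. \<psi> t \<in> normal_cone q M (Lselections (ennreal p) M (Y t)) (causal_op f t x)) \<and>
     (\<forall>t. \<nu> t \<in> normal_cone q M (Lselections (ennreal p) M (X t)) (x t)) \<and>
     (\<forall>v\<in>adapted. policy_pairing M g v + policy_pairing M \<psi> (linearized x v)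
        + policy_pairing M \<nu> v = 0)"
proof -
  let ?Pn = "pol :: ('t \<Rightarrow> 'a \<Rightarrow> real^'n) set"
  let ?Pm = "pol :: ('t \<Rightarrow> 'a \<Rightarrow> real^'m) set"
  obtain \<kappa> where \<kappa>: "0 \<le> \<kappa>"
    "\<And>v. v \<in> adapted \<Longrightarrow> 0 \<le> clarke_rate p M \<phi> x v + \<kappa> * (rate_Y (linearized x v) + rate_X v)"
    using directional_stationarity by blast
  obtain L where "Lipschitz_policy_functional p M \<phi> x L" by (rule Lipschitz_constant)
  then interpret Lip: Lipschitz_policy_functional p M \<phi> x L .
  have subX: "sublinear_on ?Pn rate_X" unfolding rate_X_def[abs_def] by (rule sublinear_dist_rate_sum[OF selection_X])
  have subY: "sublinear_on ?Pm rate_Y" unfolding rate_Y_def[abs_def] by (rule sublinear_dist_rate_sum[OF selection_Y])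
  note subC = Lip.sublinear_clarke_rate
  have zero: "rate_X 0 = 0" "rate_Y 0 = 0" "clarke_rate p M \<phi> x 0 = 0"
    using sublinear_on_zero[OF subX subspace_policies] sublinear_on_zero[OF subY subspace_policies]
      sublinear_on_zero[OF subC subspace_policies] by auto
  define E where "E = ?Pn \<times> ?Pm \<times> ?Pn"
  define S where "S = (\<lambda>(v, w, u). clarke_rate p M \<phi> x v + \<kappa> * (rate_Y w + rate_X u))"
  define N where "N = (\<lambda>v. (v, linearized x v, v)) ` adapted"
  have E: "subspace E" unfolding E_def by (intro subspace_Times subspace_policies)
  have S: "sublinear_on E S"
  proof (rule sublinear_onI)
    fix a b assume "a \<in> E" "b \<in> E"
    then obtain v w u v' w' u' where ab: "a = (v, w, u)" "b = (v', w', u')"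
      "v \<in> ?Pn" "w \<in> ?Pm" "u \<in> ?Pn" "v' \<in> ?Pn" "w' \<in> ?Pm" "u' \<in> ?Pn" by (auto simp: E_def)
    have "\<kappa> * (rate_Y (w + w') + rate_X (u + u')) \<le> \<kappa> * ((rate_Y w + rate_Y w') + (rate_X u + rate_X u'))"
      using ab by (intro mult_left_mono \<kappa>(1) add_mono sublinear_on_add[OF subX] sublinear_on_add[OF subY])
    moreover have "clarke_rate p M \<phi> x (v + v') \<le> clarke_rate p M \<phi> x v + clarke_rate p M \<phi> x v'"
      using ab by (intro sublinear_on_add[OF subC])
    ultimately show "S (a + b) \<le> S a + S b" by (simp add: S_def ab algebra_simps)
  next
    fix c :: real and a assume c: "0 < c" and "a \<in> E"
    then obtain v w u where a: "a = (v, w, u)" "v \<in> ?Pn" "w \<in> ?Pm" "u \<in> ?Pn" by (auto simp: E_def)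
    show "S (c *\<^sub>R a) \<le> c * S a"
      using sublinear_on_scale[OF subC subspace_policies c a(2)] sublinear_on_scale[OF subY subspace_policies c a(3)]
        sublinear_on_scale[OF subX subspace_policies c a(4)]
      by (simp add: S_def a algebra_simps)
  qed
  have N: "subspace N"
  proof -
    have "linear (\<lambda>v. (v, linearized x v, v))"
      by (rule linearI) (simp_all add: linearized_add linearized_scale)
    then show ?thesis unfolding N_def using subspace_adapted by (rule linear_subspace_image)
  qed
  have NE: "N \<subseteq> E"
    by (auto simp: N_def E_def adapted_iff policies_def intro: linearized_Lspace[OF x_meas])
  have "0 \<le> S n" if "n \<in> N" for n using that \<kappa>(2) by (auto simp: N_def S_def)
  then obtain \<Lambda> where \<Lambda>: "linear \<Lambda>" "\<And>a. a \<in> E \<Longrightarrow> \<Lambda> a \<le> S a" "\<And>a. a \<in> N \<Longrightarrow> \<Lambda> a = 0"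
    using Hahn_Banach_annihilating[OF E S N NE] by blast
  have P0: "0 \<in> ?Pn" "0 \<in> ?Pm" using subspace_0[OF subspace_policies] by auto
  define \<Lambda>g where "\<Lambda>g v = \<Lambda> (v, 0, 0)" for v
  define \<Lambda>\<psi> where "\<Lambda>\<psi> w = \<Lambda> (0, w, 0)" for w
  define \<Lambda>\<nu> where "\<Lambda>\<nu> u = \<Lambda> (0, 0, u)" for u
  have \<Lambda>_scale: "c * \<Lambda> a = \<Lambda> (c *\<^sub>R a)" for c a using linear_scale[OF \<Lambda>(1), of c a] by simp
  have lin: "linear \<Lambda>g" "linear \<Lambda>\<psi>" "linear \<Lambda>\<nu>"
    by (auto intro!: linearI simp: \<Lambda>g_def \<Lambda>\<psi>_def \<Lambda>\<nu>_def linear_add[OF \<Lambda>(1), symmetric] \<Lambda>_scale)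
  have le_g: "\<Lambda>g v \<le> clarke_rate p M \<phi> x v" if "v \<in> ?Pn" for v
    using \<Lambda>(2)[of "(v, 0, 0)"] that P0 zero by (simp add: \<Lambda>g_def E_def S_def)
  have le_\<psi>: "\<Lambda>\<psi> w \<le> \<kappa> * rate_Y w" if "w \<in> ?Pm" for w
    using \<Lambda>(2)[of "(0, w, 0)"] that P0 zero by (simp add: \<Lambda>\<psi>_def E_def S_def)
  have le_\<nu>: "\<Lambda>\<nu> u \<le> \<kappa> * rate_X u" if "u \<in> ?Pn" for u
    using \<Lambda>(2)[of "(0, 0, u)"] that P0 zero by (simp add: \<Lambda>\<nu>_def E_def S_def)
  have "\<exists>g\<in>policies q M. \<forall>v\<in>?Pn. \<Lambda>g v = policy_pairing M g v"
  proof (rule policy_functional_representation[OF finite_measure_M p q lin(1)])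
    fix v assume v: "v \<in> ?Pn"
    have "\<Lambda>g v \<le> L * policy_norm p M v" using le_g[OF v] Lip.clarke_rate_le_norm[OF v] by simp
    also have "\<dots> \<le> L * (\<Sum>t\<in>UNIV. Lnorm p M (v t))"
      by (intro mult_left_mono policy_norm_le_sum_Lnorm p Lip.L)
    finally show "\<Lambda>g v \<le> L * (\<Sum>t\<in>UNIV. Lnorm p M (v t))" .
  qed
  then obtain g where g: "g \<in> policies q M" "\<And>v. v \<in> ?Pn \<Longrightarrow> \<Lambda>g v = policy_pairing M g v" by blast
  have "\<exists>\<psi>\<in>policies q M. \<forall>w\<in>?Pm. \<Lambda>\<psi> w = policy_pairing M \<psi> w"
  proof (rule policy_functional_representation[OF finite_measure_M p q lin(2)])
    fix w assume w: "w \<in> ?Pm"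
    have "\<kappa> * rate_Y w \<le> \<kappa> * (\<Sum>t\<in>UNIV. Lnorm p M (w t))"
      unfolding rate_Y_def
      by (intro mult_left_mono sum_mono \<kappa>(1) convex_selection.dist_rate_le_Lnorm[OF selection_Y] policiesD[OF w])
    then show "\<Lambda>\<psi> w \<le> \<kappa> * (\<Sum>t\<in>UNIV. Lnorm p M (w t))" using le_\<psi>[OF w] by simp
  qed
  then obtain \<psi> where \<psi>: "\<psi> \<in> policies q M" "\<And>w. w \<in> ?Pm \<Longrightarrow> \<Lambda>\<psi> w = policy_pairing M \<psi> w" by blast
  have "\<exists>\<nu>\<in>policies q M. \<forall>u\<in>?Pn. \<Lambda>\<nu> u = policy_pairing M \<nu> u"
  proof (rule policy_functional_representation[OF finite_measure_M p q lin(3)])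
    fix u assume u: "u \<in> ?Pn"
    have "\<kappa> * rate_X u \<le> \<kappa> * (\<Sum>t\<in>UNIV. Lnorm p M (u t))"
      unfolding rate_X_def
      by (intro mult_left_mono sum_mono \<kappa>(1) convex_selection.dist_rate_le_Lnorm[OF selection_X] policiesD[OF u])
    then show "\<Lambda>\<nu> u \<le> \<kappa> * (\<Sum>t\<in>UNIV. Lnorm p M (u t))" using le_\<nu>[OF u] by simp
  qed
  then obtain \<nu> where \<nu>: "\<nu> \<in> policies q M" "\<And>u. u \<in> ?Pn \<Longrightarrow> \<Lambda>\<nu> u = policy_pairing M \<nu> u" by blast
  have "g \<in> clarke_subdifferential p q M \<phi> x"
    unfolding clarke_subdifferential_def mem_Collect_eq
  proof (intro conjI ballI g(1))
    fix v assume v: "v \<in> ?Pn"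
    have "ereal (policy_pairing M g v) \<le> ereal (clarke_rate p M \<phi> x v)"
      using le_g[OF v] g(2)[OF v] by simp
    also have "\<dots> \<le> clarke_derivative p M \<phi> x v" by (rule Lip.clarke_rate_le_clarke_derivative[OF v])
    finally show "ereal (policy_pairing M g v) \<le> clarke_derivative p M \<phi> x v" .
  qed
  moreover have "\<psi> t \<in> normal_cone q M (Lselections (ennreal p) M (Y t)) (causal_op f t x)" for t
    by (rule normal_cone_of_minorant[OF selection_Y \<psi>(1) \<kappa>(1)])
       (use le_\<psi> \<psi>(2) in \<open>auto simp: rate_Y_def\<close>)
  moreover have "\<nu> t \<in> normal_cone q M (Lselections (ennreal p) M (X t)) (x t)" for t
    by (rule normal_cone_of_minorant[OF selection_X \<nu>(1) \<kappa>(1)])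
       (use le_\<nu> \<nu>(2) in \<open>auto simp: rate_X_def\<close>)
  moreover have "policy_pairing M g v + policy_pairing M \<psi> (linearized x v)
        + policy_pairing M \<nu> v = 0" if v: "v \<in> adapted" for v
  proof -
    have vE: "v \<in> ?Pn" "linearized x v \<in> ?Pm" using NE v by (auto simp: N_def E_def)
    have "(v, linearized x v, v) = (v, 0, 0) + (0, linearized x v, 0) + (0, 0, v)" by simp
    then have "\<Lambda> (v, linearized x v, v) = \<Lambda>g v + \<Lambda>\<psi> (linearized x v) + \<Lambda>\<nu> v"
      unfolding \<Lambda>g_def \<Lambda>\<psi>_def \<Lambda>\<nu>_def by (simp only: linear_add[OF \<Lambda>(1)])
    moreover have "\<Lambda> (v, linearized x v, v) = 0" using v by (intro \<Lambda>(3)) (auto simp: N_def)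
    ultimately show ?thesis using g(2) \<psi>(2) \<nu>(2) vE by simp
  qed
  ultimately show ?thesis using g(1) \<psi>(1) \<nu>(1) by blast
qed

text \<open>
  Moving the Jacobians to the other side of the pairing turns the annihilation property into a
  statement on one family \<open>lam\<close>; causality restricts the adjoint sum to the stages \<open>l \<ge> t\<close>.
\<close>

theorem optimality_conditions:
  "\<exists>g lam \<psi> \<nu>.
     g \<in> clarke_subdifferential p q M \<phi> x \<and>
     (\<forall>t. lam t \<in> Lspace q M) \<and>
     (\<forall>t. \<psi> t \<in> normal_cone q M (Lselections (ennreal p) M (Y t)) (causal_op f t x)) \<and>
     (\<forall>t. \<nu> t \<in> normal_cone q M (Lselections (ennreal p) M (X t)) (x t)) \<and>
     (AE \<omega> in M. \<forall>t.
        g t \<omega> + lam t \<omega>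
          + (\<Sum>l\<in>{t..}. transpose (jacobian_block f x l t \<omega>) *v \<psi> l \<omega>) + \<nu> t \<omega> = 0 \<and>
        vec_cond_exp M (F t) (lam t) \<omega> = 0)"
proof -
  obtain g \<psi> \<nu> where g: "g \<in> policies q M" and \<psi>: "\<psi> \<in> policies q M" and \<nu>: "\<nu> \<in> policies q M"
    and clarke: "g \<in> clarke_subdifferential p q M \<phi> x"
    and normal: "\<And>t. \<psi> t \<in> normal_cone q M (Lselections (ennreal p) M (Y t)) (causal_op f t x)"
      "\<And>t. \<nu> t \<in> normal_cone q M (Lselections (ennreal p) M (X t)) (x t)"
    and ann: "\<And>v. v \<in> adapted \<Longrightarrow> policy_pairing M g v
        + policy_pairing M \<psi> (linearized x v) + policy_pairing M \<nu> v = 0"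
    using separated_multipliers by blast
  define adj where "adj t \<omega> = (\<Sum>l\<in>{t..}. transpose (jac x l t \<omega>) *v \<psi> l \<omega>)" for t \<omega>
  define lam where "lam t \<omega> = - (g t \<omega> + adj t \<omega> + \<nu> t \<omega>)" for t \<omega>
  obtain L where L: "0 \<le> L" "AE \<omega> in M. \<forall>t l u. norm (jac x t l \<omega> *v u) \<le> L * norm u"
    by (rule jac_bound_AE)
  have adj: "adj t \<in> Lspace q M" for t
  proof -
    have "(\<lambda>\<omega>. \<Sum>l\<in>{t..}. transpose (jac x l t \<omega>) *v \<psi> l \<omega>) \<in> Lspace q M"
    proof (rule Lspace_sum)
      fix l
      show "(\<lambda>\<omega>. transpose (jac x l t \<omega>) *v \<psi> l \<omega>) \<in> Lspace q M"
      proof (rule Lspace_dominated[OF policiesD[OF \<psi>, of l], where C = L])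
        show "(\<lambda>\<omega>. transpose (jac x l t \<omega>) *v \<psi> l \<omega>) \<in> borel_measurable M"
          by (intro borel_measurable_matrix_vector_mult borel_measurable_transpose measurable_jac x_meas
              Lspace_measurable[OF policiesD[OF \<psi>]])
        show "AE \<omega> in M. norm (transpose (jac x l t \<omega>) *v \<psi> l \<omega>) \<le> L * norm (\<psi> l \<omega>)"
          using L(2) by eventually_elim (intro norm_transpose_mult_le, blast)
      qed
    qed
    then show ?thesis by (simp add: adj_def[abs_def])
  qed
  have lam: "lam t \<in> Lspace q M" for t
    unfolding lam_def[abs_def]
    by (intro Lspace_uminus Lspace_add policiesD[OF g] policiesD[OF \<nu>] adj)
  have "policy_pairing M lam v = 0" if v: "v \<in> adapted" for v
  proof -
    have vp: "v \<in> pol" using v by (simp add: adapted_iff)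
    have int: "integrable M (\<lambda>\<omega>. h t \<omega> \<bullet> v t \<omega>)" if "\<And>t. h t \<in> Lspace q M" for h t
      using integrable_inner_conjugate[OF p q that policiesD[OF vp]] .
    have int\<psi>: "integrable M (\<lambda>\<omega>. \<psi> t \<omega> \<bullet> linearized x v t \<omega>)" for t
      using integrable_inner_conjugate[OF p q policiesD[OF \<psi>] linearized_Lspace[OF x_meas vp]] .
    have swap: "(\<Sum>t\<in>UNIV. adj t \<omega> \<bullet> v t \<omega>) = (\<Sum>t\<in>UNIV. \<psi> t \<omega> \<bullet> linearized x v t \<omega>)"
      if \<omega>: "\<omega> \<in> space M" for \<omega>
    proof -
      have "adj t \<omega> \<bullet> v t \<omega> = (\<Sum>l\<in>UNIV. \<psi> l \<omega> \<bullet> (jac x l t \<omega> *v v t \<omega>))" for t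
      proof -
        have "adj t \<omega> \<bullet> v t \<omega> = (\<Sum>l\<in>{t..}. \<psi> l \<omega> \<bullet> (jac x l t \<omega> *v v t \<omega>))"
          unfolding adj_def inner_sum_left transpose_inner ..
        also have "\<dots> = (\<Sum>l\<in>UNIV. \<psi> l \<omega> \<bullet> (jac x l t \<omega> *v v t \<omega>))"
          by (rule sum.mono_neutral_left) (auto simp: jac_eq_0[OF \<omega>] not_le)
        finally show ?thesis .
      qed
      then have "(\<Sum>t\<in>UNIV. adj t \<omega> \<bullet> v t \<omega>) = (\<Sum>t\<in>UNIV. \<Sum>l\<in>UNIV. \<psi> l \<omega> \<bullet> (jac x l t \<omega> *v v t \<omega>))" by simp
      also have "\<dots> = (\<Sum>l\<in>UNIV. \<Sum>t\<in>UNIV. \<psi> l \<omega> \<bullet> (jac x l t \<omega> *v v t \<omega>))" by (rule sum.swap)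
      also have "\<dots> = (\<Sum>l\<in>UNIV. \<psi> l \<omega> \<bullet> linearized x v l \<omega>)" by (simp add: linearized_def inner_sum_right)
      finally show ?thesis .
    qed
    have "policy_pairing M adj v = (LINT \<omega>|M. (\<Sum>t\<in>UNIV. adj t \<omega> \<bullet> v t \<omega>))"
      unfolding pairing_def using int[of adj, OF adj] by (intro Bochner_Integration.integral_sum[symmetric])
    also have "\<dots> = (LINT \<omega>|M. (\<Sum>t\<in>UNIV. \<psi> t \<omega> \<bullet> linearized x v t \<omega>))"
      using swap by (intro Bochner_Integration.integral_cong) auto
    also have "\<dots> = policy_pairing M \<psi> (linearized x v)"
      unfolding pairing_def using int\<psi> by (intro Bochner_Integration.integral_sum)
    finally have adj_eq: "policy_pairing M adj v = policy_pairing M \<psi> (linearized x v)" .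
    have "pairing M (lam t) (v t) = - (pairing M (g t) (v t) + pairing M (adj t) (v t) + pairing M (\<nu> t) (v t))" for t
      using int[of g, OF policiesD[OF g]] int[of adj, OF adj] int[of \<nu>, OF policiesD[OF \<nu>]]
      by (simp add: pairing_def lam_def inner_diff_left inner_add_left)
    then show ?thesis using ann[OF v] adj_eq by (simp add: sum_negf sum.distrib sum_subtractf)
  qed
  then have cond: "AE \<omega> in M. \<forall>t. vec_cond_exp M (F t) (lam t) \<omega> = 0"
    using vec_cond_exp_zero_of_annihilator[of lam, OF lam] by (simp add: AE_all_countable)
  have "AE \<omega> in M. \<forall>t. g t \<omega> + lam t \<omega>
          + (\<Sum>l\<in>{t..}. transpose (jacobian_block f x l t \<omega>) *v \<psi> l \<omega>) + \<nu> t \<omega> = 0 \<and>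
        vec_cond_exp M (F t) (lam t) \<omega> = 0"
    using cond jac_AE[of x]
  proof eventually_elim
    case (elim \<omega>)
    then have "adj t \<omega> = (\<Sum>l\<in>{t..}. transpose (jacobian_block f x l t \<omega>) *v \<psi> l \<omega>)" for t
      by (simp add: adj_def)
    then show ?case using elim(1) by (simp add: lam_def)
  qed
  then show ?thesis using clarke normal lam by blast
qed

end

theorem theorem4p5:
  fixes M :: "'a measure"
    and F :: "'t::{finite,linorder} \<Rightarrow> 'a measure"
    and p :: real and q :: ennreal
    and f :: "'t \<Rightarrow> (real^'n, 't) vec \<Rightarrow> 'a \<Rightarrow> real^'m"
    and X :: "'t \<Rightarrow> 'a \<Rightarrow> (real^'n) set"
    and Y :: "'t \<Rightarrow> 'a \<Rightarrow> (real^'m) set"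
    and \<phi> \<phi>' :: "('t \<Rightarrow> 'a \<Rightarrow> real^'n) \<Rightarrow> real"
    and x :: "'t \<Rightarrow> 'a \<Rightarrow> real^'n"
  assumes "prob_space M"
    and "stage_filtration M F"
    and "1 \<le> p" and "1 / ennreal p + 1 / q = 1"
    and "causal M F f"
    and "smoothness_assumption (ennreal p) M F f"
    and "\<And>t. convex_closed_multifunction (F t) (Y t)"
    and "\<And>t. convex_closed_multifunction (F t) (X t)"
    and "Lipschitz_functional p M (adapted_policies (ennreal p) M F) \<phi>"
    and "Lipschitz_functional p M (policies (ennreal p) M) \<phi>'"
    and "is_extension (ennreal p) M F \<phi>' \<phi>"
    and "complete_subregular_recourse M f X Y"
    and "local_minimum p M \<phi>' (feasible (ennreal p) M F f X Y) x"
  shows "\<exists>g lam \<psi> \<nu>.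
     g \<in> clarke_subdifferential p q M \<phi>' x \<and>
     (\<forall>t. lam t \<in> Lspace q M) \<and>
     (\<forall>t. \<psi> t \<in> normal_cone q M (Lselections (ennreal p) M (Y t)) (causal_op f t x)) \<and>
     (\<forall>t. \<nu> t \<in> normal_cone q M (Lselections (ennreal p) M (X t)) (x t)) \<and>
     (AE \<omega> in M. \<forall>t.
        g t \<omega> + lam t \<omega>
          + (\<Sum>l\<in>{t..}. transpose (jacobian_block f x l t \<omega>) *v \<psi> l \<omega>) + \<nu> t \<omega> = 0 \<and>
        vec_cond_exp M (F t) (lam t) \<omega> = 0)"
proof -
  interpret multistage_optimum M F p f X Y q \<phi>' x
    by (intro multistage_optimum.intro multistage_recourse.intro multistage_optimum_axioms.intro assms)
  show ?thesis by (rule optimality_conditions)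
qed

end
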